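(* Let $G=(V,E)$ be a (finite or infinite) graph without isolated edge. Then there exists a function $\omega\colon E\to\{1,2,3\}$ such that for every edge $uv\in E$, either $s_\omega(u)\neq s_\omega(v)$, or $u$ and $v$ have the same infinite degree.
   Context: Graphs are simple and may be infinite (of arbitrary cardinality); an isolated edge is a connected component isomorphic to $K_2$. For an edge weighting $\omega\colon E\to\{1,2,3\}$, the weighted degree of a vertex $v$ is $s_\omega(v)=\sum_{w\in N(v)}\omega(vw)$, where $N(v)$ is the set of neighbours of $v$. If $v$ has finite degree this is a natural number; if $v$ has infinite degree $\kappa$, the sum of the positive integer weights is the cardinal $\kappa$, i.e. $s_\omega(v)$ equals the degree of $v$. *)

theory Defs
  imports Main "HOL-Library.Equipollence"
begin

definition simple_graph :: "'a set \<Rightarrow> 'a set set \<Rightarrow> bool" where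
  "simple_graph V E \<longleftrightarrow> (\<forall>e\<in>E. e \<subseteq> V \<and> card e = 2)"

definition nbhd :: "'a set set \<Rightarrow> 'a \<Rightarrow> 'a set" where
  "nbhd E v = {w. {v, w} \<in> E}"

definition has_isolated_edge :: "'a set set \<Rightarrow> bool" where
  "has_isolated_edge E \<longleftrightarrow> (\<exists>u v. {u, v} \<in> E \<and> nbhd E u = {v} \<and> nbhd E v = {u})"

definition wsum :: "'a set set \<Rightarrow> ('a set \<Rightarrow> nat) \<Rightarrow> 'a \<Rightarrow> nat" where
  "wsum E \<omega> v = (\<Sum>w\<in>nbhd E v. \<omega> {v, w})"

text \<open>Equality of weighted degrees s_omega(u) = s_omega(v): for finite degree s is the
natural number wsum; for infinite degree s is the cardinal of the neighbourhood.
Natural numbers and infinite cardinals are never equal.\<close>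
definition same_wdeg :: "'a set set \<Rightarrow> ('a set \<Rightarrow> nat) \<Rightarrow> 'a \<Rightarrow> 'a \<Rightarrow> bool" where
  "same_wdeg E \<omega> u v \<longleftrightarrow>
     (finite (nbhd E u) \<and> finite (nbhd E v) \<and> wsum E \<omega> u = wsum E \<omega> v) \<or>
     (infinite (nbhd E u) \<and> infinite (nbhd E v) \<and> nbhd E u \<approx> nbhd E v)"

end

theory Submission
  imports Defs "HOL-Analysis.Function_Topology"
begin

text \<open>Write the weights as \<open>2 + \<eta>\<close> with \<open>\<eta>\<close> in \<open>{-1, 0, 1}\<close>. Split the vertices of a finite connected graph
  into an independent set \<open>R\<close> of red vertices and a set \<open>B\<close> of blue ones such that the bipartite graph
  between \<open>R\<close> and \<open>B\<close> is connected. The red vertices are to get even weighted degrees, the blue ones odd.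
  For a maximum cut of the graph induced on \<open>B\<close>, any prescription of flow values in \<open>{-1, 0, 1}\<close> on the non-cut
  edges extends to a circulation whose values on the cut edges are also in \<open>{-1, 0, 1}\<close>. Used as changes of weights,
  such circulations let every blue vertex avoid the weighted degrees of its earlier neighbours on its own side,
  while the two sides are kept apart modulo 4; this works as soon as the edges from a blue vertex to \<open>R\<close>
  contribute \<open>\<eta>\<close>-sum \<open>1\<close> or \<open>-1\<close>, as dictated by the choice just made.
  Since the bipartite graph is connected, these sums are attainable together with even sums at the red vertices
  precisely if \<open>B\<close> has an even number of elements.

  If \<open>B\<close> has an odd number of elements, one vertex, chosen as far as possible from a fixed red vertex, is
  exempted from the parity rule, and the freedom that is left is used to separate it from its neighbours.

  Infinite graphs reduce to finite ones by Tychonoff's theorem, since only edges between vertices of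
  finite degree impose a condition and each such condition concerns finitely many weights.\<close>

section \<open>Maximum cuts and flows\<close>

text \<open>Parity is the main obstacle. Every edge of the bipartite graph has one red and one blue
  end, so the red and the blue \<open>\<eta>\<close>-sums have the same total; odd blue and even red
  sums force an even number of blue vertices. Values in \<open>{-1, 0, 1}\<close> suffice on the cut
  edges because switching sides in a maximum cut cannot gain: at least as many cut as non-cut edges
  leave any vertex set, which is the feasibility condition for unit capacities. The modulus 4 comes
  from a count: a vertex with \<open>i\<close> earlier neighbours on its side can reach every odd
  number within \<open>2 * i + 1\<close> of twice its degree, and these include \<open>i + 1\<close>
  members of each of the classes 1 and 3, one more than the forbidden values. An exempted vertex
  usually becomes even, so that only its red neighbours can collide with it. Two or more of them
  leave a suitable sign pattern; with a single one, in minimum degree two, it takes a triangle, a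
  recolouring or a second exempted vertex. Working at maximal distance keeps the rest
  connected.\<close>

lemma rtranclp_distinct_list:
  assumes "r\<^sup>*\<^sup>* u v"
  shows "\<exists>xs. xs \<noteq> [] \<and> hd xs = u \<and> last xs = v \<and> distinct xs \<and> successively r xs"
  using assms
proof (induction rule: rtranclp_induct)
  case base
  then show ?case by (intro exI[of _ "[u]"]) auto
next
  case (step v w)
  then obtain xs where xs: "xs \<noteq> []" "hd xs = u" "last xs = v" "distinct xs" "successively r xs" by blast
  show ?case
  proof (cases "w \<in> set xs")
    case True
    then obtain ys zs where "xs = ys @ w # zs" by (meson split_list)
    with xs show ?thesis
      by (intro exI[of _ "ys @ [w]"]) (auto simp: successively_append_iff hd_append split: if_splits)
  next
    case False
    with xs step show ?thesis
      by (intro exI[of _ "xs @ [w]"]) (auto simp: successively_append_iff)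
  qed
qed

text \<open>Antisymmetry turns the single bound into \<open>-1 \<le> f u v \<le> 1\<close>: an
  integral flow with unit capacities on the edges of \<open>r\<close> inside
  \<open>B\<close>.\<close>

definition is_flow :: "'a set \<Rightarrow> ('a \<Rightarrow> 'a \<Rightarrow> bool) \<Rightarrow> ('a \<Rightarrow> 'a \<Rightarrow> int) \<Rightarrow> bool" where
  "is_flow B r f \<longleftrightarrow> (\<forall>u v. f u v = - f v u \<and> f u v \<le> 1 \<and> (f u v \<noteq> 0 \<longrightarrow> r u v \<and> u \<in> B \<and> v \<in> B))"

lemma is_flow_push:
  assumes "finite B" "is_flow B r f" "u \<in> B" "v \<in> B" "u \<noteq> v" "r u v" "r v u" "f u v < 1"
  defines "f' \<equiv> (\<lambda>a b. f a b + (if a = u \<and> b = v then 1 else 0) - (if a = v \<and> b = u then 1 else 0))"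
  shows "is_flow B r f'"
    and "(\<Sum>b\<in>B. f' w b) = (\<Sum>b\<in>B. f w b) + (if w = u then 1 else 0) - (if w = v then 1 else 0)"
proof -
  show "is_flow B r f'"
    unfolding is_flow_def
  proof (intro allI conjI impI)
    fix a b
    have f: "f a b = - f b a" "f a b \<le> 1" "f a b \<noteq> 0 \<Longrightarrow> r a b \<and> a \<in> B \<and> b \<in> B" for a b
      using assms(2) unfolding is_flow_def by blast+
    show "f' a b = - f' b a" unfolding f'_def using f(1)[of a b] by (smt (verit))
    show "f' a b \<le> 1" unfolding f'_def using f(2)[of a b] \<open>f u v < 1\<close> by (smt (verit))
    show "r a b" "a \<in> B" "b \<in> B" if "f' a b \<noteq> 0"
      using that f(3)[of a b] assms by (auto simp: f'_def split: if_splits)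
  qed
  show "(\<Sum>b\<in>B. f' w b) = (\<Sum>b\<in>B. f w b) + (if w = u then 1 else 0) - (if w = v then 1 else 0)"
    using assms(1,3,4,5) by (auto simp: f'_def sum.distrib sum_subtractf)
qed

text \<open>One unit is pushed along the path edge by edge. Since no vertex is repeated, the first
  push does not change \<open>f\<close> between the later vertices, so their residual capacity
  survives; this is why distinct vertices are required.\<close>

lemma is_flow_augment:
  assumes "finite B" "\<And>a b. r a b \<Longrightarrow> r b a" "xs \<noteq> []" "distinct xs" "set xs \<subseteq> B" "is_flow B r f"
    "successively (\<lambda>a b. r a b \<and> f a b < 1) xs"
  shows "\<exists>f'. is_flow B r f' \<and> (\<forall>w. (\<Sum>b\<in>B. f' w b) =
           (\<Sum>b\<in>B. f w b) + (if w = hd xs then 1 else 0) - (if w = last xs then 1 else 0))"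
  using assms(3-)
proof (induction xs arbitrary: f)
  case Nil
  then show ?case by simp
next
  case (Cons u ys)
  show ?case
  proof (cases ys)
    case Nil
    with Cons show ?thesis by (intro exI[of _ f]) auto
  next
    case (Cons v zs)
    define f1 where "f1 = (\<lambda>a b. f a b + (if a = u \<and> b = v then 1 else 0) - (if a = v \<and> b = u then 1 else 0))"
    have *: "u \<in> B" "v \<in> B" "u \<noteq> v" "r u v" "r v u" "f u v < 1"
      using Cons.prems Cons assms(2) by auto
    have 1: "is_flow B r f1"
      unfolding f1_def by (rule is_flow_push(1)[OF assms(1) Cons.prems(4) *])
    have 2: "(\<Sum>b\<in>B. f1 w b) = (\<Sum>b\<in>B. f w b) + (if w = u then 1 else 0) - (if w = v then 1 else 0)" for w
      unfolding f1_def by (rule is_flow_push(2)[OF assms(1) Cons.prems(4) *])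
    have s: "successively (\<lambda>a b. r a b \<and> f a b < 1) ys"
      using Cons.prems(5) unfolding Cons by simp
    have u: "u \<notin> set ys" using Cons.prems(2) by simp
    have same: "f1 a b = f a b" if "a \<in> set ys" "b \<in> set ys" for a b
    proof -
      have "a \<noteq> u" "b \<noteq> u" using u that by blast+
      then show ?thesis by (simp add: f1_def)
    qed
    have "successively (\<lambda>a b. r a b \<and> f1 a b < 1) ys"
      using s by (rule successively_mono) (simp only: same)
    moreover have "ys \<noteq> []" "distinct ys" "set ys \<subseteq> B" using Cons.prems Cons by simp_all
    ultimately obtain f' where f': "is_flow B r f'" "\<forall>w. (\<Sum>b\<in>B. f' w b) =
           (\<Sum>b\<in>B. f1 w b) + (if w = hd ys then 1 else 0) - (if w = last ys then 1 else 0)"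
      using Cons.IH[of f1] 1 by blast
    have "hd ys = v" "last (u # ys) = last ys" using Cons by simp_all
    then show ?thesis by (intro exI[of _ f'] conjI f'(1)) (simp add: f'(2) 2)
  qed
qed

lemma sum_antisym_zero:
  fixes f :: "'a \<Rightarrow> 'a \<Rightarrow> int"
  assumes "\<And>u v. f u v = - f v u"
  shows "(\<Sum>u\<in>A. \<Sum>v\<in>A. f u v) = 0"
proof -
  have "(\<Sum>u\<in>A. \<Sum>v\<in>A. f u v) = (\<Sum>u\<in>A. \<Sum>v\<in>A. f v u)"
    by (rule sum.swap)
  also have "\<dots> = - (\<Sum>u\<in>A. \<Sum>v\<in>A. f u v)"
    unfolding sum_negf[symmetric] by (intro sum.cong refl, rule assms)
  finally show ?thesis by simp
qed

lemma sum_antisym_boundary: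
  fixes f :: "'a \<Rightarrow> 'a \<Rightarrow> int"
  assumes "\<And>u v. f u v = - f v u" "finite B" "A \<subseteq> B"
  shows "(\<Sum>u\<in>A. \<Sum>v\<in>B. f u v) = (\<Sum>u\<in>A. \<Sum>v\<in>B - A. f u v)"
proof -
  have "(\<Sum>v\<in>B. f u v) = (\<Sum>v\<in>B - A. f u v) + (\<Sum>v\<in>A. f u v)" for u
    by (rule sum.subset_diff[OF assms(3,2)])
  then show ?thesis
    by (simp add: sum.distrib sum_antisym_zero[of f A, OF assms(1)])
qed

text \<open>The cut condition suffices: a flow of minimal total defect has none, since otherwise the set
  reachable in the residual network from a vertex with missing outflow violates the condition.\<close>

lemma flow_exists:
  fixes p :: "'a \<Rightarrow> int"
  assumes fin: "finite B" and sym: "\<And>a b. r a b \<Longrightarrow> r b a"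
    and p0: "(\<Sum>u\<in>B. p u) = 0"
    and cut: "\<And>A. A \<subseteq> B \<Longrightarrow> (\<Sum>u\<in>A. p u) \<le> (\<Sum>u\<in>A. \<Sum>v\<in>B - A. if r u v then 1 else 0)"
  shows "\<exists>f. is_flow B r f \<and> (\<forall>u\<in>B. (\<Sum>v\<in>B. f u v) = p u)"
proof -
  define \<Phi> where "\<Phi> f = nat (\<Sum>u\<in>B. \<bar>p u - (\<Sum>v\<in>B. f u v)\<bar>)" for f :: "'a \<Rightarrow> 'a \<Rightarrow> int"
  have "is_flow B r (\<lambda>_ _. 0)" by (auto simp: is_flow_def)
  then obtain f where f: "is_flow B r f" and min: "\<And>g. is_flow B r g \<Longrightarrow> \<Phi> f \<le> \<Phi> g"
    using ex_has_least_nat[of "is_flow B r" _ \<Phi>] by metis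
  have anti: "f u v = - f v u" and le1: "f u v \<le> 1" for u v
    using f unfolding is_flow_def by blast+
  define e where "e u = p u - (\<Sum>v\<in>B. f u v)" for u
  have e0: "(\<Sum>u\<in>B. e u) = 0"
    using p0 by (simp add: e_def sum_subtractf sum_antisym_zero[of f B, OF anti])
  have "\<forall>u\<in>B. e u = 0"
  proof (rule ccontr)
    assume "\<not> ?thesis"
    have "\<exists>u\<in>B. e u > 0"
    proof (rule ccontr)
      assume "\<not> (\<exists>u\<in>B. e u > 0)"
      then have "\<forall>u\<in>B. - e u \<ge> 0" by force
      moreover have "(\<Sum>u\<in>B. - e u) = 0" using e0 by (simp add: sum_negf)
      ultimately have "\<forall>u\<in>B. - e u = 0" using fin by (simp add: sum_nonneg_eq_0_iff)
      with \<open>\<not> (\<forall>u\<in>B. e u = 0)\<close> show False by simp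
    qed
    then obtain u where u: "u \<in> B" "e u > 0" by blast
    define rf where "rf = (\<lambda>a b. a \<in> B \<and> b \<in> B \<and> r a b \<and> f a b < 1)"
    define A where "A = {v. rf\<^sup>*\<^sup>* u v}"
    have AB: "A \<subseteq> B"
    proof
      fix v assume "v \<in> A"
      then have "rf\<^sup>*\<^sup>* u v" by (simp add: A_def)
      then show "v \<in> B" by (cases rule: rtranclp.cases) (use u in \<open>auto simp: rf_def\<close>)
    qed
    \<comment> \<open>Otherwise augmenting along a residual path from \<open>u\<close> to
      \<open>v\<close> moves both defects one unit towards 0 and lowers the total by 2.\<close>
    have "e v \<ge> 0" if v: "v \<in> A" for v
    proof (rule ccontr)
      assume neg: "\<not> e v \<ge> 0"
      from v obtain xs where xs: "xs \<noteq> []" "hd xs = u" "last xs = v" "distinct xs" "successively rf xs"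
        using rtranclp_distinct_list[of rf u v] by (auto simp: A_def)
      have "set xs \<subseteq> B"
      proof -
        have "set ys \<subseteq> B" if "successively rf ys" "ys \<noteq> []" "hd ys \<in> B" for ys
          using that by (induction ys rule: induct_list012) (auto simp: rf_def)
        with xs u show ?thesis by blast
      qed
      moreover have "successively (\<lambda>a b. r a b \<and> f a b < 1) xs"
        using xs(5) by (rule successively_mono) (auto simp: rf_def)
      ultimately obtain f' where f': "is_flow B r f'" "\<And>w. (\<Sum>b\<in>B. f' w b) =
           (\<Sum>b\<in>B. f w b) + (if w = u then 1 else 0) - (if w = v then 1 else 0)"
        using is_flow_augment[OF fin sym xs(1,4) _ f] xs(2,3) by blast
      have uv: "u \<noteq> v" "v \<in> B" using neg u AB v by auto
      have abs: "\<bar>p w - (\<Sum>b\<in>B. f' w b)\<bar> = \<bar>e w\<bar> - (if w = u then 1 else 0) - (if w = v then 1 else 0)" for w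
        using u neg uv by (auto simp: f'(2) e_def)
      have "(\<Sum>w\<in>B. \<bar>p w - (\<Sum>b\<in>B. f' w b)\<bar>) = (\<Sum>w\<in>B. \<bar>e w\<bar>) - 2"
        unfolding abs using fin u uv by (simp add: sum_subtractf)
      moreover have "(\<Sum>w\<in>B. \<bar>p w - (\<Sum>b\<in>B. f' w b)\<bar>) \<ge> 0" by (rule sum_nonneg) simp
      ultimately have "\<Phi> f' < \<Phi> f" by (simp add: \<Phi>_def e_def)
      with min[OF f'(1)] show False by simp
    qed
    then have "(\<Sum>v\<in>A. e v) > 0"
      using u(2) fin AB by (intro sum_pos2[of A u]) (auto simp: A_def intro: finite_subset)
    then have "(\<Sum>v\<in>A. \<Sum>w\<in>B. f v w) < (\<Sum>v\<in>A. p v)"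
      by (simp add: e_def sum_subtractf)
    also have "\<dots> \<le> (\<Sum>v\<in>A. \<Sum>w\<in>B - A. if r v w then 1 else 0)" using cut[OF AB] .
    also have "\<dots> \<le> (\<Sum>v\<in>A. \<Sum>w\<in>B - A. f v w)"
    proof (intro sum_mono)
      fix v w assume vw: "v \<in> A" "w \<in> B - A"
      show "(if r v w then 1 else 0) \<le> f v w"
      proof (cases "r v w")
        case True
        have "\<not> rf v w" using vw by (auto simp: A_def intro: rtranclp.rtrancl_into_rtrancl)
        with True vw AB show ?thesis by (auto simp: rf_def)
      next
        case False
        with sym have "f v w = 0" using f unfolding is_flow_def by blast
        with False show ?thesis by simp
      qed
    qed
    also have "\<dots> = (\<Sum>v\<in>A. \<Sum>w\<in>B. f v w)"
      by (rule sum_antisym_boundary[OF anti fin AB, symmetric])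
    finally show False by simp
  qed
  with f show ?thesis unfolding e_def by (intro exI[of _ f]) auto
qed

text \<open>Moving \<open>A\<close> to the other side exchanges the cut and non-cut edges between
  \<open>A\<close> and \<open>B - A\<close> and affects no other edge, so a maximum cut has the
  required balance. Sums run over ordered pairs, whence the factor 2 in
  \<open>split\<close>.\<close>

lemma max_cut_exists:
  assumes fin: "finite B" and sym: "\<And>a b. r a b \<Longrightarrow> r b a"
  shows "\<exists>S. \<forall>A\<subseteq>B. (\<Sum>u\<in>A. \<Sum>v\<in>B - A. if r u v \<and> (u \<in> S \<longleftrightarrow> v \<in> S) then 1 else 0)
            \<le> (\<Sum>u\<in>A. \<Sum>v\<in>B - A. if r u v \<and> (u \<in> S \<longleftrightarrow> v \<notin> S) then 1 else (0::int))"
proof -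
  define c where "c S u v = (if r u v \<and> (u \<in> S \<longleftrightarrow> v \<notin> S) then 1 else (0::int))" for S u v
  have csym: "c S u v = c S v u" for S u v using sym by (auto simp: c_def)
  have split: "(\<Sum>u\<in>B. \<Sum>v\<in>B. c S u v) = (\<Sum>u\<in>A. \<Sum>v\<in>A. c S u v) + (\<Sum>u\<in>B-A. \<Sum>v\<in>B-A. c S u v)
       + 2 * (\<Sum>u\<in>A. \<Sum>v\<in>B-A. c S u v)" if "A \<subseteq> B" for S A
  proof -
    have *: "(\<Sum>u\<in>B-A. \<Sum>v\<in>A. c S u v) = (\<Sum>u\<in>A. \<Sum>v\<in>B-A. c S u v)"
      by (subst sum.swap) (simp add: csym[of S])
    have "(\<Sum>u\<in>B. \<Sum>v\<in>B. c S u v) = (\<Sum>u\<in>B-A. \<Sum>v\<in>B. c S u v) + (\<Sum>u\<in>A. \<Sum>v\<in>B. c S u v)"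
      by (rule sum.subset_diff[OF that fin])
    moreover have "(\<Sum>v\<in>B. c S u v) = (\<Sum>v\<in>B-A. c S u v) + (\<Sum>v\<in>A. c S u v)" for u
      by (rule sum.subset_diff[OF that fin])
    ultimately show ?thesis by (simp add: sum.distrib *)
  qed
  have "finite (Pow B)" "Pow B \<noteq> {}" using fin by auto
  then obtain S where S: "S \<in> Pow B"
    and Max: "Max ((\<lambda>S. \<Sum>u\<in>B. \<Sum>v\<in>B. c S u v) ` Pow B) = (\<Sum>u\<in>B. \<Sum>v\<in>B. c S u v)"
    by (rule obtains_MAX)
  have max: "(\<Sum>u\<in>B. \<Sum>v\<in>B. c S' u v) \<le> (\<Sum>u\<in>B. \<Sum>v\<in>B. c S u v)" if "S' \<in> Pow B" for S'
    unfolding Max[symmetric] using that fin by (intro Max_ge) auto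
  have "(\<Sum>u\<in>A. \<Sum>v\<in>B - A. if r u v \<and> (u \<in> S \<longleftrightarrow> v \<in> S) then 1 else 0)
            \<le> (\<Sum>u\<in>A. \<Sum>v\<in>B - A. c S u v)" if A: "A \<subseteq> B" for A
  proof -
    define S' where "S' = (S - A) \<union> (A - S)"
    have "S' \<in> Pow B" using S A by (auto simp: S'_def)
    note max[OF this, unfolded split[OF A]]
    moreover have "(\<Sum>u\<in>A. \<Sum>v\<in>A. c S' u v) = (\<Sum>u\<in>A. \<Sum>v\<in>A. c S u v)"
      by (intro sum.cong refl) (auto simp: c_def S'_def)
    moreover have "(\<Sum>u\<in>B-A. \<Sum>v\<in>B-A. c S' u v) = (\<Sum>u\<in>B-A. \<Sum>v\<in>B-A. c S u v)"
      by (intro sum.cong refl) (auto simp: c_def S'_def)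
    moreover have "(\<Sum>u\<in>A. \<Sum>v\<in>B-A. c S' u v) = (\<Sum>u\<in>A. \<Sum>v\<in>B - A. if r u v \<and> (u \<in> S \<longleftrightarrow> v \<in> S) then 1 else 0)"
      by (intro sum.cong refl) (auto simp: c_def S'_def)
    ultimately show ?thesis by linarith
  qed
  then show ?thesis unfolding c_def by blast
qed

section \<open>Odd weighted degrees on the blue vertices\<close>

text \<open>There are \<open>2 * i + 2\<close> odd numbers from \<open>2 * c - 2 * i - 1\<close> to
  \<open>2 * c + 2 * i + 1\<close>, alternating between the residues 1 and 3. Each class has
  \<open>i + 1\<close> of them, more than \<open>X\<close> can exclude.\<close>

lemma avoiding_value_exists:
  fixes c :: int
  assumes "finite X" "card X \<le> i" "m = 1 \<or> m = 3"
  shows "\<exists>w. w mod 4 = m \<and> \<bar>w - 2 * c\<bar> \<le> 2 * int i + 1 \<and> w \<notin> X"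
proof -
  obtain w0 where w0: "w0 mod 4 = m" "w0 = 2 * c - 2 * int i - 1 \<or> w0 = 2 * c - 2 * int i + 1"
  proof -
    have "(2 * c - 2 * int i - 1) mod 4 = m \<or> (2 * c - 2 * int i + 1) mod 4 = m"
      using assms(3) by presburger
    then show ?thesis using that by blast
  qed
  define W where "W = (\<lambda>k. w0 + 4 * int k) ` {..i}"
  have "card W = Suc i" unfolding W_def by (subst card_image) (auto simp: inj_on_def)
  then have "\<not> W \<subseteq> X" using assms(1,2) card_mono[of X W] by fastforce
  then obtain k where k: "k \<le> i" "w0 + 4 * int k \<notin> X" unfolding W_def by blast
  moreover have "(w0 + 4 * int k) mod 4 = m" using w0(1) by presburger
  moreover have "\<bar>w0 + 4 * int k - 2 * c\<bar> \<le> 2 * int i + 1" using w0(2) k(1) by auto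
  ultimately show ?thesis by blast
qed

lemma greedy_values_exist:
  fixes c :: "'a \<Rightarrow> int" and rk :: "'a \<Rightarrow> nat"
  assumes "\<And>v. finite (I v)" "\<And>u v. u \<in> I v \<Longrightarrow> rk u < rk v"
  shows "\<exists>val. \<forall>v. val v mod 4 = (if v \<in> S then 1 else 3) \<and>
    \<bar>val v - 2 * c v\<bar> \<le> 2 * int (card (I v)) + 1 \<and> (\<forall>u\<in>I v. val u \<noteq> val v)"
proof -
  define P where "P val v \<longleftrightarrow> val v mod 4 = (if v \<in> S then 1 else 3) \<and>
    \<bar>val v - 2 * c v\<bar> \<le> 2 * int (card (I v)) + 1 \<and> (\<forall>u\<in>I v. val u \<noteq> val v)" for val v
  define pick where "pick val v = (SOME w. w mod 4 = (if v \<in> S then 1 else 3) \<and>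
    \<bar>w - 2 * c v\<bar> \<le> 2 * int (card (I v)) + 1 \<and> w \<notin> val ` I v)" for val :: "'a \<Rightarrow> int" and v
  have pick: "pick val v mod 4 = (if v \<in> S then 1 else 3) \<and>
    \<bar>pick val v - 2 * c v\<bar> \<le> 2 * int (card (I v)) + 1 \<and> pick val v \<notin> val ` I v" for val v
    unfolding pick_def
    by (rule someI_ex, rule avoiding_value_exists) (auto simp: assms(1) card_image_le)
  \<comment> \<open>Blanking \<open>val\<close> outside \<open>I v\<close> makes the recursion
    admissible: only values at vertices of smaller rank are consulted.\<close>
  define G where "G = (\<lambda>val v. pick (\<lambda>u. if u \<in> I v then val u else 0) v)"
  define val where "val = wfrec (measure rk) G"
  have "adm_wf (measure rk) G"
    unfolding adm_wf_def G_def
  proof (intro allI impI)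
    fix f g x assume "\<forall>z. (z, x) \<in> measure rk \<longrightarrow> f z = (g z :: int)"
    then have "(\<lambda>u. if u \<in> I x then f u else 0) = (\<lambda>u. if u \<in> I x then g u else 0)"
      using assms(2) by auto
    then show "pick (\<lambda>u. if u \<in> I x then f u else 0) x = pick (\<lambda>u. if u \<in> I x then g u else 0) x"
      by simp
  qed
  then have "val v = G val v" for v
    unfolding val_def using wfrec_fixpoint[OF wf_measure] by metis
  then have pfix: "pick (\<lambda>u. if u \<in> I v then val u else 0) v = val v" for v
    unfolding G_def by simp
  have "P val v" for v
  proof -
    have "(\<lambda>u. if u \<in> I v then val u else 0) ` I v = val ` I v" by auto
    then show ?thesis
      using pick[where val = "\<lambda>u. if u \<in> I v then val u else 0" and v = v] unfolding pfix P_def by (metis imageI)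
  qed
  then show ?thesis unfolding P_def by blast
qed

text \<open>Write \<open>d = s * (2 * j + 1)\<close> with \<open>s\<close> its sign, so that
  \<open>j \<le> card I\<close>: let \<open>j\<close> elements of \<open>I\<close> contribute
  \<open>s\<close>, the others 0, and let \<open>\<sigma> = s\<close> supply the last unit.\<close>

lemma odd_split_signs:
  fixes d :: int
  assumes "odd d" "\<bar>d\<bar> \<le> 2 * int (card I) + 1" "finite I"
  shows "\<exists>\<sigma> y. (\<sigma> = 1 \<or> \<sigma> = -1) \<and> (\<forall>u. y u \<in> {-1, 0, 1 :: int}) \<and> d = 2 * (\<Sum>u\<in>I. y u) + \<sigma>"
proof -
  define s :: int where "s = (if d > 0 then 1 else -1)"
  define j where "j = nat ((\<bar>d\<bar> - 1) div 2)"
  have "\<bar>d\<bar> \<ge> 1" using assms(1) by (cases "d = 0") auto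
  moreover from this have "int j = (\<bar>d\<bar> - 1) div 2" by (simp add: j_def)
  moreover have "even (\<bar>d\<bar> - 1)" using assms(1) by simp
  ultimately have j: "\<bar>d\<bar> = 2 * int j + 1" by simp
  then have "j \<le> card I" using assms(2) by simp
  then obtain K where K: "K \<subseteq> I" "card K = j" using obtain_subset_with_card_n by metis
  have "(\<Sum>u\<in>I. if u \<in> K then s else 0) = s * int j"
    using K assms(3) by (simp add: sum.If_cases Int_absorb1 Int_absorb2)
  then have "d = 2 * (\<Sum>u\<in>I. if u \<in> K then s else 0) + s"
    using j by (auto simp: s_def split: if_splits)
  then show ?thesis
    by (intro exI[of _ s] exI[of _ "\<lambda>u. if u \<in> K then s else 0"]) (auto simp: s_def)
qed

text \<open>Order the vertices and fix a maximum cut. A non-cut edge may add any of \<open>-2, 0, 2\<close> to its later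
  endpoint and nothing to the earlier one: change its weight by \<open>y\<close> and let the flow on the cut edges
  carry \<open>y\<close> units from one endpoint to the other.\<close>

lemma odd_proper_values_exist:
  fixes c :: "'a \<Rightarrow> int"
  assumes fin: "finite B" and "symp r" and irr: "\<And>a. \<not> r a a"
  shows "\<exists>h \<sigma> val. (\<forall>u v. h u v = h v u) \<and> (\<forall>u v. h u v \<in> {-1, 0, 1 :: int}) \<and>
    (\<forall>u v. h u v \<noteq> 0 \<longrightarrow> r u v) \<and> (\<forall>b. \<sigma> b \<in> {1, -1}) \<and> (\<forall>b. odd (val b)) \<and>
    (\<forall>b\<in>B. val b = 2 * c b + \<sigma> b + (\<Sum>w\<in>B. h b w)) \<and>
    (\<forall>u\<in>B. \<forall>v\<in>B. r u v \<longrightarrow> val u \<noteq> val v)"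
proof -
  have sym: "\<And>a b. r a b \<Longrightarrow> r b a" using \<open>symp r\<close> by (rule sympD)
  obtain S where S: "\<And>A. A \<subseteq> B \<Longrightarrow>
     (\<Sum>u\<in>A. \<Sum>v\<in>B - A. if r u v \<and> (u \<in> S \<longleftrightarrow> v \<in> S) then 1 else 0)
            \<le> (\<Sum>u\<in>A. \<Sum>v\<in>B - A. if r u v \<and> (u \<in> S \<longleftrightarrow> v \<notin> S) then 1 else (0::int))"
    using max_cut_exists[OF fin, of r] sym by blast
  obtain rk :: "'a \<Rightarrow> nat" where rk: "inj_on rk B"
    using finite_imp_inj_to_nat_seg[OF fin] by blast
  \<comment> \<open>Earlier neighbours on the same side of the cut; neighbours across the cut are
    kept apart by the residue modulo 4.\<close>
  define I where "I v = {u\<in>B. v \<in> B \<and> r u v \<and> (u \<in> S \<longleftrightarrow> v \<in> S) \<and> rk u < rk v}" for v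
  have finI: "finite (I v)" for v using fin by (simp add: I_def)
  obtain val where val: "\<And>v. val v mod 4 = (if v \<in> S then 1 else 3)"
     "\<And>v. \<bar>val v - 2 * c v\<bar> \<le> 2 * int (card (I v)) + 1" "\<And>u v. u \<in> I v \<Longrightarrow> val u \<noteq> val v"
  proof -
    have "rk u < rk v" if "u \<in> I v" for u v using that by (simp add: I_def)
    from greedy_values_exist[of I rk S c, OF finI this] show ?thesis using that by blast
  qed
  have odd: "odd (val v)" for v
    using val(1)[of v] by (cases "v \<in> S") (simp_all, presburger+)
  have "\<exists>\<sigma> y. (\<sigma> = 1 \<or> \<sigma> = -1) \<and> (\<forall>u. y u \<in> {-1, 0, 1 :: int}) \<and> val v - 2 * c v = 2 * (\<Sum>u\<in>I v. y u) + \<sigma>" for v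
    by (rule odd_split_signs) (use odd val(2) finI in auto)
  then obtain \<sigma> y where \<sigma>: "\<And>v. \<sigma> v = 1 \<or> \<sigma> v = -1" and y: "\<And>v u. y v u \<in> {-1, 0, 1 :: int}"
    and vy: "\<And>v. val v - 2 * c v = 2 * (\<Sum>u\<in>I v. y v u) + \<sigma> v"
    by metis
  define g where "g u v = (if u \<in> I v then y v u else 0)" for u v
  \<comment> \<open>The change \<open>h\<close> on a cut edge will be the outflow of
    \<open>f\<close> at the end in \<open>S\<close>, hence minus the outflow at the other end. So
    \<open>f0\<close> carries the change from the earlier to the later endpoint inside
    \<open>S\<close> and backwards outside; on both sides the earlier endpoint nets 0 and the later
    one twice the change.\<close>
  define f0 where "f0 u v = (if u \<in> S then g u v - g v u else g v u - g u v)" for u v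
  have disj: "\<not> (u \<in> I v \<and> v \<in> I u)" for u v by (auto simp: I_def)
  have g: "g u v \<in> {-1, 0, 1}" "g u v \<noteq> 0 \<Longrightarrow> u \<in> I v" for u v
    using y[of v u] by (auto simp: g_def split: if_splits)
  have f0: "f0 u v = - f0 v u" "f0 u v \<le> 1" "- f0 u v \<le> 1"
    "f0 u v \<noteq> 0 \<Longrightarrow> u \<in> B \<and> v \<in> B \<and> r u v \<and> (u \<in> S \<longleftrightarrow> v \<in> S)" for u v
  proof -
    have I: "u \<in> I v \<or> v \<in> I u \<Longrightarrow> u \<in> B \<and> v \<in> B \<and> r u v \<and> (u \<in> S \<longleftrightarrow> v \<in> S)"
      using sym by (auto simp: I_def)
    show "f0 u v \<noteq> 0 \<Longrightarrow> u \<in> B \<and> v \<in> B \<and> r u v \<and> (u \<in> S \<longleftrightarrow> v \<in> S)"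
      using I unfolding f0_def g_def by (cases "u \<in> I v \<or> v \<in> I u") (simp_all split: if_splits)
    show "f0 u v = - f0 v u"
    proof (cases "u \<in> I v \<or> v \<in> I u")
      case True
      then show ?thesis using I unfolding f0_def by simp
    next
      case False
      then show ?thesis unfolding f0_def g_def by simp
    qed
    show "f0 u v \<le> 1" "- f0 u v \<le> 1"
      using g[of u v] g[of v u] disj[of u v] unfolding f0_def by auto
  qed
  \<comment> \<open>This demand makes \<open>f + f0\<close> a circulation. It is feasible since a
    non-cut edge carries at most one unit of \<open>f0\<close> and, the cut being maximal, at least
    as many cut as non-cut edges leave any \<open>A\<close>.\<close>
  define p where "p u = - (\<Sum>v\<in>B. f0 u v)" for u
  define rc where "rc u v \<longleftrightarrow> r u v \<and> (u \<in> S \<longleftrightarrow> v \<notin> S)" for u v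
  have "\<exists>f. is_flow B rc f \<and> (\<forall>u\<in>B. (\<Sum>v\<in>B. f u v) = p u)"
  proof (rule flow_exists[OF fin])
    show "rc b a" if "rc a b" for a b using that sym by (auto simp: rc_def)
    show "(\<Sum>u\<in>B. p u) = 0"
      unfolding p_def sum_negf by (simp add: sum_antisym_zero[of f0 B, OF f0(1)])
    fix A assume A: "A \<subseteq> B"
    have "(\<Sum>u\<in>A. p u) = (\<Sum>u\<in>A. \<Sum>v\<in>B - A. - f0 u v)"
      unfolding p_def sum_negf using sum_antisym_boundary[of f0 B A, OF f0(1) fin A] by simp
    also have "\<dots> \<le> (\<Sum>u\<in>A. \<Sum>v\<in>B - A. if r u v \<and> (u \<in> S \<longleftrightarrow> v \<in> S) then 1 else 0)"
    proof (intro sum_mono)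
      fix u v
      show "- f0 u v \<le> (if r u v \<and> (u \<in> S \<longleftrightarrow> v \<in> S) then 1 else 0)"
        using f0(3,4)[of u v] by (cases "f0 u v = 0") auto
    qed
    also have "\<dots> \<le> (\<Sum>u\<in>A. \<Sum>v\<in>B - A. if rc u v then 1 else 0)"
      unfolding rc_def by (rule S[OF A])
    finally show "(\<Sum>u\<in>A. p u) \<le> (\<Sum>u\<in>A. \<Sum>v\<in>B - A. if rc u v then 1 else 0)" .
  qed
  then obtain f where f: "\<And>u v. f u v = - f v u" "\<And>u v. f u v \<le> 1" "\<And>u v. f u v \<noteq> 0 \<Longrightarrow> rc u v"
    and fp: "\<And>u. u \<in> B \<Longrightarrow> (\<Sum>v\<in>B. f u v) = p u"
    unfolding is_flow_def by blast
  define h where "h u v = (if u \<in> S then f u v else f v u) + g u v + g v u" for u v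
  have I0: "u \<in> I v \<Longrightarrow> f u v = 0 \<and> f v u = 0" for u v
    using f(3)[of u v] f(3)[of v u] by (auto simp: I_def rc_def)
  have hsym: "h u v = h v u" for u v
  proof (cases "f u v = 0")
    case True
    then have "f v u = 0" using f(1)[of v u] by simp
    with True show ?thesis by (simp add: h_def)
  next
    case False
    then show ?thesis using f(3)[of u v] by (auto simp: h_def rc_def)
  qed
  have hval: "h u v \<in> {-1, 0, 1}" for u v
  proof (cases "u \<in> I v \<or> v \<in> I u")
    case True
    then have "h u v = g u v \<or> h u v = g v u" using I0 g(2) disj unfolding h_def by fastforce
    then show ?thesis using g(1) by metis
  next
    case False
    then have "h u v = f u v \<or> h u v = f v u" unfolding h_def g_def by auto
    moreover have "f u v \<in> {-1, 0, 1}" "f v u \<in> {-1, 0, 1}"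
      using f(1)[of u v] f(2)[of u v] f(2)[of v u] by auto
    ultimately show ?thesis by auto
  qed
  have hr: "r u v" if "h u v \<noteq> 0" for u v
  proof (rule ccontr)
    assume "\<not> r u v"
    then have "\<not> r v u" using sym by blast
    then have "f u v = 0" "f v u = 0" "g u v = 0" "g v u = 0"
      using \<open>\<not> r u v\<close> f(3) by (auto simp: rc_def g_def I_def)
    with that show False by (simp add: h_def split: if_splits)
  qed
  have sumh: "(\<Sum>w\<in>B. h b w) = 2 * (\<Sum>u\<in>I b. y b u)" if b: "b \<in> B" for b
  proof -
    have gI: "(\<Sum>u\<in>I b. y b u) = (\<Sum>u\<in>B. g u b)"
      unfolding g_def using fin by (simp add: sum.If_cases) (rule sum.cong, auto simp: I_def)
    have f0s: "(\<Sum>v\<in>B. f0 b v) = (if b \<in> S then (\<Sum>v\<in>B. g b v) - (\<Sum>v\<in>B. g v b) else (\<Sum>v\<in>B. g v b) - (\<Sum>v\<in>B. g b v))"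
      by (simp add: f0_def sum_subtractf)
    have neg: "(\<Sum>w\<in>B. f w b) = - (\<Sum>w\<in>B. f b w)"
      unfolding sum_negf[symmetric] by (intro sum.cong refl f(1))
    have "(\<Sum>w\<in>B. h b w) = (if b \<in> S then (\<Sum>w\<in>B. f b w) else (\<Sum>w\<in>B. f w b)) + (\<Sum>w\<in>B. g b w) + (\<Sum>w\<in>B. g w b)"
      by (simp add: h_def sum.distrib)
    also have "\<dots> = 2 * (\<Sum>w\<in>B. g w b)"
      unfolding neg fp[OF b] p_def f0s by simp
    finally show ?thesis by (simp add: gI)
  qed
  have vne: "val u \<noteq> val v" if "u \<in> B" "v \<in> B" "r u v" for u v
  proof (cases "u \<in> S \<longleftrightarrow> v \<in> S")
    case True
    have "u \<noteq> v" using irr that by auto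
    then have "rk u \<noteq> rk v" using rk that by (auto simp: inj_on_def)
    then have "u \<in> I v \<or> v \<in> I u" using that sym True by (auto simp: I_def)
    then show ?thesis using val(3) by metis
  next
    case False
    then show ?thesis using val(1)[of u] val(1)[of v] by auto
  qed
  have veq: "val b = 2 * c b + \<sigma> b + (\<Sum>w\<in>B. h b w)" if "b \<in> B" for b
    using vy[of b] sumh[OF that] by linarith
  have "\<sigma> b \<in> {1, -1}" for b using \<sigma>[of b] by blast
  then show ?thesis
    by - (rule exI[of _ h], rule exI[of _ \<sigma>], rule exI[of _ val],
      intro conjI allI ballI impI, (assumption | (rule vne, assumption, assumption, assumption) | rule hsym hval hr odd veq)+)
qed

section \<open>Colourings from labellings of a bipartite core\<close>

lemma odd_card_symdiff:
  assumes "finite A" "finite B"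
  shows "odd (card {x. (x \<in> A) \<noteq> (x \<in> B)}) \<longleftrightarrow> odd (card A) \<noteq> odd (card B)"
proof -
  have "{x. (x \<in> A) \<noteq> (x \<in> B)} = (A - B) \<union> (B - A)" by auto
  moreover have "card (A - B \<union> (B - A)) = card (A - B) + card (B - A)"
    by (rule card_Un_disjoint) (use assms in auto)
  moreover have "card A = card (A \<inter> B) + card (A - B)" "card B = card (B \<inter> A) + card (B - A)"
    by (rule card_Int_Diff, rule assms)+
  ultimately show ?thesis by (simp add: Int_commute) presburger
qed

lemma odd_card_xor:
  assumes "finite {x. P x}" "finite {x. Q x}"
  shows "odd (card {x. P x \<noteq> Q x}) \<longleftrightarrow> odd (card {x. P x}) \<noteq> odd (card {x. Q x})"
  using odd_card_symdiff[OF assms] unfolding mem_Collect_eq .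

text \<open>\<open>F\<close> is the sum modulo 2 of the edges of a walk. Repeated edges cancel, so
  the walk need not be a path.\<close>

lemma walk_join_exists:
  assumes sym: "\<And>a b. r a b \<Longrightarrow> r b a" and irr: "\<And>a. \<not> r a a"
    and fin: "\<And>a. finite {b. r a b}" and "r\<^sup>*\<^sup>* u v"
  shows "\<exists>F. (\<forall>a b. F a b \<longrightarrow> F b a \<and> r a b) \<and> (\<forall>w. odd (card {x. F w x}) \<longleftrightarrow> (w = u) \<noteq> (w = v))"
  using assms(4)
proof (induction rule: rtranclp_induct)
  case base
  then show ?case by (intro exI[of _ "\<lambda>_ _. False"]) auto
next
  case (step v v')
  then obtain F where F: "\<And>a b. F a b \<Longrightarrow> F b a" "\<And>a b. F a b \<Longrightarrow> r a b"
    "\<And>w. odd (card {x. F w x}) \<longleftrightarrow> (w = u) \<noteq> (w = v)" by blast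
  define G where "G a b \<longleftrightarrow> {a, b} = {v, v'}" for a b
  have ne: "v \<noteq> v'" using irr step by metis
  have Gset: "{x. G w x} = (if w = v then {v'} else if w = v' then {v} else {})" for w
    using ne by (auto simp: G_def doubleton_eq_iff)
  have "finite {x. F w x}" for w
    by (rule finite_subset[OF _ fin[of w]]) (use F(2) in auto)
  moreover have "finite {x. G w x}" "odd (card {x. G w x}) \<longleftrightarrow> (w = v) \<noteq> (w = v')" for w
    using ne by (auto simp: Gset)
  ultimately have par: "odd (card {x. F w x \<noteq> G w x}) \<longleftrightarrow> (w = u) \<noteq> (w = v')" for w
    using odd_card_xor[of "F w" "G w"] F(3)[of w] by blast
  have rG: "r a b" if "G a b" for a b
    using that step sym by (auto simp: G_def doubleton_eq_iff)
  have symG: "G a b = G b a" for a b by (auto simp: G_def insert_commute)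
  have symF: "F a b = F b a" for a b using F(1) by blast
  show ?case
  proof (intro exI conjI allI impI)
    fix a b assume "F a b \<noteq> G a b"
    then show "F b a \<noteq> G b a" "r a b" using symF[of a b] symG[of a b] F(2) rG by blast+
  qed (rule par)
qed

text \<open>\<open>F\<close> is a T-join with \<open>T = X\<close>: the vertices of \<open>X\<close>
  are paired off and the connecting walks added modulo 2.\<close>

lemma join_exists:
  assumes sym: "\<And>a b. r a b \<Longrightarrow> r b a" and irr: "\<And>a. \<not> r a a"
    and fin: "\<And>a. finite {b. r a b}"
    and "finite X" "even (card X)" "\<And>u v. u \<in> X \<Longrightarrow> v \<in> X \<Longrightarrow> r\<^sup>*\<^sup>* u v"
  shows "\<exists>F. (\<forall>a b. F a b \<longrightarrow> F b a \<and> r a b) \<and> (\<forall>w. odd (card {x. F w x}) \<longleftrightarrow> w \<in> X)"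
  using assms(4-)
proof (induction "card X" arbitrary: X rule: less_induct)
  case less
  show ?case
  proof (cases "X = {}")
    case True
    then show ?thesis by (intro exI[of _ "\<lambda>_ _. False"]) auto
  next
    case False
    then obtain u where u: "u \<in> X" by blast
    have "X \<noteq> {u}" using less.prems(2) by auto
    then obtain v where v: "v \<in> X" "u \<noteq> v" using u by blast
    have "card (X - {u, v}) = card X - 2"
      using u v less.prems(1) by (subst card_Diff_subset) auto
    moreover have "card X \<ge> 2" using card_mono[of X "{u,v}"] u v less.prems(1) by auto
    ultimately have "card (X - {u, v}) < card X" "even (card (X - {u, v}))"
      using less.prems(2) by auto
    then obtain F where F: "\<And>a b. F a b \<Longrightarrow> F b a" "\<And>a b. F a b \<Longrightarrow> r a b"
      "\<And>w. odd (card {x. F w x}) \<longleftrightarrow> w \<in> X - {u, v}"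
      using less.hyps[of "X - {u, v}"] less.prems by (metis Diff_iff finite_Diff)
    have "r\<^sup>*\<^sup>* u v" using less.prems u v by blast
    from walk_join_exists[of r, OF sym irr fin this]
    obtain G where G: "\<And>a b. G a b \<Longrightarrow> G b a" "\<And>a b. G a b \<Longrightarrow> r a b"
      "\<And>w. odd (card {x. G w x}) \<longleftrightarrow> (w = u) \<noteq> (w = v)" by blast
    have "finite {x. F w x}" "finite {x. G w x}" for w
      by (rule finite_subset[OF _ fin[of w]], use F(2) G(2) in auto)+
    then have par: "odd (card {x. F w x \<noteq> G w x}) \<longleftrightarrow> w \<in> X" for w
      using odd_card_xor[of "F w" "G w"] F(3)[of w] G(3)[of w] u v by blast
    have sym': "F a b = F b a" "G a b = G b a" for a b using F(1) G(1) by blast+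
    show ?thesis
    proof (intro exI conjI allI impI)
      fix a b assume "F a b \<noteq> G a b"
      then show "F b a \<noteq> G b a" "r a b" using sym'[of a b] F(2) G(2) by blast+
    qed (rule par)
  qed
qed

lemma signs_with_sum_exist:
  fixes t :: int
  assumes "finite K" "t \<in> {-1, 0, 1}" "odd (card K) \<longleftrightarrow> t \<noteq> 0"
  shows "\<exists>s. (\<forall>x. s x = 1 \<or> s x = -1) \<and> (\<Sum>x\<in>K. s x) = t"
proof -
  obtain m where m: "2 * int m = int (card K) + t" "m \<le> card K"
  proof -
    have e: "even (int (card K) + t)" using assms(2,3) by auto
    have "0 \<le> int (card K) + t" "int (card K) + t \<le> 2 * int (card K)"
      using assms(2,3) by (cases "card K = 0"; auto)+
    then show ?thesis using that[of "nat ((int (card K) + t) div 2)"] e by auto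
  qed
  then obtain J where J: "J \<subseteq> K" "card J = m" using obtain_subset_with_card_n by metis
  have "(\<Sum>x\<in>K. if x \<in> J then 1 else -1 :: int) = int (card J) - int (card (K - J))"
    using J(1) assms(1) by (simp add: sum.If_cases Int_absorb1 Diff_eq)
  also have "card (K - J) = card K - m" using J assms(1) by (simp add: card_Diff_subset finite_subset)
  finally have "(\<Sum>x\<in>K. if x \<in> J then 1 else -1 :: int) = t" using m J by simp
  then show ?thesis by (intro exI[of _ "\<lambda>x. if x \<in> J then 1 else -1"]) auto
qed

lemma symmetric_set_function:
  assumes "\<And>u v. W u v = W v u"
  shows "\<exists>\<omega>. \<forall>u v. \<omega> {u, v} = W u v"
proof -
  define \<omega> where "\<omega> e = (SOME c. \<exists>u v. e = {u, v} \<and> c = W u v)" for e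
  have "\<omega> {u, v} = W u v" for u v
    unfolding \<omega>_def by (rule some_equality) (use assms in \<open>auto simp: doubleton_eq_iff\<close>)
  then show ?thesis by blast
qed

section \<open>Labellings of a finite graph and the treatment of blue edges\<close>

locale fin_graph =
  fixes V :: "'a set" and adj :: "'a \<Rightarrow> 'a \<Rightarrow> bool"
  assumes finV: "finite V"
    and adj_sym: "adj u v \<Longrightarrow> adj v u"
    and adj_irrefl: "\<not> adj v v"
    and adj_V: "adj u v \<Longrightarrow> u \<in> V"
begin

definition N :: "'a \<Rightarrow> 'a set" where "N v = {w. adj v w}"

definition deg :: "'a \<Rightarrow> int" where "deg v = int (card (N v))"

definition D :: "('a \<Rightarrow> 'a \<Rightarrow> int) \<Rightarrow> 'a \<Rightarrow> int" where "D \<eta> v = (\<Sum>w\<in>N v. \<eta> v w)"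

definition labelling :: "('a \<Rightarrow> 'a \<Rightarrow> int) \<Rightarrow> bool" where
  "labelling \<eta> \<longleftrightarrow> (\<forall>u v. \<eta> u v = \<eta> v u \<and> \<eta> u v \<in> {-1, 0, 1})"

definition colourable :: bool where
  "colourable \<longleftrightarrow> (\<exists>\<omega> :: 'a set \<Rightarrow> int. (\<forall>u v. adj u v \<longrightarrow> \<omega> {u, v} \<in> {1, 2, 3}) \<and>
     (\<forall>u v. adj u v \<longrightarrow> (\<Sum>w\<in>N u. \<omega> {u, w}) \<noteq> (\<Sum>w\<in>N v. \<omega> {v, w})))"

lemma N_V: "N v \<subseteq> V"
  using adj_V adj_sym by (auto simp: N_def)

lemma finite_N [simp]: "finite (N v)"
  using N_V finV finite_subset by blast

lemma in_N [simp]: "w \<in> N v \<longleftrightarrow> adj v w"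
  by (simp add: N_def)

text \<open>With weights \<open>2 + \<eta>\<close> outside the blue set \<open>B\<close>, the blue vertices only have to receive
  \<open>\<eta>\<close>-sums \<open>\<sigma>\<close> from outside; their weighted degrees are then the odd numbers \<open>val\<close>, which differ on blue edges.\<close>

definition frame :: "'a set \<Rightarrow> ('a \<Rightarrow> int) \<Rightarrow> ('a \<Rightarrow> int) \<Rightarrow> bool" where
  "frame B \<sigma> val \<longleftrightarrow> (\<forall>b\<in>B. \<sigma> b \<in> {1, -1} \<and> odd (val b)) \<and>
     (\<forall>\<eta>. labelling \<eta> \<longrightarrow> (\<forall>u\<in>B. \<forall>v\<in>B. \<eta> u v = 0) \<longrightarrow> (\<forall>b\<in>B. D \<eta> b = \<sigma> b) \<longrightarrow>
        (\<forall>q\<in>V - B. \<forall>w. adj q w \<longrightarrow> 2 * deg q + D \<eta> q \<noteq> (if w \<in> B then val w else 2 * deg w + D \<eta> w)) \<longrightarrow>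
        colourable)"

text \<open>Edges inside \<open>B\<close> get \<open>2 + h\<close>, all others
  \<open>2 + \<eta>\<close>. As \<open>\<eta>\<close> vanishes inside \<open>B\<close>, its sum at a
  blue \<open>b\<close> comes from outside only and equals \<open>\<sigma> b\<close>, so
  \<open>b\<close> has weighted degree \<open>val b\<close>. Since \<open>h\<close>,
  \<open>\<sigma>\<close> and \<open>val\<close> do not depend on \<open>\<eta>\<close>, the
  labelling can be built afterwards with \<open>\<sigma>\<close> as its target.\<close>

lemma frame_exists:
  assumes "B \<subseteq> V"
  shows "\<exists>\<sigma> val. frame B \<sigma> val"
proof -
  have fin: "finite B" using assms finV finite_subset by blast
  obtain h \<sigma> val where h: "\<forall>u v. h u v = h v u" "\<forall>u v. h u v \<in> {-1, 0, 1}"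
    "\<forall>u v. h u v \<noteq> 0 \<longrightarrow> adj u v"
    and \<sigma>: "\<forall>b. \<sigma> b \<in> {1, -1}" "\<forall>b. odd (val b)"
    and val: "\<forall>b\<in>B. val b = 2 * deg b + \<sigma> b + (\<Sum>w\<in>B. h b w)"
    "\<forall>u\<in>B. \<forall>v\<in>B. adj u v \<longrightarrow> val u \<noteq> val v"
  proof -
    have "symp adj" using adj_sym by (rule sympI)
    from odd_proper_values_exist[OF fin this, of deg, OF adj_irrefl] show thesis
      by (elim exE conjE) (rule that)
  qed
  note h = h[rule_format] and \<sigma> = \<sigma>[rule_format] and val = val[rule_format]
  have "colourable" if \<eta>: "labelling \<eta>" "\<forall>u\<in>B. \<forall>v\<in>B. \<eta> u v = 0" "\<forall>b\<in>B. D \<eta> b = \<sigma> b"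
    and q: "\<forall>q\<in>V - B. \<forall>w. adj q w \<longrightarrow> 2 * deg q + D \<eta> q \<noteq> (if w \<in> B then val w else 2 * deg w + D \<eta> w)" for \<eta>
  proof -
    define W where "W u v = 2 + (if u \<in> B \<and> v \<in> B then h u v else \<eta> u v)" for u v
    have \<eta>': "\<eta> u v = \<eta> v u" "\<eta> u v \<in> {-1, 0, 1}" for u v
      using \<eta>(1) unfolding labelling_def by blast+
    have "W u v = W v u" for u v unfolding W_def using h(1)[of u v] \<eta>'(1)[of u v] by (simp add: conj_commute)
    then obtain \<omega> where \<omega>: "\<And>u v. \<omega> {u, v} = W u v" using symmetric_set_function[of W] by blast
    define s where "s v = (\<Sum>w\<in>N v. W v w)" for v
    have sD: "s v = 2 * deg v + (\<Sum>w\<in>N v. if v \<in> B \<and> w \<in> B then h v w else \<eta> v w)" for v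
      unfolding s_def W_def by (simp add: sum.distrib deg_def)
    have s1: "s v = 2 * deg v + D \<eta> v" if "v \<notin> B" for v
      unfolding sD D_def using that by simp
    have s2: "s b = val b" if b: "b \<in> B" for b
    proof -
      have "(\<Sum>w\<in>N b. if b \<in> B \<and> w \<in> B then h b w else \<eta> b w) =
        (\<Sum>w\<in>N b. (if w \<in> B then h b w else 0) + \<eta> b w)"
        by (rule sum.cong) (use b \<eta>(2) in auto)
      also have "\<dots> = (\<Sum>w\<in>N b. if w \<in> B then h b w else 0) + D \<eta> b"
        by (simp add: sum.distrib D_def)
      also have "(\<Sum>w\<in>N b. if w \<in> B then h b w else 0) = (\<Sum>w\<in>N b \<inter> B. h b w)"
        by (simp add: sum.inter_restrict)
      also have "\<dots> = (\<Sum>w\<in>B. h b w)"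
        by (rule sum.mono_neutral_left[OF fin]) (use h(3) in auto)
      finally show ?thesis using sD[of b] val(1)[OF b] \<eta>(3) b by simp
    qed
    have ns: "s u \<noteq> s v" if "adj u v" for u v
    proof (cases "u \<in> B")
      case True
      show ?thesis
      proof (cases "v \<in> B")
        case False
        then have "v \<in> V - B" using adj_V[OF adj_sym[OF that]] by blast
        then show ?thesis using q adj_sym[OF that] True s1[OF False] s2[OF True] by fastforce
      qed (use val(2) that True s2 in auto)
    next
      case False
      then have "u \<in> V - B" using adj_V[OF that] by blast
      then show ?thesis using q that s1[OF False] s1[of v] s2[of v] by (cases "v \<in> B") fastforce+
    qed
    have "W u v \<in> {1, 2, 3}" for u v
      using h(2)[of u v] \<eta>'(2)[of u v] unfolding W_def by auto
    with ns show ?thesis unfolding colourable_def s_def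
      by (intro exI[of _ \<omega>]) (simp only: \<omega>, blast)
  qed
  then show ?thesis using \<sigma> unfolding frame_def by (intro exI[of _ \<sigma>] exI[of _ val]) blast
qed

lemma frame_sign: "frame B \<sigma> val \<Longrightarrow> b \<in> B \<Longrightarrow> \<sigma> b = 1 \<or> \<sigma> b = -1"
  unfolding frame_def by blast

lemma frame_odd: "frame B \<sigma> val \<Longrightarrow> b \<in> B \<Longrightarrow> odd (val b)"
  unfolding frame_def by blast

text \<open>Blue weighted degrees are odd, so a non-blue vertex with even \<open>\<eta>\<close>-sum
  cannot collide with a blue one.\<close>

lemma frame_colourable:
  assumes "frame B \<sigma> val" "labelling \<eta>" "\<And>u v. u \<in> B \<Longrightarrow> v \<in> B \<Longrightarrow> \<eta> u v = 0"
    "\<And>b. b \<in> B \<Longrightarrow> D \<eta> b = \<sigma> b"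
    "\<And>q b. q \<in> V - B \<Longrightarrow> b \<in> B \<Longrightarrow> adj q b \<Longrightarrow> even (D \<eta> q) \<or> 2 * deg q + D \<eta> q \<noteq> val b"
    "\<And>q w. q \<in> V - B \<Longrightarrow> w \<in> V - B \<Longrightarrow> adj q w \<Longrightarrow> 2 * deg q + D \<eta> q \<noteq> 2 * deg w + D \<eta> w"
  shows colourable
proof -
  have "2 * deg q + D \<eta> q \<noteq> (if w \<in> B then val w else 2 * deg w + D \<eta> w)"
    if q: "q \<in> V - B" and w: "adj q w" for q w
  proof (cases "w \<in> B")
    case True
    then show ?thesis using assms(5)[OF q True w] frame_odd[OF assms(1) True] True
      by (metis even_add even_mult_iff even_numeral)
  next
    case False
    then have "w \<in> V - B" using adj_V[OF adj_sym[OF w]] by blast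
    then show ?thesis using assms(6)[OF q _ w] False by simp
  qed
  then show ?thesis
    using assms(1-4) unfolding frame_def by blast
qed

section \<open>Connected bipartite cores and labellings supported on them\<close>

definition bip :: "'a set \<Rightarrow> 'a set \<Rightarrow> 'a \<Rightarrow> 'a \<Rightarrow> bool" where
  "bip R B u v \<longleftrightarrow> adj u v \<and> (u \<in> R \<and> v \<in> B \<or> u \<in> B \<and> v \<in> R)"

text \<open>The core may miss part of \<open>V\<close>: exempted vertices, and blue vertices served
  by them alone, are left outside.\<close>

definition core :: "'a set \<Rightarrow> 'a set \<Rightarrow> bool" where
  "core R B \<longleftrightarrow> R \<inter> B = {} \<and> R \<union> B \<subseteq> V \<and> (\<forall>u\<in>R \<union> B. \<forall>v\<in>R \<union> B. (bip R B)\<^sup>*\<^sup>* u v)"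

definition indep :: "'a set \<Rightarrow> bool" where
  "indep R \<longleftrightarrow> (\<forall>u\<in>R. \<forall>v\<in>R. \<not> adj u v)"

lemma bip_sym: "bip R B u v \<Longrightarrow> bip R B v u"
  using adj_sym by (auto simp: bip_def)

lemma rtranclp_sym:
  assumes "\<And>a b. r a b \<Longrightarrow> r b a" "r\<^sup>*\<^sup>* u v"
  shows "r\<^sup>*\<^sup>* v u"
  using assms(2) by (induction rule: rtranclp_induct) (use assms(1) in \<open>auto intro: converse_rtranclp_into_rtranclp\<close>)

lemma coreI:
  assumes "R \<inter> B = {}" "R \<union> B \<subseteq> V" "\<And>v. v \<in> R \<union> B \<Longrightarrow> (bip R B)\<^sup>*\<^sup>* s v"
  shows "core R B"
proof -
  have "(bip R B)\<^sup>*\<^sup>* u v" if "u \<in> R \<union> B" "v \<in> R \<union> B" for u v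
    using rtranclp_sym[of "bip R B", OF bip_sym assms(3)[OF that(1)]] assms(3)[OF that(2)] by auto
  then show ?thesis using assms unfolding core_def by blast
qed

lemma bip_rtranclp_mono:
  assumes "(bip R B)\<^sup>*\<^sup>* u v" "R \<subseteq> R'" "B \<subseteq> B'"
  shows "(bip R' B')\<^sup>*\<^sup>* u v"
  by (rule rtranclp_mono[THEN predicate2D, OF _ assms(1)]) (use assms(2,3) in \<open>auto simp: bip_def\<close>)

text \<open>The support of \<open>\<eta>\<close> is a T-join whose odd vertices are \<open>P\<close>
  and the blue vertices with nonzero target; \<open>ev\<close> is the handshake condition. Each core
  edge has exactly one blue end, so the signs can be chosen at each blue vertex separately to hit
  \<open>\<tau>\<close>, and they do not influence the parities at red vertices.\<close>

lemma core_labelling_exists: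
  assumes core: "core R B" and \<tau>: "\<And>b. b \<in> B \<Longrightarrow> \<tau> b \<in> {-1, 0, 1}" and P: "P \<subseteq> R"
    and ev: "even (card {b\<in>B. \<tau> b \<noteq> 0} + card P)"
  shows "\<exists>\<eta>. labelling \<eta> \<and> (\<forall>u v. \<eta> u v \<noteq> 0 \<longrightarrow> bip R B u v) \<and> (\<forall>b\<in>B. D \<eta> b = \<tau> b) \<and>
    (\<forall>r\<in>R. odd (D \<eta> r) \<longleftrightarrow> r \<in> P)"
proof -
  define X where "X = {b\<in>B. \<tau> b \<noteq> 0} \<union> P"
  have sub: "R \<inter> B = {}" "R \<subseteq> V" "B \<subseteq> V" using core by (auto simp: core_def)
  have fin: "finite R" "finite B" "finite P" using sub P finV by (meson finite_subset)+
  have "card X = card {b\<in>B. \<tau> b \<noteq> 0} + card P"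
    unfolding X_def using fin P sub by (intro card_Un_disjoint) auto
  then have X: "even (card X)" "finite X" "X \<subseteq> R \<union> B" using ev fin P by (auto simp: X_def)
  have finb: "finite {b. bip R B a b}" for a
    by (rule finite_subset[OF _ finite_N[of a]]) (auto simp: bip_def)
  have conn: "(bip R B)\<^sup>*\<^sup>* u v" if "u \<in> X" "v \<in> X" for u v
    using that X(3) core unfolding core_def by blast
  obtain F where F: "\<And>a b. F a b \<Longrightarrow> F b a" "\<And>a b. F a b \<Longrightarrow> bip R B a b"
      "\<And>w. odd (card {x. F w x}) \<longleftrightarrow> w \<in> X"
    using join_exists[of "bip R B" X, OF bip_sym _ finb X(2,1) conn] adj_irrefl
    unfolding bip_def by blast
  have FN: "{x. F w x} \<subseteq> N w" for w using F(2) by (auto simp: bip_def)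
  have finF: "finite {x. F w x}" for w by (rule finite_subset[OF FN finite_N])
  have "\<exists>s. (\<forall>x. s x = 1 \<or> s x = -1) \<and> (\<Sum>x\<in>{x. F b x}. s x) = \<tau> b" if "b \<in> B" for b
    by (rule signs_with_sum_exist[OF finF \<tau>[OF that]]) (use F(3)[of b] that sub P in \<open>auto simp: X_def\<close>)
  then obtain s where s: "\<And>b x. b \<in> B \<Longrightarrow> s b x = 1 \<or> s b x = (-1::int)"
    "\<And>b. b \<in> B \<Longrightarrow> (\<Sum>x\<in>{x. F b x}. s b x) = \<tau> b"
    by metis
  define \<eta> where "\<eta> u v = (if F u v then if u \<in> B then s u v else s v u else 0)" for u v
  have D: "D \<eta> v = (\<Sum>x\<in>{x. F v x}. \<eta> v x)" for v
    unfolding D_def by (rule sum.mono_neutral_right) (use FN in \<open>auto simp: \<eta>_def\<close>)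
  have Fx: "u \<in> B \<and> v \<in> R \<or> u \<in> R \<and> v \<in> B" if "F u v" for u v
    using F(2)[OF that] by (auto simp: bip_def)
  have sym: "\<eta> u v = \<eta> v u" for u v
  proof (cases "F u v")
    case True
    then show ?thesis using Fx[OF True] F(1)[OF True] sub by (auto simp: \<eta>_def)
  next
    case False
    then show ?thesis using F(1)[of v u] by (auto simp: \<eta>_def)
  qed
  have vals: "\<eta> u v = 1 \<or> \<eta> u v = -1" if "F u v" for u v
    using that Fx[OF that] s(1)[of u v] s(1)[of v u] sub by (auto simp: \<eta>_def)
  have "labelling \<eta>"
    unfolding labelling_def
  proof (intro allI conjI sym)
    fix u v show "\<eta> u v \<in> {-1, 0, 1}" using vals[of u v] by (cases "F u v") (auto simp: \<eta>_def)
  qed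
  moreover have "bip R B u v" if "\<eta> u v \<noteq> 0" for u v
    using that F(2) by (auto simp: \<eta>_def split: if_splits)
  moreover have "D \<eta> b = \<tau> b" if "b \<in> B" for b
    unfolding D s(2)[OF that, symmetric] by (rule sum.cong) (use that in \<open>auto simp: \<eta>_def\<close>)
  moreover have "odd (D \<eta> r) \<longleftrightarrow> r \<in> P" if "r \<in> R" for r
  proof -
    have "{a \<in> {x. F r x}. odd (\<eta> r a)} = {x. F r x}" using vals by fastforce
    then have "odd (D \<eta> r) \<longleftrightarrow> odd (card {x. F r x})"
      unfolding D by (simp add: even_sum_iff[OF finF])
    then show ?thesis using F(3)[of r] that sub by (auto simp: X_def)
  qed
  ultimately show ?thesis by blast
qed

text \<open>Take a maximal independent \<open>R\<close> connected to \<open>s\<close> through its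
  neighbourhood \<open>nb R\<close>. If something of \<open>U\<close> were uncovered, an edge would
  lead from a covered \<open>u\<close> to an uncovered \<open>w\<close>. Then \<open>u\<close> lies
  in \<open>nb R\<close>, because \<open>w\<close> does not, and \<open>w\<close> could join
  \<open>R\<close>, being adjacent to no red vertex and reached through \<open>u\<close>.\<close>

lemma core_exists:
  assumes U: "U \<subseteq> V" and s: "s \<in> U"
    and conn: "\<And>v. v \<in> U \<Longrightarrow> (\<lambda>a b. adj a b \<and> a \<in> U \<and> b \<in> U)\<^sup>*\<^sup>* s v"
  shows "\<exists>R B. R \<union> B = U \<and> s \<in> R \<and> core R B \<and> indep R"
proof -
  define nb where "nb R = {w\<in>U. \<exists>r\<in>R. adj r w}" for R
  define good where "good R \<longleftrightarrow> R \<subseteq> U \<and> s \<in> R \<and> indep R \<and> (\<forall>v\<in>R \<union> nb R. (bip R (nb R))\<^sup>*\<^sup>* s v)" for R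
  have "good {s}"
    unfolding good_def
  proof (intro conjI ballI)
    fix v assume "v \<in> {s} \<union> nb {s}"
    then have "v = s \<or> bip {s} (nb {s}) s v" by (auto simp: nb_def bip_def)
    then show "(bip {s} (nb {s}))\<^sup>*\<^sup>* s v" by auto
  qed (use s adj_irrefl in \<open>auto simp: indep_def\<close>)
  then have ne: "{R. good R} \<noteq> {}" by blast
  have finU: "finite U" using U finV finite_subset by blast
  have "finite {R. good R}"
    by (rule finite_subset[of _ "Pow U"]) (use finU in \<open>auto simp: good_def\<close>)
  from finite_has_maximal[OF this ne]
  obtain R where R: "good R" and max: "\<And>R'. good R' \<Longrightarrow> R \<subseteq> R' \<Longrightarrow> R = R'"
    by auto
  have indep: "indep R" and RU: "R \<subseteq> U" and sR: "s \<in> R"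
    and reach: "\<And>v. v \<in> R \<union> nb R \<Longrightarrow> (bip R (nb R))\<^sup>*\<^sup>* s v"
    using R by (auto simp: good_def)
  have all: "R \<union> nb R = U"
  proof (rule ccontr)
    assume "\<not> ?thesis"
    moreover have "R \<union> nb R \<subseteq> U" using RU by (auto simp: nb_def)
    ultimately obtain w where w: "w \<in> U" "w \<notin> R \<union> nb R" by blast
    have "\<exists>u w. u \<in> R \<union> nb R \<and> w \<in> U - (R \<union> nb R) \<and> adj u w"
    proof (rule ccontr)
      assume no: "\<not> ?thesis"
      have "v \<in> R \<union> nb R" if "(\<lambda>a b. adj a b \<and> a \<in> U \<and> b \<in> U)\<^sup>*\<^sup>* s v" for v
        using that by (induction rule: rtranclp_induct) (use sR no in blast)+
      then show False using conn w by blast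
    qed
    then obtain u w where u: "u \<in> R \<union> nb R" and w: "w \<in> U" "w \<notin> R" "w \<notin> nb R" and uw: "adj u w" by blast
    have unb: "u \<in> nb R" using u w uw by (auto simp: nb_def)
    have mono: "nb R \<subseteq> nb (insert w R)" by (auto simp: nb_def)
    have step: "(bip (insert w R) (nb (insert w R)))\<^sup>*\<^sup>* s v" if "v \<in> R \<union> nb R" for v
      by (rule bip_rtranclp_mono[OF reach[OF that] _ mono]) auto
    have sw: "(bip (insert w R) (nb (insert w R)))\<^sup>*\<^sup>* s w"
      by (rule rtranclp.rtrancl_into_rtrancl[OF step[OF u]]) (use uw unb mono in \<open>auto simp: bip_def\<close>)
    have "good (insert w R)"
      unfolding good_def
    proof (intro conjI ballI)
      show "insert w R \<subseteq> U" "s \<in> insert w R" using RU w sR by auto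
      show "indep (insert w R)" using indep w adj_sym adj_irrefl unfolding indep_def nb_def by blast
      fix v assume "v \<in> insert w R \<union> nb (insert w R)"
      then consider "v \<in> R \<union> nb R" | "v = w" | "v \<in> nb (insert w R)" "adj w v"
        by (auto simp: nb_def)
      then show "(bip (insert w R) (nb (insert w R)))\<^sup>*\<^sup>* s v"
      proof cases
        case 3
        show ?thesis
          by (rule rtranclp.rtrancl_into_rtrancl[OF sw]) (use 3 in \<open>auto simp: bip_def\<close>)
      qed (use step sw in auto)
    qed
    then show False using max[of "insert w R"] w by blast
  qed
  have "R \<inter> nb R = {}" using indep by (auto simp: nb_def indep_def)
  then have "core R (nb R)" by (rule coreI[OF _ _ reach]) (use all U in auto)
  then show ?thesis using all sR indep by blast
qed

end

section \<open>Exempting one vertex from the parity rule\<close>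

lemma sum_card_level_sets_le:
  assumes "finite K" "finite J"
  shows "(\<Sum>t\<in>J. card {i\<in>K. f i = t}) \<le> card K"
proof -
  have "(\<Sum>t\<in>J. card {i\<in>K. f i = t}) = card (\<Union>t\<in>J. {i\<in>K. f i = t})"
    using assms by (intro card_UN_disjoint[symmetric]) auto
  also have "\<dots> \<le> card K" using assms by (intro card_mono) auto
  finally show ?thesis .
qed

text \<open>If exactly \<open>t\<close> signs are positive, the sum of the other signs is determined at each \<open>i\<close> by the sign
  of \<open>i\<close>, so that the elements of \<open>A t\<close> must be positive and those of \<open>A (t - 1)\<close> negative. If this
  is impossible for every \<open>t\<close>, then \<open>A t\<close> has more than \<open>t\<close> elements for every \<open>t < card K\<close>.\<close>

lemma signs_avoiding_partial_sums:
  fixes b :: "'a \<Rightarrow> int"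
  assumes fin: "finite K" and "card K \<ge> 2"
  shows "\<exists>e. (\<forall>i. e i = 1 \<or> e i = -1) \<and> (\<forall>i\<in>K. (\<Sum>j\<in>K. e j) - e i \<noteq> b i)"
proof -
  define k where "k = card K"
  \<comment> \<open>With \<open>t\<close> positive signs among \<open>k\<close> the total is
    \<open>2 * t - k\<close>. Leaving out a negative sign gives \<open>2 * t - k + 1\<close>,
    leaving out a positive one the same expression for \<open>t - 1\<close>.\<close>
  define A where "A t = {i\<in>K. b i = 2 * t - int k + 1}" for t :: int
  have finA: "finite (A t)" for t using fin by (simp add: A_def)
  have AK: "A t \<subseteq> K" for t by (auto simp: A_def)
  have tot: "(\<Sum>t\<in>J. card (A t)) \<le> k" if "finite J" for J :: "int set"
  proof -
    have "(\<Sum>t\<in>J. card (A t)) = (\<Sum>t\<in>(\<lambda>t. 2 * t - int k + 1) ` J. card {i\<in>K. b i = t})"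
      by (subst sum.reindex) (auto simp: inj_on_def A_def)
    also have "\<dots> \<le> k" unfolding k_def by (rule sum_card_level_sets_le) (use fin that in auto)
    finally show ?thesis .
  qed
  have good: ?thesis if t: "card (A (int t)) \<le> t" "t \<le> k - card (A (int t - 1))" for t
  proof -
    have "card (K - A (int t - 1)) = k - card (A (int t - 1))"
      using AK finA by (simp add: card_Diff_subset k_def)
    moreover have sub: "A (int t) \<subseteq> K - A (int t - 1)" by (auto simp: A_def)
    ultimately obtain U where U: "A (int t) \<subseteq> U" "U \<subseteq> K - A (int t - 1)" "card U = t"
      using exists_subset_between[OF t(1) _ sub] t(2) fin by auto
    define e :: "'a \<Rightarrow> int" where "e i = (if i \<in> U then 1 else -1)" for i
    have "U \<subseteq> K" using U by blast
    then have "(\<Sum>j\<in>K. e j) = int (card U) - int (card (K - U))"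
      using fin by (simp add: e_def sum.If_cases Int_absorb1 Diff_eq)
    also have "card (K - U) = k - t" using \<open>U \<subseteq> K\<close> U(3) fin by (simp add: card_Diff_subset finite_subset k_def)
    finally have S: "(\<Sum>j\<in>K. e j) = 2 * int t - int k"
      using t(2) by (simp add: U(3) of_nat_diff)
    have "(\<Sum>j\<in>K. e j) - e i \<noteq> b i" if "i \<in> K" for i
    proof (cases "i \<in> U")
      case True
      then have "i \<notin> A (int t - 1)" using U by blast
      then show ?thesis unfolding S using True that by (simp add: A_def e_def)
    next
      case False
      then have "i \<notin> A (int t)" using U by blast
      then show ?thesis unfolding S using False that by (simp add: A_def e_def)
    qed
    then show ?thesis by (intro exI[of _ e]) (simp add: e_def)
  qed
  show ?thesis
  proof (rule ccontr)
    assume no: "\<not> ?thesis"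
    have bad: "card (A (int t)) > t \<or> t > k - card (A (int t - 1))" for t
      using good[of t] no not_le by blast
    have k2: "k \<ge> 2" using assms by (simp add: k_def)
    have Ak: "card (A t) \<le> k" for t using card_mono[OF fin AK] by (simp add: k_def)
    \<comment> \<open>At \<open>t = k\<close> the first alternative of \<open>bad\<close> would need
      more than \<open>k\<close> elements, so the second holds and \<open>A (k - 1)\<close> is
      nonempty.\<close>
    have last: "card (A (int k - 1)) \<ge> 1" using bad[of k] Ak[of "int k"] by linarith
    have big: "t < k \<Longrightarrow> card (A (int t)) \<ge> t + 1" for t
    proof (induction t rule: less_induct)
      case (less t)
      show ?case
      proof (rule ccontr)
        assume "\<not> ?thesis"
        \<comment> \<open>With \<open>t = s + 1\<close>, the set \<open>A s\<close> has at least
          \<open>k - s\<close> elements, the sets before it together at least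
          \<open>1 + ... + s \<ge> s\<close>, and \<open>A (k - 1)\<close> at least one. These sets
          are disjoint and would have more than \<open>k\<close> elements.\<close>
        then have c: "card (A (int t - 1)) + t > k" using bad[of t] by linarith
        have "t \<noteq> 0"
        proof
          assume "t = 0"
          then show False using c Ak[of "-1"] by simp
        qed
        then obtain s where s: "t = Suc s" by (cases t) auto
        define J where "J = int ` {..<s}"
        have "(\<Sum>j<s. j + 1) \<le> (\<Sum>j<s. card (A (int j)))"
          by (intro sum_mono less.IH[unfolded s]) (use less.prems s in auto)
        also have "\<dots> = (\<Sum>j\<in>J. card (A j))" unfolding J_def by (subst sum.reindex) auto
        finally have J: "(\<Sum>j<s. j + 1) \<le> (\<Sum>j\<in>J. card (A j))" .
        have "(\<Sum>j\<in>insert (int s) (insert (int k - 1) J). card (A j)) =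
          card (A (int s)) + (card (A (int k - 1)) + (\<Sum>j\<in>J. card (A j)))"
        proof -
          have "int k - 1 \<notin> J" "int s \<notin> insert (int k - 1) J" "finite J"
            using less.prems s by (auto simp: J_def)
          then show ?thesis by simp
        qed
        moreover have "(\<Sum>j\<in>insert (int s) (insert (int k - 1) J). card (A j)) \<le> k"
          by (rule tot) (simp add: J_def)
        moreover have "card (A (int s)) + s + 1 > k" using c s by simp
        ultimately have "(\<Sum>j<s. j + 1) + 1 \<le> s" using J last by linarith
        moreover have "(\<Sum>j<s. j + 1) \<ge> s" using sum_mono[of "{..<s}" "\<lambda>_. 1" "\<lambda>j. j + 1"] by simp
        ultimately show False by linarith
      qed
    qed
    \<comment> \<open>Here \<open>k \<ge> 2\<close> enters: \<open>1 + ... + k\<close> exceeds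
      \<open>k\<close>. For a single element the sum of the other signs is always 0, which might be
      the forbidden value.\<close>
    have "(\<Sum>j<k. j + 1) \<le> (\<Sum>j<k. card (A (int j)))"
      by (intro sum_mono) (use big in auto)
    moreover have "(\<Sum>j<k. card (A (int j))) = (\<Sum>j\<in>int ` {..<k}. card (A j))"
      by (subst sum.reindex) auto
    moreover have "(\<Sum>j\<in>int ` {..<k}. card (A j)) \<le> k" by (rule tot) simp
    moreover have "(\<Sum>j<k. j + 1) > k"
    proof -
      have "(\<Sum>j<k. 1::nat) < (\<Sum>j<k. j + 1)"
        by (rule sum_strict_mono_ex1) (use k2 in \<open>auto intro: bexI[of _ 1]\<close>)
      then show ?thesis by simp
    qed
    ultimately show False by linarith
  qed
qed

section \<open>Colourability criteria according to the neighbours of the exempted vertices\<close>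

context fin_graph
begin

definition add_star :: "('a \<Rightarrow> 'a \<Rightarrow> int) \<Rightarrow> 'a \<Rightarrow> ('a \<Rightarrow> int) \<Rightarrow> 'a \<Rightarrow> 'a \<Rightarrow> int" where
  "add_star \<eta> x e u v = \<eta> u v + (if u = x \<and> adj x v then e v else if v = x \<and> adj x u then e u else 0)"

lemma labelling_add_star:
  assumes "labelling \<eta>" "\<And>v. adj x v \<Longrightarrow> \<eta> x v + e v \<in> {-1, 0, 1}"
  shows "labelling (add_star \<eta> x e)"
  unfolding labelling_def
proof (intro allI conjI)
  fix u v
  have \<eta>: "\<eta> u v = \<eta> v u" "\<eta> u v \<in> {-1, 0, 1}" using assms(1) unfolding labelling_def by blast+
  show "add_star \<eta> x e u v = add_star \<eta> x e v u"
    using \<eta>(1) adj_irrefl by (auto simp: add_star_def)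
  show "add_star \<eta> x e u v \<in> {-1, 0, 1}"
    using \<eta> assms(2)[of u] assms(2)[of v] unfolding add_star_def by (auto split: if_splits)
qed

lemma D_add_star_center: "D (add_star \<eta> x e) x = D \<eta> x + (\<Sum>v\<in>N x. e v)"
  by (simp add: D_def add_star_def sum.distrib)

lemma D_add_star:
  assumes "v \<noteq> x"
  shows "D (add_star \<eta> x e) v = D \<eta> v + (if adj x v then e v else 0)"
proof -
  have "D (add_star \<eta> x e) v = D \<eta> v + (\<Sum>w\<in>N v. if w = x then (if adj x v then e v else 0) else 0)"
    unfolding D_def sum.distrib[symmetric]
    by (rule sum.cong) (use assms in \<open>auto simp: add_star_def\<close>)
  then show ?thesis using adj_sym by (auto simp: sum.delta)
qed

lemma D_eq_0: "(\<And>w. \<eta> v w = 0) \<Longrightarrow> D \<eta> v = 0"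
  by (simp add: D_def)

lemma not_adj_self [simp]: "\<not> adj v v"
  by (rule adj_irrefl)

lemma frame_sign_set: "frame B \<sigma> val \<Longrightarrow> b \<in> B \<Longrightarrow> \<sigma> b \<in> {-1, 0, 1}"
  using frame_sign by fastforce

lemma core_sets:
  assumes "core R B"
  shows "R \<inter> B = {}" "R \<subseteq> V" "B \<subseteq> V" "finite R" "finite B"
proof -
  show 1: "R \<inter> B = {}" "R \<subseteq> V" "B \<subseteq> V" using assms by (auto simp: core_def)
  show "finite R" "finite B" using 1 finV by (meson finite_subset)+
qed

lemma bip_zero:
  assumes "\<forall>u v. \<eta> u v \<noteq> 0 \<longrightarrow> bip R B u v" "R \<inter> B = {}"
  shows "u \<in> B \<Longrightarrow> v \<in> B \<Longrightarrow> \<eta> u v = 0" "u \<notin> R \<union> B \<Longrightarrow> \<eta> u v = 0"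
  using assms unfolding bip_def by blast+

lemma colourable_even_core:
  assumes core: "core R B" and indep: "indep R" and V: "R \<union> B = V" and ev: "even (card B)"
  shows colourable
proof -
  note sets = core_sets[OF core]
  obtain \<sigma> val where fr: "frame B \<sigma> val" using frame_exists[OF sets(3)] by blast
  have "{b\<in>B. \<sigma> b \<noteq> 0} = B" using frame_sign[OF fr] by fastforce
  then have "even (card {b\<in>B. \<sigma> b \<noteq> 0} + card ({} :: 'a set))" using ev by simp
  from core_labelling_exists[OF core frame_sign_set[OF fr] _ this]
  obtain \<eta> where \<eta>: "labelling \<eta>" "\<forall>u v. \<eta> u v \<noteq> 0 \<longrightarrow> bip R B u v" "\<forall>b\<in>B. D \<eta> b = \<sigma> b"
    "\<forall>r\<in>R. even (D \<eta> r)" by auto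
  show colourable
  proof (rule frame_colourable[OF fr \<eta>(1)])
    show "\<eta> u v = 0" if "u \<in> B" "v \<in> B" for u v by (rule bip_zero(1)[OF \<eta>(2) sets(1) that])
    show "D \<eta> b = \<sigma> b" if "b \<in> B" for b using \<eta>(3) that by blast
    show "even (D \<eta> q) \<or> 2 * deg q + D \<eta> q \<noteq> val b" if "q \<in> V - B" for q b
      using \<eta>(4) that V by blast
    fix q w assume "q \<in> V - B" "w \<in> V - B" "adj q w"
    then show "2 * deg q + D \<eta> q \<noteq> 2 * deg w + D \<eta> w"
      using indep V unfolding indep_def by blast
  qed
qed

text \<open>For even \<open>card B\<close> the leaf edge keeps weight 2, and \<open>x\<close> has a
  smaller weighted degree than \<open>v\<close>. For odd \<open>card B\<close> the vertex
  \<open>v\<close> is made odd in the core and repaired by \<open>\<eta> = 1\<close> on the leaf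
  edge, so that \<open>x\<close> ends with weighted degree 3 next to an even
  \<open>v\<close>.\<close>

lemma colourable_leaf:
  assumes x: "x \<in> V" "N x = {v}" and v: "card (N v) \<ge> 2"
    and core: "core R B" and V: "R \<union> B = V - {x}" and vR: "v \<in> R" and indep: "indep R"
  shows colourable
proof -
  note sets = core_sets[OF core]
  have xRB: "x \<notin> R \<union> B" using V by blast
  have adjx: "adj x w \<longleftrightarrow> w = v" for w using x(2) by (auto simp: N_def)
  have adjx': "adj w x \<longleftrightarrow> w = v" for w using adjx adj_sym by blast
  have noxB: "\<not> adj x b" if "b \<in> B" for b using that adjx vR sets(1) by auto
  have degx: "deg x = 1" by (simp add: deg_def x(2))
  have vx: "v \<noteq> x" using adjx[of v] by auto
  obtain \<sigma> val where fr: "frame B \<sigma> val" using frame_exists[OF sets(3)] by blast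
  have B: "{b\<in>B. \<sigma> b \<noteq> 0} = B" using frame_sign[OF fr] by fastforce
  show colourable
  proof (cases "even (card B)")
    case True
    then have "even (card {b\<in>B. \<sigma> b \<noteq> 0} + card ({} :: 'a set))" using B by simp
    from core_labelling_exists[OF core frame_sign_set[OF fr] _ this]
    obtain \<eta> where \<eta>: "labelling \<eta>" "\<forall>u v. \<eta> u v \<noteq> 0 \<longrightarrow> bip R B u v" "\<forall>b\<in>B. D \<eta> b = \<sigma> b"
      "\<forall>r\<in>R. even (D \<eta> r)" by auto
    note zero = bip_zero[OF \<eta>(2) sets(1)]
    have Dx: "D \<eta> x = 0" by (rule D_eq_0) (rule zero(2)[OF xRB])
    have ge: "\<eta> v w \<ge> -1" for w 
    proof -
      have "\<eta> v w \<in> {-1, 0, 1}" using \<eta>(1) unfolding labelling_def by blast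
      then show ?thesis by auto
    qed
    have "\<eta> v x = 0" using zero(2)[OF xRB, of v] \<eta>(1) unfolding labelling_def by metis
    then have "D \<eta> v = (\<Sum>w\<in>N v - {x}. \<eta> v w)"
      unfolding D_def by (intro sum.mono_neutral_right) auto
    also have "\<dots> \<ge> (\<Sum>w\<in>N v - {x}. -1)" by (intro sum_mono ge)
    finally have "D \<eta> v \<ge> - int (card (N v - {x}))" by simp
    moreover have "card (N v - {x}) = card (N v) - 1"
      using adjx' by (subst card_Diff_singleton) auto
    \<comment> \<open>The leaf edge weighs 2, and the remaining edges at \<open>v\<close>, of which
      there is at least one, weigh at least 1 each.\<close>
    ultimately have Dv: "2 * deg v + D \<eta> v > 2" using v by (simp add: deg_def)
    show colourable
    proof (rule frame_colourable[OF fr \<eta>(1)])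
      show "\<eta> u w = 0" if "u \<in> B" "w \<in> B" for u w by (rule zero(1)[OF that])
      show "D \<eta> b = \<sigma> b" if "b \<in> B" for b using \<eta>(3) that by blast
      fix q w assume q: "q \<in> V - B" "w \<in> V - B" "adj q w"
      have "q \<in> R \<union> {x}" "w \<in> R \<union> {x}" using q V by blast+
      moreover have "\<not> (q \<in> R \<and> w \<in> R)" using indep q unfolding indep_def by blast
      ultimately have "q = x \<and> w = v \<or> q = v \<and> w = x" using adjx adjx' q(3) by auto
      then show "2 * deg q + D \<eta> q \<noteq> 2 * deg w + D \<eta> w"
        using Dv Dx degx by auto
    next
      fix q b assume q: "q \<in> V - B" "b \<in> B" "adj q b"
      have "q \<noteq> x" using q noxB by auto
      then show "even (D \<eta> q) \<or> 2 * deg q + D \<eta> q \<noteq> val b" using q V \<eta>(4) by blast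
    qed
  next
    case False
    then have ev: "even (card {b\<in>B. \<sigma> b \<noteq> 0} + card {v})" using B by simp
    have "{v} \<subseteq> R" using vR by simp
    from core_labelling_exists[OF core frame_sign_set[OF fr] this ev]
    obtain \<eta>0 where \<eta>0: "labelling \<eta>0" "\<forall>u v. \<eta>0 u v \<noteq> 0 \<longrightarrow> bip R B u v" "\<forall>b\<in>B. D \<eta>0 b = \<sigma> b"
      "\<forall>r\<in>R. odd (D \<eta>0 r) \<longleftrightarrow> r \<in> {v}" by blast
    note zero = bip_zero[OF \<eta>0(2) sets(1)]
    define \<eta> where "\<eta> = add_star \<eta>0 x (\<lambda>_. 1)"
    have lab: "labelling \<eta>" unfolding \<eta>_def
      by (rule labelling_add_star[OF \<eta>0(1)]) (simp add: zero(2)[OF xRB])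
    have Dx: "D \<eta> x = 1" unfolding \<eta>_def D_add_star_center using zero(2)[OF xRB] by (simp add: D_eq_0 x(2))
    have D: "D \<eta> w = D \<eta>0 w + (if w = v then 1 else 0)" if "w \<noteq> x" for w
      unfolding \<eta>_def D_add_star[OF that] adjx ..
    have evR: "even (D \<eta> r)" if "r \<in> R" for r
    proof -
      have "r \<noteq> x" using that xRB by blast
      moreover have "odd (D \<eta>0 r) \<longleftrightarrow> r = v" using \<eta>0(4) that by simp
      ultimately show ?thesis using D[of r] by (cases "r = v") simp_all
    qed
    show colourable
    proof (rule frame_colourable[OF fr lab])
      show "\<eta> u w = 0" if "u \<in> B" "w \<in> B" for u w
      proof -
        have "u \<noteq> x" "w \<noteq> x" using that xRB by blast+
        then show ?thesis using zero(1)[OF that] by (simp add: \<eta>_def add_star_def)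
      qed
      show "D \<eta> b = \<sigma> b" if "b \<in> B" for b
      proof -
        have "b \<noteq> x" "b \<noteq> v" using that xRB vR sets(1) by blast+
        then show ?thesis using D[of b] \<eta>0(3) that by simp
      qed
      fix q w assume q: "q \<in> V - B" "w \<in> V - B" "adj q w"
      have "q \<in> R \<union> {x}" "w \<in> R \<union> {x}" using q V by blast+
      moreover have "\<not> (q \<in> R \<and> w \<in> R)" using indep q unfolding indep_def by blast
      ultimately have "q = x \<and> w = v \<or> q = v \<and> w = x" using adjx adjx' q(3) by auto
      then show "2 * deg q + D \<eta> q \<noteq> 2 * deg w + D \<eta> w"
        using evR[OF vR] Dx even_mult_iff even_add by (metis even_numeral odd_one)
    next
      fix q b assume q: "q \<in> V - B" "b \<in> B" "adj q b"
      have "q \<noteq> x" using q noxB by auto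
      then show "even (D \<eta> q) \<or> 2 * deg q + D \<eta> q \<noteq> val b" using q V evR by blast
    qed
  qed
qed

lemma frame_sign_odd: "frame B \<sigma> val \<Longrightarrow> b \<in> B \<Longrightarrow> odd (\<sigma> b)"
  by (drule (1) frame_sign) auto

text \<open>\<open>x\<close> becomes even, so only its red neighbours \<open>K\<close> can collide
  with it. Their edges to \<open>x\<close> carry signs, compensated by odd sums in the core. The
  vertices of \<open>Y\<close> receive their \<open>\<sigma>\<close> from the edge to
  \<open>x\<close> instead of from the core, which corrects the parity both at \<open>x\<close> and
  in the core. Separating \<open>x\<close> from \<open>i\<close> in \<open>K\<close> forbids one
  value for the sum of the signs other than that of \<open>i\<close>, the situation of
  \<open>signs_avoiding_partial_sums\<close>.\<close>

lemma colourable_many_reds: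
  assumes x: "x \<in> V" and core: "core R B" and V: "R \<union> B = V - {x}" and indep: "indep R"
    and ev: "even (card B)" and K: "K = N x \<inter> R" "card K \<ge> 2"
    and Y: "Y \<subseteq> N x \<inter> B" "even (card K + card Y)"
  shows colourable
proof -
  note sets = core_sets[OF core]
  have xRB: "x \<notin> R \<union> B" using V by blast
  have KR: "K \<subseteq> R" and YB: "Y \<subseteq> B" using K Y by blast+
  have KY: "K \<inter> Y = {}" using KR YB sets(1) by blast
  have finK: "finite K" and finY: "finite Y" using KR YB sets finite_subset by metis+
  have adjK: "adj x r \<longleftrightarrow> r \<in> K" if "r \<in> R" for r using that K by auto
  obtain \<sigma> val where fr: "frame B \<sigma> val" using frame_exists[OF sets(3)] by blast
  define \<tau> where "\<tau> b = (if b \<in> Y then 0 else \<sigma> b)" for b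
  have \<tau>: "\<tau> b \<in> {-1, 0, 1}" if "b \<in> B" for b
    using frame_sign_set[OF fr that] by (simp add: \<tau>_def)
  have "{b\<in>B. \<tau> b \<noteq> 0} = B - Y" using frame_sign[OF fr] by (fastforce simp: \<tau>_def)
  moreover have "card (B - Y) = card B - card Y" using YB finY by (simp add: card_Diff_subset)
  moreover have "card Y \<le> card B" using YB sets by (simp add: card_mono)
  ultimately have par: "even (card {b\<in>B. \<tau> b \<noteq> 0} + card K)" using ev Y(2) by auto
  from core_labelling_exists[OF core \<tau> KR par]
  obtain \<eta>0 where \<eta>0: "labelling \<eta>0" "\<forall>u v. \<eta>0 u v \<noteq> 0 \<longrightarrow> bip R B u v" "\<forall>b\<in>B. D \<eta>0 b = \<tau> b"
    "\<forall>r\<in>R. odd (D \<eta>0 r) \<longleftrightarrow> r \<in> K" by blast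
  note zero = bip_zero[OF \<eta>0(2) sets(1)]
  define SY where "SY = (\<Sum>b\<in>Y. \<sigma> b)"
  obtain e where e: "\<And>i. e i = 1 \<or> e i = (-1 :: int)"
    and avoid: "\<And>i. i \<in> K \<Longrightarrow> (\<Sum>j\<in>K. e j) - e i \<noteq> 2 * deg i + D \<eta>0 i - 2 * deg x - SY"
    using signs_avoiding_partial_sums[OF finK K(2), of "\<lambda>i. 2 * deg i + D \<eta>0 i - 2 * deg x - SY"] by blast
  define f where "f v = (if v \<in> K then e v else if v \<in> Y then \<sigma> v else 0)" for v
  define \<eta> where "\<eta> = add_star \<eta>0 x f"
  have f: "f v \<in> {-1, 0, 1}" for v
    using e[of v] frame_sign_set[OF fr, of v] YB by (auto simp: f_def)
  have lab: "labelling \<eta>" unfolding \<eta>_def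
  proof (rule labelling_add_star[OF \<eta>0(1)])
    show "\<eta>0 x v + f v \<in> {-1, 0, 1}" for v using f[of v] zero(2)[OF xRB, of v] by simp
  qed
  have "(\<Sum>v\<in>N x. f v) = (\<Sum>v\<in>K \<union> Y. f v)"
    by (rule sum.mono_neutral_right) (use K Y in \<open>auto simp: f_def\<close>)
  also have "\<dots> = (\<Sum>v\<in>K. f v) + (\<Sum>v\<in>Y. f v)"
    by (rule sum.union_disjoint) (use finK finY KY in auto)
  also have "(\<Sum>v\<in>K. f v) = (\<Sum>v\<in>K. e v)" by (rule sum.cong) (auto simp: f_def)
  also have "(\<Sum>v\<in>Y. f v) = SY" unfolding SY_def
    by (rule sum.cong) (use KY in \<open>auto simp: f_def\<close>)
  finally have Dx: "D \<eta> x = (\<Sum>j\<in>K. e j) + SY"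
    unfolding \<eta>_def D_add_star_center using D_eq_0[of \<eta>0 x] zero(2)[OF xRB] by simp
  have D: "D \<eta> v = D \<eta>0 v + (if adj x v then f v else 0)" if "v \<noteq> x" for v
    unfolding \<eta>_def by (rule D_add_star[OF that])
  have odde: "odd (e i)" for i using e[of i] by auto
  have odds: "odd (\<sigma> b)" if "b \<in> Y" for b using frame_sign_odd[OF fr] that YB by blast
  have "{i\<in>K. odd (e i)} = K" "{b\<in>Y. odd (\<sigma> b)} = Y" using odde odds by auto
  then have evx: "even (D \<eta> x)"
    unfolding Dx SY_def using Y(2) by (simp add: even_sum_iff[OF finK] even_sum_iff[OF finY])
  have DK: "D \<eta> i = D \<eta>0 i + e i" if "i \<in> K" for i
  proof -
    have "i \<noteq> x" "adj x i" using that KR xRB K by auto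
    then show ?thesis using D[of i] that by (simp add: f_def)
  qed
  have evr: "even (D \<eta> r)" if r: "r \<in> R" for r
  proof (cases "r \<in> K")
    case True
    then show ?thesis using DK[OF True] \<eta>0(4) r odde[of r] by simp
  next
    case False
    have "r \<noteq> x" using r xRB by blast
    then show ?thesis using D[of r] False \<eta>0(4)[rule_format, OF r] adjK[OF r] by simp
  qed
  have ne: "2 * deg x + D \<eta> x \<noteq> 2 * deg i + D \<eta> i" if "i \<in> K" for i
    unfolding Dx DK[OF that] using avoid[OF that] by linarith
  show colourable
  proof (rule frame_colourable[OF fr lab])
    show "\<eta> u w = 0" if "u \<in> B" "w \<in> B" for u w
    proof -
      have "u \<noteq> x" "w \<noteq> x" using that xRB by blast+
      then show ?thesis using zero(1)[OF that] by (simp add: \<eta>_def add_star_def)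
    qed
    show "D \<eta> b = \<sigma> b" if "b \<in> B" for b
    proof -
      have "b \<noteq> x" "b \<notin> K" using that xRB KR sets(1) by blast+
      moreover have "D \<eta>0 b = \<tau> b" using \<eta>0(3) that by blast
      moreover have "b \<in> Y \<Longrightarrow> adj x b" using Y by auto
      ultimately show ?thesis using D[of b] by (simp add: f_def \<tau>_def)
    qed
    show "even (D \<eta> q) \<or> 2 * deg q + D \<eta> q \<noteq> val b" if "q \<in> V - B" for q b
    proof -
      have "q = x \<or> q \<in> R" using that V by blast
      then show ?thesis using evx evr by blast
    qed
    fix q w assume q: "q \<in> V - B" "w \<in> V - B" "adj q w"
    have "q = x \<or> q \<in> R" "w = x \<or> w \<in> R" using q V by blast+
    moreover have "\<not> (q \<in> R \<and> w \<in> R)" using indep q unfolding indep_def by blast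
    moreover have "\<not> (q = x \<and> w = x)" using q(3) by auto
    ultimately consider "q = x" "w \<in> R" | "w = x" "q \<in> R" by blast
    then show "2 * deg q + D \<eta> q \<noteq> 2 * deg w + D \<eta> w"
    proof cases
      case 1
      then show ?thesis using ne[of w] adjK[of w] q(3) by simp
    next
      case 2
      then have "adj x q" using q(3) adj_sym by blast
      then show ?thesis using ne[of q] adjK[of q] 2 by simp
    qed
  qed
qed

text \<open>Here \<open>x\<close> is exempted by making it odd and its red neighbour \<open>w\<close> turns blue, with \<open>x\<close> as its
  only neighbour outside the blue set.\<close>

lemma colourable_only_reds:
  assumes xw: "x \<in> V" "w \<in> V" "adj x w" and core: "core R B" and V: "R \<union> B = V - {x, w}"
    and indep: "indep (insert w R)" and ev: "even (card B)" and Nx: "N x \<subseteq> insert w R"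
    and r: "r1 \<in> N x" "r2 \<in> N x" "r1 \<in> R" "r2 \<in> R" "r1 \<noteq> r2"
  shows colourable
proof -
  note sets = core_sets[OF core]
  have xwn: "x \<noteq> w" using xw(3) by auto
  have xRB: "x \<notin> R \<union> B" and wRB: "w \<notin> R \<union> B" using V by blast+
  have noxB: "\<not> adj x b" if "b \<in> B" for b
  proof
    assume "adj x b"
    then have "b \<in> insert w R" using Nx by auto
    then show False using that wRB sets(1) by blast
  qed
  have "insert w B \<subseteq> V" using sets xw by blast
  then obtain \<sigma> val where fr: "frame (insert w B) \<sigma> val" using frame_exists by blast
  have sg: "\<sigma> b \<in> {-1, 0, 1}" if "b \<in> B" for b using frame_sign_set[OF fr] that by blast
  have "{b\<in>B. \<sigma> b \<noteq> 0} = B" using frame_sign[OF fr] by fastforce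
  moreover have "card {r1, r2} = 2" using r(5) by simp
  ultimately have par: "even (card {b\<in>B. \<sigma> b \<noteq> 0} + card {r1, r2})" using ev by simp
  have rR: "{r1, r2} \<subseteq> R" using r by simp
  from core_labelling_exists[OF core sg rR par]
  obtain \<eta>0 where \<eta>0: "labelling \<eta>0" "\<forall>u v. \<eta>0 u v \<noteq> 0 \<longrightarrow> bip R B u v" "\<forall>b\<in>B. D \<eta>0 b = \<sigma> b"
    "\<forall>r\<in>R. odd (D \<eta>0 r) \<longleftrightarrow> r \<in> {r1, r2}" by blast
  note zero = bip_zero[OF \<eta>0(2) sets(1)]
  have sw: "\<sigma> w = 1 \<or> \<sigma> w = -1" using frame_sign[OF fr] by blast
  \<comment> \<open>Both \<open>r1\<close> and \<open>r2\<close> get the same \<open>c\<close>, so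
    \<open>x\<close> remains odd. The two choices of \<open>c\<close> give it different weighted
    degrees, at most one of which is \<open>val w\<close>.\<close>
  obtain c :: int where c: "c = 1 \<or> c = -1" "2 * deg x + \<sigma> w + 2 * c \<noteq> val w"
  proof (cases "2 * deg x + \<sigma> w + 2 * 1 = val w")
    case True
    then show ?thesis using that[of "-1"] by simp
  next
    case False
    then show ?thesis using that[of 1] by simp
  qed
  define f where "f v = (if v = w then \<sigma> w else if v \<in> {r1, r2} then c else 0)" for v
  define \<eta> where "\<eta> = add_star \<eta>0 x f"
  have f: "f v \<in> {-1, 0, 1}" for v using c(1) sw by (auto simp: f_def)
  have lab: "labelling \<eta>" unfolding \<eta>_def
  proof (rule labelling_add_star[OF \<eta>0(1)])
    show "\<eta>0 x v + f v \<in> {-1, 0, 1}" for v using f[of v] zero(2)[OF xRB, of v] by simp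
  qed
  have wr: "w \<noteq> r1" "w \<noteq> r2" using rR wRB by blast+
  have "(\<Sum>v\<in>N x. f v) = (\<Sum>v\<in>{w, r1, r2}. f v)"
    by (rule sum.mono_neutral_right) (use r xw in \<open>auto simp: f_def\<close>)
  also have "\<dots> = \<sigma> w + 2 * c" using wr r(5) by (simp add: f_def)
  finally have Dx: "D \<eta> x = \<sigma> w + 2 * c"
    unfolding \<eta>_def D_add_star_center using D_eq_0[of \<eta>0 x] zero(2)[OF xRB] by simp
  have oddx: "odd (D \<eta> x)" unfolding Dx using sw by auto
  have D: "D \<eta> v = D \<eta>0 v + (if adj x v then f v else 0)" if "v \<noteq> x" for v
    unfolding \<eta>_def by (rule D_add_star[OF that])
  have evr: "even (D \<eta> q)" if q: "q \<in> R" for q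
  proof -
    have "q \<noteq> x" "q \<noteq> w" using q xRB wRB by blast+
    moreover have "odd c" using c(1) by auto
    ultimately show ?thesis using D[of q] \<eta>0(4)[rule_format, OF q] r(1,2) by (cases "q \<in> {r1, r2}") (auto simp: f_def)
  qed
  show colourable
  proof (rule frame_colourable[OF fr lab])
    show "\<eta> u v = 0" if "u \<in> insert w B" "v \<in> insert w B" for u v
    proof -
      have "u \<noteq> x" "v \<noteq> x" using that xRB xwn by blast+
      moreover have "\<eta>0 u v = 0"
      proof (cases "u = w \<or> v = w")
        case True
        then show ?thesis using zero(2)[OF wRB] \<eta>0(1) unfolding labelling_def by metis
      next
        case False
        then show ?thesis using zero(1) that by blast
      qed
      ultimately show ?thesis by (simp add: \<eta>_def add_star_def)
    qed
    show "D \<eta> b = \<sigma> b" if b: "b \<in> insert w B" for b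
    proof (cases "b = w")
      case True
      have "D \<eta>0 w = 0" by (rule D_eq_0) (rule zero(2)[OF wRB])
      then show ?thesis using D[of w] True xw xwn by (simp add: f_def)
    next
      case False
      then have "b \<in> B" "b \<noteq> x" using b xRB by blast+
      then show ?thesis using D[of b] noxB \<eta>0(3) by simp
    qed
    show "even (D \<eta> q) \<or> 2 * deg q + D \<eta> q \<noteq> val b"
      if "q \<in> V - insert w B" "b \<in> insert w B" "adj q b" for q b
    proof (cases "q = x")
      case True
      then have "b = w" using that noxB by blast
      then show ?thesis using True Dx c(2) by simp
    next
      case False
      then have "q \<in> R" using that V by blast
      then show ?thesis using evr by blast
    qed
    fix q v assume q: "q \<in> V - insert w B" "v \<in> V - insert w B" "adj q v"
    have "q = x \<or> q \<in> R" "v = x \<or> v \<in> R" using q V by blast+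
    moreover have "\<not> (q \<in> R \<and> v \<in> R)" using indep q unfolding indep_def by blast
    moreover have "\<not> (q = x \<and> v = x)" using q(3) by auto
    ultimately have "even (D \<eta> q) \<longleftrightarrow> odd (D \<eta> v)" using oddx evr by blast
    then show "2 * deg q + D \<eta> q \<noteq> 2 * deg v + D \<eta> v"
      by (metis even_add even_mult_iff even_numeral)
  qed
qed

text \<open>If \<open>x\<close>, untouched by \<open>\<eta>0\<close>, collides with its only red
  neighbour \<open>r\<close>, the triangle is used: add \<open>d\<close> on \<open>xy\<close>,
  subtract \<open>d\<close> on \<open>yr\<close> and add 1 on \<open>xr\<close>. The sum at the blue
  \<open>y\<close> is preserved, \<open>x\<close> and \<open>r\<close> stay even, and their
  difference becomes \<open>2 * d\<close>.\<close>

lemma colourable_triangle: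
  assumes x: "x \<in> V" and core: "core R B" and V: "R \<union> B = V - {x}" and indep: "indep R"
    and ev: "even (card B)" and Nx: "N x \<inter> R = {r}" and y: "y \<in> B" "adj x y" "adj y r"
  shows colourable
proof -
  note sets = core_sets[OF core]
  have xRB: "x \<notin> R \<union> B" using V by blast
  have rR: "r \<in> R" and xr: "adj x r" using Nx by auto
  have rx: "r \<noteq> x" and yx: "y \<noteq> x" and yr: "y \<noteq> r" using rR y sets(1) xRB by blast+
  have adjR: "adj x q \<longleftrightarrow> q = r" if "q \<in> R" for q
  proof -
    have "q \<in> N x \<inter> R \<longleftrightarrow> q = r" unfolding Nx by simp
    then show ?thesis using that by simp
  qed
  obtain \<sigma> val where fr: "frame B \<sigma> val" using frame_exists[OF sets(3)] by blast
  have "{b\<in>B. \<sigma> b \<noteq> 0} = B" using frame_sign[OF fr] by fastforce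
  then have par: "even (card {b\<in>B. \<sigma> b \<noteq> 0} + card ({} :: 'a set))" using ev by simp
  from core_labelling_exists[OF core frame_sign_set[OF fr] empty_subsetI par]
  obtain \<eta>0 where \<eta>0: "labelling \<eta>0" "\<forall>u v. \<eta>0 u v \<noteq> 0 \<longrightarrow> bip R B u v" "\<forall>b\<in>B. D \<eta>0 b = \<sigma> b"
    "\<forall>r\<in>R. odd (D \<eta>0 r) \<longleftrightarrow> r \<in> {}" by blast
  note zero = bip_zero[OF \<eta>0(2) sets(1)]
  have goal: colourable if lab: "labelling \<eta>" and z: "\<And>u v. u \<in> B \<Longrightarrow> v \<in> B \<Longrightarrow> \<eta> u v = 0"
    and s: "\<And>b. b \<in> B \<Longrightarrow> D \<eta> b = \<sigma> b" and evr: "\<And>q. q \<in> R \<Longrightarrow> even (D \<eta> q)" and evx: "even (D \<eta> x)"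
    and ne: "2 * deg x + D \<eta> x \<noteq> 2 * deg r + D \<eta> r" for \<eta>
  proof (rule frame_colourable[OF fr lab z s])
    show "even (D \<eta> q) \<or> 2 * deg q + D \<eta> q \<noteq> val b" if "q \<in> V - B" for q b
    proof -
      have "q = x \<or> q \<in> R" using that V by blast
      then show ?thesis using evx evr by blast
    qed
    fix q w assume q: "q \<in> V - B" "w \<in> V - B" "adj q w"
    have "q = x \<or> q \<in> R" "w = x \<or> w \<in> R" using q V by blast+
    moreover have "\<not> (q \<in> R \<and> w \<in> R)" using indep q unfolding indep_def by blast
    moreover have "\<not> (q = x \<and> w = x)" using q(3) by auto
    ultimately consider "q = x" "w \<in> R" | "w = x" "q \<in> R" by blast
    then show "2 * deg q + D \<eta> q \<noteq> 2 * deg w + D \<eta> w"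
    proof cases
      case 1
      then show ?thesis using ne adjR[of w] q(3) by simp
    next
      case 2
      then have "adj x q" using q(3) adj_sym by blast
      then show ?thesis using ne adjR[of q] 2 by simp
    qed
  qed
  have Dx0: "D \<eta>0 x = 0" by (rule D_eq_0) (rule zero(2)[OF xRB])
  show colourable
  proof (cases "2 * deg x = 2 * deg r + D \<eta>0 r")
    case False
    show ?thesis
      by (rule goal[OF \<eta>0(1) zero(1)]) (use \<eta>0(3,4) Dx0 False in simp_all)
  next
    case eq: True
    have h: "\<eta>0 y r \<in> {-1, 0, 1}" "\<eta>0 r y = \<eta>0 y r" using \<eta>0(1) unfolding labelling_def by blast+
    \<comment> \<open>The sign for which the label of \<open>yr\<close> stays in range after
      subtracting \<open>d\<close>.\<close>
    obtain d :: int where d: "d = 1 \<or> d = -1" "\<eta>0 r y - d \<in> {-1, 0, 1}"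
    proof (cases "\<eta>0 r y = 1")
      case True
      then show ?thesis using that[of 1] by simp
    next
      case False
      then show ?thesis using that[of "-1"] h by auto
    qed
    define f where "f v = (if v = y then d else if v = r then 1 else 0)" for v
    define g where "g v = (if v = y then - d else 0)" for v
    define \<eta>1 where "\<eta>1 = add_star \<eta>0 x f"
    define \<eta> where "\<eta> = add_star \<eta>1 r g"
    have lab1: "labelling \<eta>1" unfolding \<eta>1_def
    proof (rule labelling_add_star[OF \<eta>0(1)])
      show "\<eta>0 x v + f v \<in> {-1, 0, 1}" for v using d(1) zero(2)[OF xRB, of v] by (auto simp: f_def)
    qed
    have lab: "labelling \<eta>" unfolding \<eta>_def
    proof (rule labelling_add_star[OF lab1])
      fix v
      show "\<eta>1 r v + g v \<in> {-1, 0, 1}"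
      proof (cases "v = y")
        case True
        then have "\<eta>1 r v = \<eta>0 r y" using rx yx by (simp add: \<eta>1_def add_star_def)
        then show ?thesis using d(2) True by (simp add: g_def)
      next
        case False
        have "\<eta>1 r v \<in> {-1, 0, 1}" using lab1 unfolding labelling_def by blast
        then show ?thesis using False by (simp add: g_def)
      qed
    qed
    have "(\<Sum>v\<in>N x. f v) = (\<Sum>v\<in>{y, r}. f v)"
      by (rule sum.mono_neutral_right) (use y xr in \<open>auto simp: f_def\<close>)
    then have Dx1: "D \<eta>1 x = d + 1"
      unfolding \<eta>1_def D_add_star_center Dx0 using yr by (simp add: f_def)
    have D1: "D \<eta>1 v = D \<eta>0 v + (if adj x v then f v else 0)" if "v \<noteq> x" for v
      unfolding \<eta>1_def by (rule D_add_star[OF that])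
    have D: "D \<eta> v = D \<eta>1 v + (if adj r v then g v else 0)" if "v \<noteq> r" for v
      unfolding \<eta>_def by (rule D_add_star[OF that])
    have Dx: "D \<eta> x = d + 1" using D[of x] rx yx Dx1 by (simp add: g_def)
    have "(\<Sum>v\<in>N r. g v) = (\<Sum>v\<in>{y}. g v)"
      by (rule sum.mono_neutral_right) (use adj_sym[OF y(3)] in \<open>auto simp: g_def\<close>)
    then have Dr: "D \<eta> r = D \<eta>0 r + 1 - d"
      unfolding \<eta>_def D_add_star_center using D1[OF rx] xr yr by (simp add: f_def g_def)
    have ev0: "even (D \<eta>0 q)" if "q \<in> R" for q using \<eta>0(4) that by simp
    have evd: "even (d + 1)" "even (1 - d)" using d(1) by auto
    show ?thesis
    proof (rule goal[OF lab])
      show "\<eta> u v = 0" if "u \<in> B" "v \<in> B" for u v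
      proof -
        have "u \<noteq> x" "v \<noteq> x" "u \<noteq> r" "v \<noteq> r" using that xRB rR sets(1) by blast+
        then show ?thesis using zero(1)[OF that] by (simp add: \<eta>_def \<eta>1_def add_star_def)
      qed
      show "D \<eta> b = \<sigma> b" if "b \<in> B" for b
      proof -
        have "b \<noteq> x" "b \<noteq> r" using that xRB rR sets(1) by blast+
        moreover have "D \<eta>0 b = \<sigma> b" using \<eta>0(3) that by blast
        ultimately show ?thesis using D[of b] D1[of b] y(2) adj_sym[OF y(3)] by (simp add: f_def g_def)
      qed
      show "even (D \<eta> q)" if "q \<in> R" for q
      proof (cases "q = r")
        case True
        then show ?thesis using Dr ev0[OF rR] evd by (simp add: add_diff_eq[symmetric] del: even_diff)
      next
        case False
        have "q \<noteq> x" "q \<noteq> y" using that xRB y(1) sets(1) by blast+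
        then show ?thesis using D[of q] D1[of q] False ev0[OF that] by (simp add: f_def g_def)
      qed
      show "even (D \<eta> x)" using Dx evd by simp
      show "2 * deg x + D \<eta> x \<noteq> 2 * deg r + D \<eta> r"
        unfolding Dx Dr using eq d(1) by linarith
    qed
  qed
qed

text \<open>\<open>x\<close> and \<open>z\<close> are both exempted and made even; they have no red
  neighbours, so only the edge between them can fail. The vertices of \<open>A\<close> and
  \<open>A'\<close> get their \<open>\<sigma>\<close> from the edges to \<open>x\<close> and
  \<open>z\<close> instead of from the core, those of \<open>W\<close> all from the edges to
  \<open>z\<close>. The label \<open>c\<close> of \<open>xz\<close> corrects both parities at once
  and cancels in the comparison, which leaves exactly \<open>ne\<close>.\<close>

lemma colourable_adjacent_pair:
  assumes xz: "x \<in> V" "z \<in> V" "adj x z" and core: "core R B"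
    and V: "R \<union> B \<union> W = V - {x, z}" and W: "W \<inter> (R \<union> B) = {}" and indep: "indep R"
    and ev: "even (card B)" "even (card W)"
    and Nx: "N x \<subseteq> insert z B" and Nz: "N z \<subseteq> insert x (B \<union> W)" and Wz: "W \<subseteq> N z"
    and fr: "frame (B \<union> W) \<sigma> val"
    and A: "A \<subseteq> N x \<inter> B" "A' \<subseteq> N z \<inter> B" "A \<inter> A' = {}" "even (card A + card A')"
    and ne: "2 * deg x + sum \<sigma> A \<noteq> 2 * deg z + sum \<sigma> A' + sum \<sigma> W"
  shows colourable
proof -
  note sets = core_sets[OF core]
  have xnz: "x \<noteq> z" using xz(3) by auto
  have zx: "adj z x" using xz(3) adj_sym by blast
  have xRB: "x \<notin> R \<union> B" "x \<notin> W" and zRB: "z \<notin> R \<union> B" "z \<notin> W" using V by blast+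
  have finW: "finite W" using V finV by (metis finite_Diff finite_Un)
  have AB: "A \<subseteq> B" "A' \<subseteq> B" using A by blast+
  have finA: "finite A" "finite A'" using AB sets finite_subset by metis+
  have noxR: "\<not> adj x r" if "r \<in> R" for r
  proof
    assume "adj x r"
    then have "r \<in> insert z B" using Nx by auto
    then show False using that zRB sets(1) by blast
  qed
  have noxW: "\<not> adj x p" if "p \<in> W" for p
  proof
    assume "adj x p"
    then have "p \<in> insert z B" using Nx by auto
    then show False using that zRB W by blast
  qed
  have nozR: "\<not> adj z r" if "r \<in> R" for r
  proof
    assume "adj z r"
    then have "r \<in> insert x (B \<union> W)" using Nz by auto
    then show False using that xRB W sets(1) by blast
  qed
  have sg: "\<sigma> b = 1 \<or> \<sigma> b = -1" if "b \<in> B \<union> W" for b using frame_sign[OF fr that] .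
  define \<tau> where "\<tau> b = (if b \<in> A \<union> A' then 0 else \<sigma> b)" for b
  have \<tau>: "\<tau> b \<in> {-1, 0, 1}" if "b \<in> B" for b
    using sg[of b] that by (auto simp: \<tau>_def)
  have "{b\<in>B. \<tau> b \<noteq> 0} = B - (A \<union> A')"
  proof -
    have "\<sigma> b \<noteq> 0" if "b \<in> B" for b using sg[of b] that by auto
    then show ?thesis by (auto simp: \<tau>_def)
  qed
  moreover have "card (B - (A \<union> A')) = card B - card (A \<union> A')" using AB finA by (simp add: card_Diff_subset)
  moreover have "card (A \<union> A') = card A + card A'" using finA A(3) by (simp add: card_Un_disjoint)
  moreover have "card (A \<union> A') \<le> card B" using AB sets by (simp add: card_mono)
  ultimately have par: "even (card {b\<in>B. \<tau> b \<noteq> 0} + card ({} :: 'a set))" using ev(1) A(4) by auto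
  from core_labelling_exists[OF core \<tau> empty_subsetI par]
  obtain \<eta>0 where \<eta>0: "labelling \<eta>0" "\<forall>u v. \<eta>0 u v \<noteq> 0 \<longrightarrow> bip R B u v" "\<forall>b\<in>B. D \<eta>0 b = \<tau> b"
    "\<forall>r\<in>R. odd (D \<eta>0 r) \<longleftrightarrow> r \<in> {}" by blast
  note zero = bip_zero[OF \<eta>0(2) sets(1)]
  define c :: int where "c = (if odd (card A) then 1 else 0)"
  define f where "f v = (if v \<in> A then \<sigma> v else if v = z then c else 0)" for v
  define g where "g v = (if v \<in> A' \<union> W then \<sigma> v else 0)" for v
  define \<eta>1 where "\<eta>1 = add_star \<eta>0 x f"
  define \<eta> where "\<eta> = add_star \<eta>1 z g"
  have zA: "z \<notin> A" "x \<notin> A'" "x \<notin> A" using AB xRB zRB by blast+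
  have f: "f v \<in> {-1, 0, 1}" for v using sg[of v] AB by (auto simp: f_def c_def)
  have g: "g v \<in> {-1, 0, 1}" for v using sg[of v] AB by (auto simp: g_def)
  have gx: "g x = 0" using zA xRB by (simp add: g_def)
  have fz: "f z = c" using zA by (simp add: f_def)
  have lab1: "labelling \<eta>1" unfolding \<eta>1_def
  proof (rule labelling_add_star[OF \<eta>0(1)])
    show "\<eta>0 x v + f v \<in> {-1, 0, 1}" for v using f[of v] zero(2)[OF xRB(1), of v] by simp
  qed
  have lab: "labelling \<eta>" unfolding \<eta>_def
  proof (rule labelling_add_star[OF lab1])
    fix v
    show "\<eta>1 z v + g v \<in> {-1, 0, 1}"
    proof (cases "v = x")
      case True
      then show ?thesis using lab1 gx unfolding labelling_def by simp
    next
      case False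
      then have "\<eta>1 z v = 0" using zero(2)[OF zRB(1), of v] xnz by (simp add: \<eta>1_def add_star_def)
      then show ?thesis using g[of v] by simp
    qed
  qed
  have D1: "D \<eta>1 v = D \<eta>0 v + (if adj x v then f v else 0)" if "v \<noteq> x" for v
    unfolding \<eta>1_def by (rule D_add_star[OF that])
  have D: "D \<eta> v = D \<eta>1 v + (if adj z v then g v else 0)" if "v \<noteq> z" for v
    unfolding \<eta>_def by (rule D_add_star[OF that])
  have Nsub: "insert z A \<subseteq> N x" "A' \<union> W \<subseteq> N z" using A Wz xz(3) by auto
  have "(\<Sum>v\<in>N x. f v) = (\<Sum>v\<in>insert z A. f v)"
    by (rule sum.mono_neutral_right[OF finite_N Nsub(1)]) (simp add: f_def)
  also have "\<dots> = c + (\<Sum>v\<in>A. f v)" using zA finA fz by simp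
  also have "(\<Sum>v\<in>A. f v) = sum \<sigma> A" by (rule sum.cong) (simp_all add: f_def)
  finally have Dx1: "D \<eta>1 x = c + sum \<sigma> A"
    unfolding \<eta>1_def D_add_star_center using D_eq_0[of \<eta>0 x] zero(2)[OF xRB(1)] by simp
  have Dx: "D \<eta> x = c + sum \<sigma> A" using D[of x] xnz gx Dx1 by simp
  have A'W: "A' \<inter> W = {}" using AB W by blast
  have "(\<Sum>v\<in>N z. g v) = (\<Sum>v\<in>A' \<union> W. g v)"
    by (rule sum.mono_neutral_right[OF finite_N Nsub(2)]) (simp add: g_def)
  also have "\<dots> = (\<Sum>v\<in>A' \<union> W. \<sigma> v)" by (rule sum.cong) (simp_all add: g_def)
  also have "\<dots> = sum \<sigma> A' + sum \<sigma> W" by (rule sum.union_disjoint[OF finA(2) finW A'W])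
  finally have Dz: "D \<eta> z = c + (sum \<sigma> A' + sum \<sigma> W)"
    unfolding \<eta>_def D_add_star_center using D1[of z] xnz xz(3) fz D_eq_0[of \<eta>0 z] zero(2)[OF zRB(1)] by simp
  have odds: "odd (\<sigma> b)" if "b \<in> B \<union> W" for b by (rule frame_sign_odd[OF fr that])
  have parsum: "even (sum \<sigma> X) \<longleftrightarrow> even (card X)" if "X \<subseteq> B \<union> W" "finite X" for X
  proof -
    have "{b\<in>X. odd (\<sigma> b)} = X" using odds that by blast
    then show ?thesis using even_sum_iff[OF that(2), of \<sigma>] by simp
  qed
  have p1: "even (sum \<sigma> A) \<longleftrightarrow> even (card A)" by (rule parsum) (use AB finA in auto)
  have p2: "even (sum \<sigma> A') \<longleftrightarrow> even (card A')" by (rule parsum) (use AB finA in auto)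
  have p3: "even (sum \<sigma> W)" using parsum[of W] finW ev(2) by simp
  have evx: "even (D \<eta> x)" unfolding Dx using p1 by (auto simp: c_def)
  have evz: "even (D \<eta> z)" unfolding Dz using p2 p3 A(4) by (auto simp: c_def)
  have evr: "even (D \<eta> r)" if r: "r \<in> R" for r
  proof -
    have "r \<noteq> x" "r \<noteq> z" using r xRB zRB by blast+
    moreover have "\<not> odd (D \<eta>0 r)" using \<eta>0(4)[rule_format, OF r] by simp
    ultimately show ?thesis using D[of r] D1[of r] noxR[OF r] nozR[OF r] by simp
  qed
  have nexz: "2 * deg x + D \<eta> x \<noteq> 2 * deg z + D \<eta> z" unfolding Dx Dz using ne by linarith
  show colourable
  proof (rule frame_colourable[OF fr lab])
    show "\<eta> u v = 0" if "u \<in> B \<union> W" "v \<in> B \<union> W" for u v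
    proof -
      have "u \<noteq> x" "v \<noteq> x" "u \<noteq> z" "v \<noteq> z" using that xRB zRB by blast+
      moreover have "\<eta>0 u v = 0"
      proof (cases "u \<in> B")
        case True
        show ?thesis
        proof (cases "v \<in> B")
          case False
          then have "v \<notin> R \<union> B" using that W by blast
          then show ?thesis using zero(2)[of v u] \<eta>0(1) unfolding labelling_def by metis
        qed (use True zero(1) in blast)
      next
        case False
        then have "u \<notin> R \<union> B" using that W by blast
        then show ?thesis by (rule zero(2))
      qed
      ultimately show ?thesis by (simp add: \<eta>_def \<eta>1_def add_star_def)
    qed
    show "D \<eta> b = \<sigma> b" if b: "b \<in> B \<union> W" for b
    proof -
      have bx: "b \<noteq> x" "b \<noteq> z" using b xRB zRB by blast+
      show ?thesis
      proof (cases "b \<in> W")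
        case True
        then have "b \<notin> R \<union> B" using W by blast
        then have "D \<eta>0 b = 0" by (intro D_eq_0 zero(2))
        moreover have "adj z b" using True Wz by auto
        ultimately show ?thesis using D[of b] D1[of b] bx noxW[OF True] True by (simp add: g_def)
      next
        case False
        then have bB: "b \<in> B" using b by blast
        have "D \<eta>0 b = \<tau> b" using \<eta>0(3) bB by blast
        moreover have "b \<in> A \<Longrightarrow> adj x b \<and> b \<notin> A'" "b \<in> A' \<Longrightarrow> adj z b \<and> b \<notin> A" using A by auto
        ultimately show ?thesis using D[of b] D1[of b] bx False
          by (cases "b \<in> A"; cases "b \<in> A'") (auto simp: f_def g_def \<tau>_def)
      qed
    qed
    show "even (D \<eta> q) \<or> 2 * deg q + D \<eta> q \<noteq> val b" if "q \<in> V - (B \<union> W)" for q b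
    proof -
      have "q = x \<or> q = z \<or> q \<in> R" using that V by blast
      then show ?thesis using evx evz evr by blast
    qed
    fix q w assume q: "q \<in> V - (B \<union> W)" "w \<in> V - (B \<union> W)" "adj q w"
    have "q = x \<or> q = z \<or> q \<in> R" "w = x \<or> w = z \<or> w \<in> R" using q V by blast+
    moreover have "\<not> (q \<in> R \<and> w \<in> R)" using indep q unfolding indep_def by blast
    moreover have "q \<noteq> w" using q(3) by auto
    moreover have "\<not> (q \<in> R \<and> (w = x \<or> w = z))" using noxR nozR adj_sym[OF q(3)] by blast
    moreover have "\<not> (w \<in> R \<and> (q = x \<or> q = z))" using noxR nozR q(3) by blast
    ultimately have "q = x \<and> w = z \<or> q = z \<and> w = x" by blast
    then show "2 * deg q + D \<eta> q \<noteq> 2 * deg w + D \<eta> w" using nexz by auto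
  qed
qed

text \<open>Of three vertices in \<open>N x \<inter> B\<close> and \<open>N z \<inter> B\<close>, not all in the same set, two can be chosen so that
  moving their signs \<open>\<sigma>\<close> to the edges to \<open>x\<close> and \<open>z\<close> changes the difference of the weighted degrees of \<open>x\<close> and \<open>z\<close>.\<close>

lemma colourable_adjacent_pair_or_degree_two:
  assumes xz: "x \<in> V" "z \<in> V" "adj x z" and core: "core R B"
    and V: "R \<union> B \<union> W = V - {x, z}" and W: "W \<inter> (R \<union> B) = {}" and indep: "indep R"
    and ev: "even (card B)" "even (card W)"
    and Nx: "N x \<subseteq> insert z B" and Nz: "N z \<subseteq> insert x (B \<union> W)" and Wz: "W \<subseteq> N z"
    and disj: "N x \<inter> N z = {}" and ex: "N x \<inter> B \<noteq> {}" "N z \<inter> B \<noteq> {}"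
  shows "colourable \<or> card (N x) = 2 \<and> card (N z) = 2"
proof (rule disjCI)
  assume no: "\<not> (card (N x) = 2 \<and> card (N z) = 2)"
  note sets = core_sets[OF core]
  have "x \<notin> R \<union> B" "z \<notin> R \<union> B" "x \<notin> W" using V by blast+
  have "B \<union> W \<subseteq> V" using V by blast
  then obtain \<sigma> val where fr: "frame (B \<union> W) \<sigma> val" using frame_exists by blast
  have finW: "finite W" using V finV by (metis finite_Diff finite_Un)
  show colourable
  proof (rule ccontr)
    assume nc: "\<not> colourable"
    \<comment> \<open>Each admissible pair \<open>A\<close>, \<open>A'\<close> gives a labelling, so
      without a colouring all of them must produce a collision of \<open>x\<close> and
      \<open>z\<close>. Comparing small pairs then restricts the signs.\<close>
    have eq: "2 * deg x + sum \<sigma> A = 2 * deg z + sum \<sigma> A' + sum \<sigma> W"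
      if "A \<subseteq> N x \<inter> B" "A' \<subseteq> N z \<inter> B" "even (card A + card A')" for A A'
    proof -
      have "A \<inter> A' = {}" using that disj by blast
      then show ?thesis
        using colourable_adjacent_pair[OF xz core V W indep ev Nx Nz Wz fr that(1,2) _ that(3)] nc by blast
    qed
    have eq0: "2 * deg x = 2 * deg z + sum \<sigma> W" using eq[of "{}" "{}"] by simp
    have sg: "\<sigma> b = 1 \<or> \<sigma> b = -1" if "b \<in> B \<union> W" for b using frame_sign[OF fr that] .
    obtain y z' where y: "y \<in> N x \<inter> B" and z': "z' \<in> N z \<inter> B" using ex by blast
    have same: "\<sigma> y = \<sigma> z'" if "y \<in> N x \<inter> B" "z' \<in> N z \<inter> B" for y z'
      using eq[of "{y}" "{z'}"] that eq0 by simp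
    have Y: "N x \<inter> B = {y}"
    proof (rule ccontr)
      assume "N x \<inter> B \<noteq> {y}"
      then obtain y' where y': "y' \<in> N x \<inter> B" "y' \<noteq> y" using y by blast
      have "\<sigma> y + \<sigma> y' = 0" using eq[of "{y, y'}" "{}"] y y' eq0 by simp
      moreover have "\<sigma> y = \<sigma> y'" using same[OF y z'] same[OF y'(1) z'] by simp
      ultimately show False using sg[of y] y by auto
    qed
    have Z: "N z \<inter> B = {z'}"
    proof (rule ccontr)
      assume "N z \<inter> B \<noteq> {z'}"
      then obtain y' where y': "y' \<in> N z \<inter> B" "y' \<noteq> z'" using z' by blast
      have "\<sigma> z' + \<sigma> y' = 0" using eq[of "{}" "{z', y'}"] z' y' eq0 by simp
      moreover have "\<sigma> z' = \<sigma> y'" using same[OF y z'] same[OF y y'(1)] by simp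
      ultimately show False using sg[of z'] z' by auto
    qed
    have "N x = insert z (N x \<inter> B)" using Nx xz(3) by auto
    then have Nx': "N x = {z, y}" using Y by simp
    have "N z = insert x ((N z \<inter> B) \<union> W)" using Nz Wz adj_sym[OF xz(3)] by auto
    then have Nz': "N z = insert x (insert z' W)" using Z by simp
    have "z \<noteq> y" using y \<open>z \<notin> R \<union> B\<close> by blast
    then have dx: "card (N x) = 2" using Nx' by simp
    have "x \<noteq> z'" "z' \<notin> W" using z' \<open>x \<notin> R \<union> B\<close> W by blast+
    then have dz: "card (N z) = 2 + card W" using Nz' \<open>x \<notin> W\<close> finW by simp
    \<comment> \<open>By the two degrees, \<open>eq0\<close> says that \<open>sum \<sigma> W\<close>
      is \<open>- 2 * card W\<close>, whereas signs give at least \<open>- card W\<close>; hence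
      \<open>W\<close> is empty.\<close>
    have "(\<Sum>p\<in>W. -1) \<le> sum \<sigma> W" by (rule sum_mono) (use sg in force)
    then have "- int (card W) \<le> sum \<sigma> W" by simp
    then have "card W = 0" using eq0 dx dz by (simp add: deg_def)
    then show False using no dx dz by simp
  qed
qed

text \<open>The path \<open>u\<close>, \<open>x\<close>, \<open>z\<close>, \<open>v\<close> gets the
  labels \<open>\<alpha>\<close>, \<open>\<beta>\<close>, \<open>\<gamma>\<close>. Both inner
  vertices have degree 2 and share \<open>\<beta>\<close>, so they differ as soon as
  \<open>\<alpha> \<noteq> \<gamma>\<close>; \<open>\<beta>\<close> remains free for avoiding
  \<open>u\<close> and \<open>v\<close>.\<close>

lemma colourable_two_path:
  assumes xz: "x \<in> V" "z \<in> V" and Nx: "N x = {z, u}" and Nz: "N z = {x, v}"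
    and ne: "z \<noteq> u" "x \<noteq> v" "u \<noteq> v" and core: "core R B" and V: "R \<union> B = V - {x, z}"
    and u: "u \<in> R" and indep: "indep R"
  shows colourable
proof -
  note sets = core_sets[OF core]
  have adjx: "adj x w \<longleftrightarrow> w = z \<or> w = u" for w
  proof -
    have "w \<in> N x \<longleftrightarrow> w = z \<or> w = u" unfolding Nx by simp
    then show ?thesis by simp
  qed
  have adjz: "adj z w \<longleftrightarrow> w = x \<or> w = v" for w
  proof -
    have "w \<in> N z \<longleftrightarrow> w = x \<or> w = v" unfolding Nz by simp
    then show ?thesis by simp
  qed
  have xnz: "x \<noteq> z" using adjx[of z] by auto
  have xRB: "x \<notin> R \<union> B" and zRB: "z \<notin> R \<union> B" using V by blast+
  have deg2: "deg x = 2" "deg z = 2" using Nx Nz ne by (simp_all add: deg_def)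
  have vnz: "v \<noteq> z" using adjz[of z] by auto
  have unx: "u \<noteq> x" using adjx[of x] by auto
  have vRB: "v \<in> R \<union> B"
  proof -
    have "v \<in> V" using adj_V[OF adj_sym] adjz by blast
    then show ?thesis using V vnz ne by blast
  qed
  obtain \<sigma> val where fr: "frame B \<sigma> val" using frame_exists[OF sets(3)] by blast
  \<comment> \<open>\<open>\<pi>\<close> tells whether \<open>\<beta>\<close> is odd, and
    \<open>v\<close> dictates it: \<open>z\<close> must be odd next to a red \<open>v\<close> and
    even next to a blue one. If \<open>\<beta>\<close> is odd, \<open>x\<close> is even and one sign
    of \<open>\<beta>\<close> avoids \<open>u\<close>; if \<open>\<beta> = 0\<close>,
    \<open>x\<close> is odd while \<open>u\<close> is even.\<close>
  have main: colourable if \<alpha>: "\<alpha> = 1 \<or> \<alpha> = (-1::int)" and \<gamma>: "\<gamma> \<in> {-1, 0, 1}" "\<alpha> \<noteq> \<gamma>"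
    "v \<in> B \<Longrightarrow> \<gamma> = 0 \<or> \<gamma> = \<sigma> v" and P: "P = (if v \<in> R \<and> odd \<gamma> then {u, v} else {u})"
    and par: "even (card {b\<in>B. \<not> (b = v \<and> \<gamma> \<noteq> 0)} + card P)"
    and \<pi>: "v \<in> R \<Longrightarrow> \<pi> \<longleftrightarrow> even \<gamma>" "v \<in> B \<Longrightarrow> \<pi> \<longleftrightarrow> odd \<gamma>" for \<alpha> \<gamma> P \<pi>
  proof -
    define \<tau> where "\<tau> b = (if b = v \<and> \<gamma> \<noteq> 0 then 0 else \<sigma> b)" for b
    have \<tau>: "\<tau> b \<in> {-1, 0, 1}" if "b \<in> B" for b
      using frame_sign_set[OF fr that] by (simp add: \<tau>_def)
    have "{b\<in>B. \<tau> b \<noteq> 0} = {b\<in>B. \<not> (b = v \<and> \<gamma> \<noteq> 0)}"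
    proof -
      have "\<sigma> b \<noteq> 0" if "b \<in> B" for b using frame_sign[OF fr that] by auto
      then show ?thesis by (auto simp: \<tau>_def)
    qed
    then have par': "even (card {b\<in>B. \<tau> b \<noteq> 0} + card P)" using par by simp
    have "P \<subseteq> R" using P u by (auto split: if_splits)
    from core_labelling_exists[OF core \<tau> this par']
    obtain \<eta>0 where \<eta>0: "labelling \<eta>0" "\<forall>u v. \<eta>0 u v \<noteq> 0 \<longrightarrow> bip R B u v" "\<forall>b\<in>B. D \<eta>0 b = \<tau> b"
      "\<forall>r\<in>R. odd (D \<eta>0 r) \<longleftrightarrow> r \<in> P" by blast
    note zero = bip_zero[OF \<eta>0(2) sets(1)]
    obtain \<beta> :: int where \<beta>: "\<pi> \<Longrightarrow> \<beta> = 1 \<or> \<beta> = -1" "\<pi> \<Longrightarrow> \<beta> \<noteq> 2 * deg u + D \<eta>0 u - 4" "\<not> \<pi> \<Longrightarrow> \<beta> = 0"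
    proof (cases "\<pi>")
      case True
      show ?thesis
      proof (cases "2 * deg u + D \<eta>0 u - 4 = 1")
        case True
        show ?thesis by (rule that[of "-1"]) (use True \<open>\<pi>\<close> in auto)
      next
        case False
        show ?thesis by (rule that[of 1]) (use False \<open>\<pi>\<close> in auto)
      qed
    next
      case False
      show ?thesis by (rule that[of 0]) (use False in auto)
    qed
    have \<beta>val: "\<beta> \<in> {-1, 0, 1}" and \<beta>odd: "odd \<beta> \<longleftrightarrow> \<pi>" using \<beta> by (cases \<pi>; auto)+
    define f where "f w = (if w = u then \<alpha> else if w = z then \<beta> else 0)" for w
    define g where "g w = (if w = v then \<gamma> else 0)" for w
    define \<eta>1 where "\<eta>1 = add_star \<eta>0 x f"
    define \<eta> where "\<eta> = add_star \<eta>1 z g"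
    have f: "f w \<in> {-1, 0, 1}" for w using \<alpha> \<beta>val by (auto simp: f_def)
    have lab1: "labelling \<eta>1" unfolding \<eta>1_def
    proof (rule labelling_add_star[OF \<eta>0(1)])
      show "\<eta>0 x w + f w \<in> {-1, 0, 1}" for w using f[of w] zero(2)[OF xRB, of w] by simp
    qed
    have lab: "labelling \<eta>" unfolding \<eta>_def
    proof (rule labelling_add_star[OF lab1])
      fix w
      show "\<eta>1 z w + g w \<in> {-1, 0, 1}"
      proof (cases "w = v")
        case True
        then have "\<eta>1 z w = 0" using zero(2)[OF zRB, of w] xnz ne by (simp add: \<eta>1_def add_star_def)
        then show ?thesis using \<gamma> True by (simp add: g_def)
      next
        case False
        then show ?thesis using lab1 unfolding labelling_def by (simp add: g_def)
      qed
    qed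
    have D1: "D \<eta>1 w = D \<eta>0 w + (if adj x w then f w else 0)" if "w \<noteq> x" for w
      unfolding \<eta>1_def by (rule D_add_star[OF that])
    have D: "D \<eta> w = D \<eta>1 w + (if adj z w then g w else 0)" if "w \<noteq> z" for w
      unfolding \<eta>_def by (rule D_add_star[OF that])
    have D0: "D \<eta>0 x = 0" "D \<eta>0 z = 0" by (intro D_eq_0 zero(2)[OF xRB]) (intro D_eq_0 zero(2)[OF zRB])
    have "D \<eta>1 x = \<alpha> + \<beta>" unfolding \<eta>1_def D_add_star_center D0 Nx using ne by (simp add: f_def)
    then have Dx: "D \<eta> x = \<alpha> + \<beta>" using D[OF xnz] ne by (simp add: g_def)
    have "D \<eta>1 z = \<beta>" using D1[of z] xnz adjx D0 ne by (simp add: f_def)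
    then have Dz: "D \<eta> z = \<beta> + \<gamma>" unfolding \<eta>_def D_add_star_center Nz using ne by (simp add: g_def)
    have Dw: "D \<eta> w = D \<eta>0 w + (if w = u then \<alpha> else 0) + (if w = v then \<gamma> else 0)" if "w \<noteq> x" "w \<noteq> z" for w
      using D[OF that(2)] D1[OF that(1)] that adjx adjz by (simp add: f_def g_def)
    have uw: "u \<noteq> x" "u \<noteq> z" using unx ne by auto
    have Du: "D \<eta> u = D \<eta>0 u + \<alpha>" using Dw[OF uw] ne by simp
    have odd\<alpha>: "odd \<alpha>" using \<alpha> by auto
    have evr: "even (D \<eta> r)" if r: "r \<in> R" for r
    proof -
      have rx: "r \<noteq> x" "r \<noteq> z" using r xRB zRB by blast+
      have "odd (D \<eta>0 r) \<longleftrightarrow> r = u \<or> r = v \<and> odd \<gamma>"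
        using \<eta>0(4)[rule_format, OF r] P r by (auto split: if_splits)
      then show ?thesis using Dw[OF rx] odd\<alpha> ne by (cases "r = u"; cases "r = v") auto
    qed
    have nexz: "2 * deg x + D \<eta> x \<noteq> 2 * deg z + D \<eta> z" unfolding Dx Dz deg2 using \<gamma>(2) by simp
    have nexu: "2 * deg x + D \<eta> x \<noteq> 2 * deg u + D \<eta> u"
    proof (cases \<pi>)
      case True
      then show ?thesis unfolding Dx Du deg2 using \<beta>(2)[OF True] by linarith
    next
      case False
      then have "odd (D \<eta> x)" unfolding Dx using odd\<alpha> \<beta>odd by simp
      then show ?thesis using evr[OF u] by (metis even_add even_mult_iff even_numeral)
    qed
    have nezv: "2 * deg z + D \<eta> z \<noteq> 2 * deg v + D \<eta> v" if "v \<in> R"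
    proof -
      have "odd (D \<eta> z)" unfolding Dz using \<beta>odd \<pi>(1)[OF that] by auto
      then show ?thesis using evr[OF that] by (metis even_add even_mult_iff even_numeral)
    qed
    show colourable
    proof (rule frame_colourable[OF fr lab])
      show "\<eta> a b = 0" if "a \<in> B" "b \<in> B" for a b
      proof -
        have "a \<noteq> x" "b \<noteq> x" "a \<noteq> z" "b \<noteq> z" using that xRB zRB by blast+
        then show ?thesis using zero(1)[OF that] by (simp add: \<eta>_def \<eta>1_def add_star_def)
      qed
      show "D \<eta> b = \<sigma> b" if b: "b \<in> B" for b
      proof -
        have bx: "b \<noteq> x" "b \<noteq> z" "b \<noteq> u" using b xRB zRB u sets(1) by blast+
        have "D \<eta>0 b = \<tau> b" using \<eta>0(3) b by blast
        then show ?thesis using Dw[OF bx(1,2)] bx(3) \<gamma>(3) b by (auto simp: \<tau>_def)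
      qed
      show "even (D \<eta> q) \<or> 2 * deg q + D \<eta> q \<noteq> val b" if q: "q \<in> V - B" "b \<in> B" "adj q b" for q b
      proof -
        have "b \<noteq> u" "b \<noteq> x" "b \<noteq> z" using q(2) u xRB zRB sets(1) by blast+
        then have "q \<noteq> x" "q = z \<Longrightarrow> v \<in> B" using q adjx adjz by auto
        moreover have "q = x \<or> q = z \<or> q \<in> R" using q V by blast
        moreover have "even (D \<eta> z)" if "v \<in> B" unfolding Dz using \<beta>odd \<pi>(2)[OF that] by auto
        ultimately show ?thesis using evr by blast
      qed
      fix q w assume q: "q \<in> V - B" "w \<in> V - B" "adj q w"
      have *: "q = x \<or> q = z \<or> q \<in> R" "w = x \<or> w = z \<or> w \<in> R" using q V by blast+
      have w: "adj w q" by (rule adj_sym[OF q(3)])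
      have nRR: "\<not> (q \<in> R \<and> w \<in> R)" using indep q unfolding indep_def by blast
      consider "q = x" | "q = z" | "w = x" | "w = z" using * nRR by blast
      then show "2 * deg q + D \<eta> q \<noteq> 2 * deg w + D \<eta> w"
      proof cases
        case 1
        then show ?thesis using q(3) adjx nexz nexu by auto
      next
        case 2
        then have "w = x \<or> w = v" using q(3) adjz by blast
        then show ?thesis
        proof
          assume "w = v"
          then have "v \<in> R" using q(2) vRB by blast
          then show ?thesis using nezv 2 \<open>w = v\<close> by simp
        qed (use 2 nexz in auto)
      next
        case 3
        then show ?thesis using w adjx nexz nexu by auto
      next
        case 4
        then have "q = x \<or> q = v" using w adjz by blast
        then show ?thesis
        proof
          assume "q = v"
          then have "v \<in> R" using q(1) vRB by blast
          then show ?thesis using nezv 4 \<open>q = v\<close> by simp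
        qed (use 4 nexz in auto)
      qed
    qed
  qed
  \<comment> \<open>The vertex \<open>u\<close> always counts in \<open>P\<close>. For odd
    \<open>card B\<close> this balances the core with \<open>\<gamma> = 0\<close>; for even
    \<open>card B\<close> the correction comes from \<open>v\<close>, as a second odd vertex if it
    is red, or by taking its \<open>\<sigma>\<close> from \<open>z\<close> if it is blue.\<close>
  show colourable
  proof (cases "v \<in> R")
    case True
    then have vB: "v \<notin> B" using sets(1) by blast
    have B: "{b\<in>B. b \<noteq> v} = B" using vB by auto
    show ?thesis
    proof (cases "even (card B)")
      case even: True
      show ?thesis
        by (rule main[of 1 "-1" "{u, v}" False]) (use even True vB ne in \<open>auto simp: B\<close>)
    next
      case odd: False
      show ?thesis
        by (rule main[of 1 0 "{u}" True]) (use odd True vB in \<open>auto simp: B\<close>)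
    qed
  next
    case False
    then have vB: "v \<in> B" using vRB by blast
    show ?thesis
    proof (cases "even (card B)")
      case odd: False
      show ?thesis
        by (rule main[of 1 0 "{u}" False]) (use odd False in auto)
    next
      case even: True
      have s: "\<sigma> v = 1 \<or> \<sigma> v = -1" using frame_sign[OF fr vB] .
      have "{b\<in>B. \<not> (b = v \<and> \<sigma> v \<noteq> 0)} = B - {v}" using s by auto
      moreover have "card (B - {v}) = card B - 1" "card B > 0" using vB sets by (auto simp: card_gt_0_iff)
      ultimately have "even (card {b\<in>B. \<not> (b = v \<and> \<sigma> v \<noteq> 0)} + card {u})" using even by simp
      then show ?thesis
        by (intro main[of "- \<sigma> v" "\<sigma> v" "{u}" True]) (use s False in auto)
    qed
  qed
qed

end

section \<open>Finite connected graphs\<close>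

lemma distance_levels:
  shows "\<exists>l::'a \<Rightarrow> nat. l s = 0 \<and> (\<forall>v. r\<^sup>*\<^sup>* s v \<longrightarrow> l v = 0 \<longrightarrow> v = s) \<and>
    (\<forall>v. r\<^sup>*\<^sup>* s v \<longrightarrow> v \<noteq> s \<longrightarrow> (\<exists>u. r\<^sup>*\<^sup>* s u \<and> r u v \<and> l v = Suc (l u))) \<and>
    (\<forall>u v. r\<^sup>*\<^sup>* s u \<longrightarrow> r u v \<longrightarrow> l v \<le> Suc (l u))"
proof -
  define l where "l v = (LEAST n. (r ^^ n) s v)" for v
  have least: "(r ^^ l v) s v" if "r\<^sup>*\<^sup>* s v" for v
    unfolding l_def using rtranclp_imp_relpowp[OF that] by (auto intro: LeastI)
  have le: "l v \<le> n" if "(r ^^ n) s v" for v n unfolding l_def using that by (rule Least_le)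
  have step: "l v \<le> Suc (l u)" if "r\<^sup>*\<^sup>* s u" "r u v" for u v
    by (rule le) (use least[OF that(1)] that(2) in auto)
  have zero: "v = s" if "r\<^sup>*\<^sup>* s v" "l v = 0" for v using least[OF that(1)] that(2) by simp
  have "\<exists>u. r\<^sup>*\<^sup>* s u \<and> r u v \<and> l v = Suc (l u)" if v: "r\<^sup>*\<^sup>* s v" "v \<noteq> s" for v
  proof -
    obtain n where n: "l v = Suc n" using zero[OF v(1)] v(2) by (cases "l v") auto
    then have "(r ^^ Suc n) s v" using least[OF v(1)] by simp
    then obtain u where u: "(r ^^ n) s u" "r u v" by auto
    then have su: "r\<^sup>*\<^sup>* s u" by (simp add: relpowp_imp_rtranclp)
    have "l u \<le> n" by (rule le[OF u(1)])
    moreover have "Suc n \<le> Suc (l u)" using step[OF su u(2)] n by simp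
    ultimately show ?thesis using su u(2) n by auto
  qed
  moreover have "l s = 0" using le[of 0 s] by simp
  ultimately show ?thesis using zero step by (intro exI[of _ l]) blast
qed

section \<open>Distance levels of a core and removal of vertices at maximal level\<close>

context fin_graph
begin

text \<open>\<open>l\<close> is the distance from \<open>s\<close> in the bipartite graph, recorded
  by its local properties; the colours alternate along edges, so red means even distance.\<close>

definition levels :: "'a set \<Rightarrow> 'a set \<Rightarrow> 'a \<Rightarrow> ('a \<Rightarrow> nat) \<Rightarrow> bool" where
  "levels R B s l \<longleftrightarrow> l s = 0 \<and> (\<forall>v\<in>R \<union> B. l v = 0 \<longrightarrow> v = s) \<and>
    (\<forall>v\<in>R \<union> B. v \<noteq> s \<longrightarrow> (\<exists>u. bip R B u v \<and> l v = Suc (l u))) \<and>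
    (\<forall>u v. bip R B u v \<longrightarrow> l v \<le> Suc (l u)) \<and> (\<forall>v\<in>R \<union> B. even (l v) \<longleftrightarrow> v \<in> R)"

lemma levels_exist:
  assumes core: "core R B" and s: "s \<in> R"
  shows "\<exists>l. levels R B s l"
proof -
  note sets = core_sets[OF core]
  have reach: "(bip R B)\<^sup>*\<^sup>* s v" if "v \<in> R \<union> B" for v
    using core s that unfolding core_def by blast
  obtain l :: "'a \<Rightarrow> nat" where l: "l s = 0" "\<forall>v. (bip R B)\<^sup>*\<^sup>* s v \<longrightarrow> l v = 0 \<longrightarrow> v = s"
    "\<forall>v. (bip R B)\<^sup>*\<^sup>* s v \<longrightarrow> v \<noteq> s \<longrightarrow> (\<exists>u. (bip R B)\<^sup>*\<^sup>* s u \<and> bip R B u v \<and> l v = Suc (l u))"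
    "\<forall>u v. (bip R B)\<^sup>*\<^sup>* s u \<longrightarrow> bip R B u v \<longrightarrow> l v \<le> Suc (l u)"
    using distance_levels[of s "bip R B"] by (elim exE conjE) (rule that)
  have ends: "u \<in> R \<union> B \<and> v \<in> R \<union> B" if "bip R B u v" for u v using that by (auto simp: bip_def)
  have par: "\<exists>u. bip R B u v \<and> l v = Suc (l u)" if "v \<in> R \<union> B" "v \<noteq> s" for v
    using l(3) reach[OF that(1)] that(2) by blast
  have "v \<in> R \<union> B \<Longrightarrow> even (l v) \<longleftrightarrow> v \<in> R" for v
  proof (induction "l v" arbitrary: v rule: less_induct)
    case less
    show ?case
    proof (cases "v = s")
      case True
      then show ?thesis using l(1) s by simp
    next
      case False
      then obtain u where u: "bip R B u v" "l v = Suc (l u)" using par less.prems by blast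
      then have "even (l u) \<longleftrightarrow> u \<in> R" using less.hyps[of u] ends by simp
      moreover have "u \<in> R \<longleftrightarrow> v \<notin> R" using u(1) sets(1) unfolding bip_def by blast
      ultimately show ?thesis using u(2) by simp
    qed
  qed
  moreover have "l v \<le> Suc (l u)" if "bip R B u v" for u v
    using l(4) reach ends that by blast
  ultimately show ?thesis
    unfolding levels_def using l(1,2) par reach by (intro exI[of _ l]) blast
qed

text \<open>Vertices up to level \<open>n\<close> keep a shortest path from \<open>s\<close>, since
  its other vertices lie below level \<open>n\<close> and are all retained; vertices above level
  \<open>n\<close> are attached to one of these by \<open>high\<close>.\<close>

lemma core_levels:
  assumes core: "core R B" and l: "levels R B s l" and sub: "R' \<subseteq> R" "B' \<subseteq> B" and s: "s \<in> R'"
    and low: "\<And>u. u \<in> R \<union> B \<Longrightarrow> l u < n \<Longrightarrow> u \<in> R' \<union> B'"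
    and high: "\<And>v. v \<in> R' \<union> B' \<Longrightarrow> l v > n \<Longrightarrow> \<exists>u. bip R' B' u v \<and> l u \<le> n"
  shows "core R' B'"
proof -
  note sets = core_sets[OF core]
  have restrict: "bip R' B' u v" if "bip R B u v" "u \<in> R' \<union> B'" "v \<in> R' \<union> B'" for u v
    using that sub sets(1) unfolding bip_def by blast
  have reach: "v \<in> R' \<union> B' \<Longrightarrow> l v \<le> n \<Longrightarrow> (bip R' B')\<^sup>*\<^sup>* s v" for v
  proof (induction "l v" arbitrary: v rule: less_induct)
    case less
    show ?case
    proof (cases "v = s")
      case False
      have vRB: "v \<in> R \<union> B" using less.prems sub by blast
      then obtain u where u: "bip R B u v" "l v = Suc (l u)" using l False unfolding levels_def by blast
      have "u \<in> R \<union> B" using u(1) by (auto simp: bip_def)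
      then have uR: "u \<in> R' \<union> B'" using low u(2) less.prems(2) by simp
      then have "(bip R' B')\<^sup>*\<^sup>* s u" using less.hyps[of u] u(2) less.prems(2) by simp
      then show ?thesis
        using restrict[OF u(1) uR less.prems(1)] by (rule rtranclp.rtrancl_into_rtrancl)
    qed simp
  qed
  show ?thesis
  proof (rule coreI)
    show "R' \<inter> B' = {}" "R' \<union> B' \<subseteq> V" using sub sets by blast+
    fix v assume v: "v \<in> R' \<union> B'"
    show "(bip R' B')\<^sup>*\<^sup>* s v"
    proof (cases "l v \<le> n")
      case True
      then show ?thesis by (rule reach[OF v])
    next
      case False
      then obtain u where u: "bip R' B' u v" "l u \<le> n" using high[OF v] by auto
      then have "u \<in> R' \<union> B'" by (auto simp: bip_def)
      from reach[OF this u(2)] show ?thesis using u(1) by (rule rtranclp.rtrancl_into_rtrancl)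
    qed
  qed
qed

lemma other_neighbour:
  assumes "card (N v) \<ge> 2"
  shows "\<exists>w. adj v w \<and> w \<noteq> u"
proof (rule ccontr)
  assume "\<not> ?thesis"
  then have "N v \<subseteq> {u}" by auto
  then have "card (N v) \<le> card {u}" by (intro card_mono) auto
  then show False using assms by simp
qed

text \<open>\<open>r\<close> has a second blue neighbour, so removing \<open>x\<close> alone also
  leaves a core, and \<open>colourable_many_reds\<close> applies, with a blue neighbour of
  \<open>x\<close> as parity correction if \<open>x\<close> has an odd number of red ones. If there
  is no blue neighbour, \<open>x\<close> has at least three red ones, so two remain when
  \<open>r\<close> turns blue.\<close>

lemma colourable_removable_pair:
  assumes x: "x \<in> B" and r: "r \<in> R" and xr: "adj x r" and core: "core (R - {r}) (B - {x})"
    and V: "R \<union> B = V" and RB: "R \<inter> B = {}" and indep: "indep R" and od: "odd (card B)"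
    and dr: "card (N r) \<ge> 2" and K2: "card (N x \<inter> R) \<ge> 2"
  shows colourable
proof -
  have finB: "finite B" using V finV by (metis finite_Un)
  have xV: "x \<in> V" and rV: "r \<in> V" using x r V by blast+
  have ev: "even (card (B - {x}))" using od x finB by (simp add: card_Diff_singleton)
  obtain b where b: "adj r b" "b \<noteq> x" using other_neighbour[OF dr] by blast
  have "b \<in> V" using adj_V[OF adj_sym[OF b(1)]] .
  moreover have "b \<notin> R" using indep r b(1) unfolding indep_def by blast
  ultimately have bB: "b \<in> B - {x}" using V b by blast
  have core': "core R (B - {x})"
  proof (rule coreI[where s = b])
    show "R \<inter> (B - {x}) = {}" "R \<union> (B - {x}) \<subseteq> V" using RB V by blast+
    fix v assume v: "v \<in> R \<union> (B - {x})"
    show "(bip R (B - {x}))\<^sup>*\<^sup>* b v"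
    proof (cases "v = r")
      case True
      have "bip R (B - {x}) b r" using adj_sym[OF b(1)] bB r by (simp add: bip_def)
      then show ?thesis using True by auto
    next
      case False
      then have "(bip (R - {r}) (B - {x}))\<^sup>*\<^sup>* b v" using core v bB unfolding core_def by blast
      then show ?thesis by (rule bip_rtranclp_mono) auto
    qed
  qed
  have U: "R \<union> (B - {x}) = V - {x}" using V RB x by blast
  show ?thesis
  proof (cases "even (card (N x \<inter> R))")
    case True
    show ?thesis
      by (rule colourable_many_reds[OF xV core' U indep ev refl K2, of "{}"]) (use True in auto)
  next
    case K: False
    show ?thesis
    proof (cases "N x \<inter> B = {}")
      case False
      then obtain y where y: "y \<in> N x \<inter> B" by blast
      then have "{y} \<subseteq> N x \<inter> (B - {x})" by auto
      then show ?thesis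
        by (rule colourable_many_reds[OF xV core' U indep ev refl K2]) (use K in simp)
    next
      case True
      have NR: "N x \<subseteq> R" using True N_V[of x] V by blast
      have "card (N x \<inter> R) \<noteq> 2" using K by auto
      then have "card (N x \<inter> R - {r}) \<ge> 2" using K2 xr r by (simp add: card_Diff_singleton)
      then obtain r1 r2 where r12: "r1 \<in> N x \<inter> R - {r}" "r2 \<in> N x \<inter> R - {r}" "r1 \<noteq> r2"
        by (metis card_le_Suc0_iff_eq finite_Diff finite_Int finite_N not_less_eq_eq numeral_2_eq_2)
      show ?thesis
      proof (rule colourable_only_reds[OF xV rV xr core])
        show "R - {r} \<union> (B - {x}) = V - {x, r}" using V RB x r by blast
        show "indep (insert r (R - {r}))" using indep r by (simp add: insert_absorb)
        show "even (card (B - {x}))" by (rule ev)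
        show "N x \<subseteq> insert r (R - {r})" using NR by blast
        show "r1 \<in> N x" "r2 \<in> N x" "r1 \<in> R - {r}" "r2 \<in> R - {r}" "r1 \<noteq> r2" using r12 by blast+
      qed
    qed
  qed
qed

text \<open>For odd \<open>card B\<close>, consider a vertex of maximal level. If it is red, or if all blue vertices of that level
  have two red neighbours, a blue vertex and one of its red neighbours can be removed without disconnecting the core.
  Otherwise let \<open>X\<close> be the set of all blue vertices whose only red neighbour is a certain \<open>r\<close> of the
  previous level. Recolouring \<open>X\<close> red and \<open>r\<close> blue repairs the parity if \<open>card X\<close> is even; if it is odd,
  \<open>r\<close> and one vertex of \<open>X\<close> are exempted together.\<close>

lemma colourable_min_degree_two:
  assumes core: "core R B" and V: "R \<union> B = V" and indep: "indep R" and s: "s \<in> R"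
    and d2: "\<And>v. v \<in> V \<Longrightarrow> card (N v) \<ge> 2"
  shows colourable
proof (cases "even (card B)")
  case True
  then show ?thesis by (rule colourable_even_core[OF core indep V])
next
  case od: False
  note sets = core_sets[OF core]
  obtain l where l: "levels R B s l" using levels_exist[OF core s] by blast
  have l0: "l s = 0" "\<And>v. v \<in> V \<Longrightarrow> l v = 0 \<Longrightarrow> v = s"
    and lpar: "\<And>v. v \<in> V \<Longrightarrow> v \<noteq> s \<Longrightarrow> \<exists>u. bip R B u v \<and> l v = Suc (l u)"
    and lstep: "\<And>u v. bip R B u v \<Longrightarrow> l v \<le> Suc (l u)"
    and leven: "\<And>v. v \<in> V \<Longrightarrow> even (l v) \<longleftrightarrow> v \<in> R"
    using l unfolding levels_def V by blast+
  have nR: "w \<in> B" if "v \<in> R" "adj v w" for v w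
  proof -
    have "w \<in> V" using adj_V[OF adj_sym[OF that(2)]] .
    then show ?thesis using indep that V unfolding indep_def by blast
  qed
  have edge: "bip R B v w \<and> bip R B w v" if "v \<in> R" "adj v w" for v w
    using nR[OF that] that adj_sym[OF that(2)] by (simp add: bip_def)
  have bipV: "u \<in> V \<and> v \<in> V \<and> adj u v \<and> (u \<in> R \<longleftrightarrow> v \<in> B)" if "bip R B u v" for u v
    using that V sets(1) unfolding bip_def by blast
  have RBiff: "v \<in> R \<longleftrightarrow> v \<notin> B" if "v \<in> V" for v using that V sets(1) by blast
  have Vne: "V \<noteq> {}" using s V by blast
  define M where "M = Max (l ` V)"
  have leM: "l v \<le> M" if "v \<in> V" for v using that finV by (simp add: M_def)
  obtain m where m: "m \<in> V" "l m = M"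
  proof -
    have "M \<in> l ` V" unfolding M_def by (rule Max_in) (use finV Vne in auto)
    then show ?thesis using that by blast
  qed
  have M0: "M > 0"
  proof (rule ccontr)
    assume "\<not> M > 0"
    then have "v = s" if "v \<in> V" for v using leM[OF that] l0(2)[OF that] by simp
    moreover obtain w where "adj s w" "w \<noteq> s" using other_neighbour[OF d2[of s]] s V by blast
    ultimately show False using adj_V[OF adj_sym] by blast
  qed
  show ?thesis
  proof (cases "even M")
    case True
    then have mR: "m \<in> R" using leven[OF m(1)] m(2) by simp
    obtain x where mx: "adj m x" using other_neighbour[OF d2[OF m(1)]] by blast
    have xB: "x \<in> B" by (rule nR[OF mR mx])
    have xV: "x \<in> V" using xB V by blast
    have lx: "M = Suc (l x)"
    proof -
      have "odd (l x)" using leven[OF xV] RBiff[OF xV] xB by simp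
      moreover have "M \<le> Suc (l x)" using lstep[of x m] edge[OF mR mx] m(2) by simp
      ultimately show ?thesis using leM[OF xV] True by (metis le_Suc_eq le_antisym)
    qed
    have "x \<noteq> s" using xB s sets(1) by blast
    then obtain p where p: "bip R B p x" "l x = Suc (l p)" using lpar[OF xV] by blast
    have pR: "p \<in> R" "adj x p" using bipV[OF p(1)] xB adj_sym by blast+
    have pm: "p \<noteq> m" using p(2) lx m(2) by auto
    have "{p, m} \<subseteq> N x \<inter> R" using pR mR adj_sym[OF mx] by auto
    then have K2: "card (N x \<inter> R) \<ge> 2" using pm card_mono[of "N x \<inter> R" "{p, m}"] by simp
    \<comment> \<open>The vertices of level \<open>M\<close> are red and have degree at least two,
      so each keeps a blue neighbour other than \<open>x\<close>, at a lower level.\<close>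
    have "core (R - {m}) (B - {x})"
    proof (rule core_levels[OF core l, where n = "M - 1"])
      show "s \<in> R - {m}" using s l0(1) m(2) M0 by auto
      show "u \<in> R - {m} \<union> (B - {x})" if "u \<in> R \<union> B" "l u < M - 1" for u
        using that m(2) lx by auto
      fix v assume v: "v \<in> R - {m} \<union> (B - {x})" "l v > M - 1"
      have vV: "v \<in> V" using v V by blast
      have "l v = M" using leM[OF vV] v(2) by linarith
      then have vR: "v \<in> R" using leven[OF vV] True by simp
      obtain b where b: "adj v b" "b \<noteq> x" using other_neighbour[OF d2[OF vV]] by blast
      have bB: "b \<in> B" by (rule nR[OF vR b(1)])
      have bV: "b \<in> V" using bB V by blast
      have "odd (l b)" using leven[OF bV] RBiff[OF bV] bB by simp
      then have "l b \<noteq> M" using True by auto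
      then have "l b \<le> M - 1" using leM[OF bV] by linarith
      moreover have "bip (R - {m}) (B - {x}) b v"
        using adj_sym[OF b(1)] bB b(2) v(1) vR sets(1) by (auto simp: bip_def)
      ultimately show "\<exists>u. bip (R - {m}) (B - {x}) u v \<and> l u \<le> M - 1" by blast
    qed auto
    then show ?thesis
      by (rule colourable_removable_pair[OF xB mR adj_sym[OF mx] _ V sets(1) indep od d2[OF m(1)] K2])
  next
    case oM: False
    have top: "v \<in> B" if "v \<in> V" "l v = M" for v using leven[OF that(1)] that oM RBiff[OF that(1)] by simp
    have redlow: "l r \<le> M - 1" if "r \<in> R" for r
    proof -
      have rV: "r \<in> V" using that V by blast
      have "l r \<noteq> M" using leven[OF rV] that oM by auto
      then show ?thesis using leM[OF rV] by linarith
    qed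
    have topred: "l r = M - 1" if "adj v r" "r \<in> R" "l v = M" for v r
    proof -
      have "bip R B r v" using edge[OF that(2) adj_sym[OF that(1)]] by blast
      then have "M \<le> Suc (l r)" using lstep[of r v] that(3) by simp
      then show ?thesis using redlow[OF that(2)] by linarith
    qed
    have parent: "\<exists>r. r \<in> R \<and> adj v r \<and> l v = Suc (l r)" if vB: "v \<in> B" for v
    proof -
      have "v \<in> V" "v \<noteq> s" using vB V s sets(1) by blast+
      then obtain r where "bip R B r v" "l v = Suc (l r)" using lpar by blast
      then show ?thesis using bipV[of r v] vB adj_sym by blast
    qed
    show ?thesis
    proof (cases "\<exists>x r. x \<in> V \<and> l x = M \<and> N x \<inter> R = {r}")
      case False
      have mB: "m \<in> B" by (rule top[OF m])
      obtain r where r: "r \<in> R" "adj m r" "l m = Suc (l r)" using parent[OF mB] by blast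
      have "N m \<inter> R \<noteq> {r}" using False m by blast
      moreover have "r \<in> N m \<inter> R" using r by simp
      ultimately obtain r' where "r' \<in> N m \<inter> R" "r' \<noteq> r" by blast
      then have r': "r' \<in> R" "adj m r'" "r' \<noteq> r" by simp_all
      have "{r, r'} \<subseteq> N m \<inter> R" using r r' by auto
      then have K2: "card (N m \<inter> R) \<ge> 2" using r' card_mono[of "N m \<inter> R" "{r, r'}"] by simp
      have lr: "l r = M - 1" using r(3) m(2) by simp
      have rV: "r \<in> V" using r V by blast
      \<comment> \<open>No vertex of level \<open>M\<close> depends on \<open>r\<close> alone, so
        each keeps a red neighbour. And \<open>r\<close> is not the root, since otherwise
        \<open>r\<close> and \<open>r'\<close> would both be at level 0.\<close>
      have "core (R - {r}) (B - {m})"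
      proof (rule core_levels[OF core l, where n = "M - 1"])
        have "r \<noteq> s"
        proof
          assume "r = s"
          then have "l r' = 0" using topred[OF r'(2,1) m(2)] lr l0(1) by simp
          then have "r' = s" using l0(2) r'(1) V by blast
          then show False using r'(3) \<open>r = s\<close> by simp
        qed
        then show "s \<in> R - {r}" using s by blast
        show "u \<in> R - {r} \<union> (B - {m})" if "u \<in> R \<union> B" "l u < M - 1" for u
          using that m(2) lr by auto
        fix v assume v: "v \<in> R - {r} \<union> (B - {m})" "l v > M - 1"
        have vV: "v \<in> V" using v V by blast
        have lv: "l v = M" using leM[OF vV] v(2) by linarith
        have vB: "v \<in> B" by (rule top[OF vV lv])
        obtain p where "p \<in> R" "adj v p" using parent[OF vB] by blast
        then have "N v \<inter> R \<noteq> {}" by auto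
        moreover have "N v \<inter> R \<noteq> {r}" using False vV lv by blast
        ultimately obtain q where "q \<in> N v \<inter> R" "q \<noteq> r" by blast
        then have q: "q \<in> R" "adj v q" "q \<noteq> r" by simp_all
        have "bip (R - {r}) (B - {m}) q v"
          using adj_sym[OF q(2)] q vB v(1) sets(1) by (auto simp: bip_def)
        then show "\<exists>u. bip (R - {r}) (B - {m}) u v \<and> l u \<le> M - 1" using redlow[OF q(1)] by blast
      qed auto
      then show ?thesis
        by (rule colourable_removable_pair[OF mB r(1,2) _ V sets(1) indep od d2[OF rV] K2])
    next
      case True
      then obtain x r where x: "x \<in> V" "l x = M" "N x \<inter> R = {r}" by blast
      have rR: "r \<in> R" and xr: "adj x r" using x(3) by auto
      have rV: "r \<in> V" using rR V by blast
      have lr: "l r = M - 1" by (rule topred[OF xr rR x(2)])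
      \<comment> \<open>The blue vertices that lose all their red neighbours when \<open>r\<close>
        is removed.\<close>
      define X where "X = {b\<in>B. N b \<inter> R = {r}}"
      have xX: "x \<in> X" using top[OF x(1,2)] x(3) by (simp add: X_def)
      have XB: "X \<subseteq> B" by (auto simp: X_def)
      have adjXr: "adj b r" if "b \<in> X" for b using that by (auto simp: X_def)
      have lX: "l b = M" if bX: "b \<in> X" for b
      proof -
        obtain p where p: "p \<in> R" "adj b p" "l b = Suc (l p)" using parent bX XB by blast
        have "N b \<inter> R = {r}" using bX unfolding X_def by blast
        moreover have "p \<in> N b \<inter> R" using p by simp
        ultimately have "p = r" by blast
        then show ?thesis using p(3) lr M0 by simp
      qed
      show ?thesis
      proof (cases "\<exists>b\<in>X. \<exists>y. adj b y \<and> adj y r")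
        case True
        then obtain b y where bt: "b \<in> X" "adj b y" "adj y r" by blast
        have yB: "y \<in> B" by (rule nR[OF rR adj_sym[OF bt(3)]])
        have yb: "y \<noteq> b" using bt(2) by auto
        have bB: "b \<in> B" using bt XB by blast
        have bV: "b \<in> V" using bB V by blast
        have "core R (B - {b})"
        proof (rule core_levels[OF core l, where n = "M - 1"])
          show "u \<in> R \<union> (B - {b})" if "u \<in> R \<union> B" "l u < M - 1" for u
            using that lX[OF bt(1)] by auto
          fix v assume v: "v \<in> R \<union> (B - {b})" "l v > M - 1"
          have vV: "v \<in> V" using v V by blast
          have lv: "l v = M" using leM[OF vV] v(2) by linarith
          have vB: "v \<in> B" by (rule top[OF vV lv])
          obtain p where p: "p \<in> R" "adj v p" using parent[OF vB] by blast
          have "bip R (B - {b}) p v" using adj_sym[OF p(2)] p vB v(1) sets(1) by (auto simp: bip_def)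
          then show "\<exists>u. bip R (B - {b}) u v \<and> l u \<le> M - 1" using redlow[OF p(1)] by blast
        qed (use s in auto)
        moreover have "R \<union> (B - {b}) = V - {b}" using V bB sets(1) by blast
        moreover have "even (card (B - {b}))" using od bB sets(5) by (simp add: card_Diff_singleton)
        moreover have "N b \<inter> R = {r}" using bt(1) by (simp add: X_def)
        moreover have "y \<in> B - {b}" using yB yb by blast
        ultimately show ?thesis using colourable_triangle[OF bV _ _ indep] bt(2,3) by blast
      next
        case notri: False
        define C where "C = B - X"
        have NX: "N b \<subseteq> insert r C" if b: "b \<in> X" for b
        proof
          fix w assume w: "w \<in> N b"
          then have wV: "w \<in> V" using N_V by blast
          show "w \<in> insert r C"
          proof (cases "w \<in> R")
            case True
            then have "w \<in> N b \<inter> R" using w by blast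
            moreover have "N b \<inter> R = {r}" using b unfolding X_def by blast
            ultimately show ?thesis by blast
          next
            case False
            then have "w \<in> B" using wV V by blast
            moreover have "w \<notin> X" using notri b w adjXr by auto
            ultimately show ?thesis by (simp add: C_def)
          qed
        qed
        have NXC: "\<exists>c\<in>C. adj b c" if b: "b \<in> X" for b
        proof -
          have "b \<in> V" using b XB V by blast
          then obtain w where w: "adj b w" "w \<noteq> r" using other_neighbour[OF d2] by blast
          then have "w \<in> C" using NX[OF b] by auto
          then show ?thesis using w by blast
        qed
        \<comment> \<open>Otherwise \<open>M = 1\<close> and \<open>s\<close> is the only red
          vertex, so a neighbour of \<open>x\<close> in \<open>C\<close> would form a triangle with
          \<open>x\<close> and \<open>r\<close>.\<close>
        have rs: "r \<noteq> s"
        proof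
          assume "r = s"
          then have M1: "M = 1" using lr l0(1) M0 by simp
          obtain c where c: "c \<in> C" "adj x c" using NXC[OF xX] by blast
          then have "c \<in> B" by (simp add: C_def)
          then obtain p where p: "p \<in> R" "adj c p" using parent by blast
          have "p \<in> V" using p V by blast
          then have "p = s" using redlow[OF p(1)] M1 l0(2) by simp
          then have "adj c r" using p \<open>r = s\<close> by simp
          then show False using notri xX c(2) by blast
        qed
        have core': "core (R - {r}) C"
        proof (rule core_levels[OF core l, where n = "M - 1"])
          show "R - {r} \<subseteq> R" "C \<subseteq> B" by (auto simp: C_def)
          show "s \<in> R - {r}" using s rs by blast
          show "u \<in> R - {r} \<union> C" if "u \<in> R \<union> B" "l u < M - 1" for u
          proof -
            have "u \<noteq> r" using that lr by auto
            moreover have "u \<notin> X" using lX[of u] that by auto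
            ultimately show ?thesis using that by (auto simp: C_def)
          qed
          fix v assume v: "v \<in> R - {r} \<union> C" "l v > M - 1"
          have vV: "v \<in> V" using v V by (auto simp: C_def)
          have lv: "l v = M" using leM[OF vV] v(2) by linarith
          have vB: "v \<in> B" by (rule top[OF vV lv])
          then have vC: "v \<in> C" using v(1) sets(1) by blast
          then have "N v \<inter> R \<noteq> {r}" by (simp add: C_def X_def)
          moreover obtain p where "p \<in> R" "adj v p" using parent[OF vB] by blast
          then have "N v \<inter> R \<noteq> {}" by auto
          ultimately obtain q where "q \<in> N v \<inter> R" "q \<noteq> r" by blast
        then have q: "q \<in> R" "adj v q" "q \<noteq> r" by simp_all
          have "bip (R - {r}) C q v" using adj_sym[OF q(2)] q vC by (simp add: bip_def)
          then show "\<exists>u. bip (R - {r}) C u v \<and> l u \<le> M - 1" using redlow[OF q(1)] by blast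
        qed
        have finX: "finite X" using XB sets(5) finite_subset by blast
        have cardC: "card C + card X = card B"
          unfolding C_def using XB sets(5) finX by (simp add: card_Diff_subset card_mono)
        have rRB: "r \<notin> B" using rR sets(1) by blast
        show ?thesis
        proof (cases "even (card X)")
          case True
          \<comment> \<open>Each vertex of \<open>X\<close> is attached through its second
            neighbour, which lies in \<open>C\<close>, and \<open>r\<close> is attached through
            \<open>x\<close>.\<close>
          have "core (R - {r} \<union> X) (insert r C)"
          proof (rule coreI[where s = s])
            show "(R - {r} \<union> X) \<inter> insert r C = {}" using sets(1) XB rRB by (auto simp: C_def)
            show "(R - {r} \<union> X) \<union> insert r C \<subseteq> V" using V XB rR by (auto simp: C_def)
            let ?r = "bip (R - {r} \<union> X) (insert r C)"
            have old: "?r\<^sup>*\<^sup>* s v" if "v \<in> R - {r} \<union> C" for v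
            proof (rule bip_rtranclp_mono)
              show "(bip (R - {r}) C)\<^sup>*\<^sup>* s v" using core' that s rs unfolding core_def by blast
            qed auto
            have X: "?r\<^sup>*\<^sup>* s b" if b: "b \<in> X" for b
            proof -
              obtain c where c: "c \<in> C" "adj b c" using NXC[OF b] by blast
              have "?r c b" using c adj_sym[OF c(2)] b by (simp add: bip_def)
              moreover have "?r\<^sup>*\<^sup>* s c" using old c by blast
              ultimately show ?thesis by (rule rtranclp.rtrancl_into_rtrancl[rotated])
            qed
            have "?r x r" using xr xX by (simp add: bip_def)
            with X[OF xX] have "?r\<^sup>*\<^sup>* s r" by (rule rtranclp.rtrancl_into_rtrancl)
            then show "?r\<^sup>*\<^sup>* s v" if "v \<in> (R - {r} \<union> X) \<union> insert r C" for v
              using that old X by blast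
          qed
          moreover have "indep (R - {r} \<union> X)"
            unfolding indep_def
          proof (intro ballI notI)
            fix u v assume uv: "u \<in> R - {r} \<union> X" "v \<in> R - {r} \<union> X" "adj u v"
            have noX: "\<not> adj b w" if "b \<in> X" "w \<in> R - {r} \<union> X" for b w
              using NX[OF that(1)] that(2) sets(1) rRB XB by (auto simp: C_def)
            show False
            proof (cases "u \<in> X \<or> v \<in> X")
              case True
              then show False using noX uv adj_sym[OF uv(3)] by blast
            next
              case False
              then show False using uv indep unfolding indep_def by blast
            qed
          qed
          moreover have "(R - {r} \<union> X) \<union> insert r C = V" using V XB rR by (auto simp: C_def)
          moreover have "even (card (insert r C))"
          proof -
            have "r \<notin> C" "finite C" using rRB sets(5) by (auto simp: C_def)
            moreover have "odd (card C)" using cardC True od by (metis even_add)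
            ultimately show ?thesis by simp
          qed
          ultimately show ?thesis by (rule colourable_even_core)
        next
          case oX: False
          \<comment> \<open>\<open>x\<close> and \<open>r\<close> are exempted; the rest of
            \<open>X\<close> stays blue outside the core and gets its signs from
            \<open>r\<close>.\<close>
          define W where "W = X - {x}"
          have evW: "even (card W)" unfolding W_def using oX xX finX by (simp add: card_Diff_singleton)
          have evC: "even (card C)" using cardC oX od by (metis even_add)
          have xB: "x \<in> B" using xX XB by blast
          have xR: "x \<notin> R" using xB sets(1) by blast
          have Veq: "R - {r} \<union> C \<union> W = V - {x, r}"
            using V XB xX rRB xR by (auto simp: C_def W_def)
          have Wd: "W \<inter> (R - {r} \<union> C) = {}" using XB sets(1) by (auto simp: C_def W_def)
          have ind: "indep (R - {r})" using indep by (auto simp: indep_def)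
          have Nr: "N r \<subseteq> insert x (C \<union> W)"
            using nR[OF rR] by (auto simp: C_def W_def)
          have Wr: "W \<subseteq> N r" using adjXr adj_sym by (auto simp: W_def)
          have disj: "N x \<inter> N r = {}"
          proof -
            have "\<not> (adj x w \<and> adj r w)" for w using notri xX adj_sym[of r w] by blast
            then show ?thesis by auto
          qed
          have ex1: "N x \<inter> C \<noteq> {}" using NXC[OF xX] by auto
          have ex2: "N r \<inter> C \<noteq> {}"
          proof -
            obtain p where p: "bip R B p r" "l r = Suc (l p)" using lpar[OF rV rs] by blast
            have "adj p r" using bipV[OF p(1)] by blast
            have pB: "p \<in> B" by (rule nR[OF rR adj_sym[OF \<open>adj p r\<close>]])
            have "l p \<noteq> M" using p(2) lr by simp
            then have "p \<notin> X" using lX by blast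
            then have "p \<in> N r \<inter> C" using pB adj_sym[OF \<open>adj p r\<close>] by (simp add: C_def)
            then show ?thesis by blast
          qed
          have "colourable \<or> card (N x) = 2 \<and> card (N r) = 2"
            by (rule colourable_adjacent_pair_or_degree_two[OF x(1) rV xr core' Veq Wd ind evC evW
                  NX[OF xX] Nr Wr disj ex1 ex2])
          then show ?thesis
          proof
            assume two: "card (N x) = 2 \<and> card (N r) = 2"
            obtain u where u: "u \<in> N x \<inter> C" using ex1 by blast
            obtain v where v: "v \<in> N r \<inter> C" using ex2 by blast
            have ur: "u \<noteq> r" and vx: "v \<noteq> x" using u v rRB xX by (auto simp: C_def)
            have Nx: "N x = {r, u}"
              by (rule card_subset_eq[symmetric]) (use two u ur xr in auto)
            have Nr: "N r = {x, v}"
              by (rule card_subset_eq[symmetric]) (use two v vx adj_sym[OF xr] in auto)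
            have uv: "u \<noteq> v" using disj u v by blast
            have "W = {}"
            proof -
              have "W \<subseteq> {x, v}" using Wr Nr by blast
              moreover have "x \<notin> W" "v \<notin> W" using v by (auto simp: W_def C_def)
              ultimately show ?thesis by blast
            qed
            then have U: "R - {r} \<union> C = V - {x, r}" using Veq by simp
            \<comment> \<open>\<open>u\<close> is blue so far but must be red in
              \<open>colourable_two_path\<close>; the connected remainder is therefore split afresh
              with \<open>u\<close> as root.\<close>
            let ?a = "\<lambda>a b. adj a b \<and> a \<in> V - {x, r} \<and> b \<in> V - {x, r}"
            have conn: "?a\<^sup>*\<^sup>* u w" if "w \<in> V - {x, r}" for w
            proof (rule rtranclp_mono[THEN predicate2D])
              have "u \<in> R - {r} \<union> C" "w \<in> R - {r} \<union> C" using u that U by blast+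
              then show "(bip (R - {r}) C)\<^sup>*\<^sup>* u w" using core' unfolding core_def by simp
              show "bip (R - {r}) C \<le> ?a"
              proof (intro predicate2I)
                fix a b assume "bip (R - {r}) C a b"
                then have "adj a b \<and> a \<in> R - {r} \<union> C \<and> b \<in> R - {r} \<union> C" unfolding bip_def by blast
                then show "?a a b" unfolding U .
              qed
            qed
            have "u \<in> V - {x, r}" using u U by blast
            from core_exists[OF _ this conn]
            obtain R2 B2 where "R2 \<union> B2 = V - {x, r}" "u \<in> R2" "core R2 B2" "indep R2" by blast
            then show ?thesis
              using colourable_two_path[OF x(1) rV Nx Nr ur[symmetric] vx[symmetric] uv] by blast
          qed
        qed
      qed
    qed
  qed
qed

theorem colourable_connected:
  assumes conn: "\<And>u v. u \<in> V \<Longrightarrow> v \<in> V \<Longrightarrow> adj\<^sup>*\<^sup>* u v" and V3: "card V \<ge> 3"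
  shows colourable
proof -
  have closed: "V \<subseteq> S" if S: "S \<inter> V \<noteq> {}" "\<And>u v. u \<in> S \<Longrightarrow> adj u v \<Longrightarrow> v \<in> S" for S
  proof
    fix v assume v: "v \<in> V"
    obtain u where u: "u \<in> S" "u \<in> V" using S(1) by blast
    have "adj\<^sup>*\<^sup>* u v" by (rule conn[OF u(2) v])
    then show "v \<in> S" by (induction rule: rtranclp_induct) (use u(1) S(2) in auto)
  qed
  have big: "\<not> V \<subseteq> S" if "card S \<le> 2" "finite S" for S
    using card_mono[OF that(2), of V] that(1) V3 by linarith
  have N1: "N v \<noteq> {}" if "v \<in> V" for v
  proof
    assume "N v = {}"
    then have "\<not> adj v w" for w by (metis empty_iff in_N)
    then have "V \<subseteq> {v}" using closed[of "{v}"] that by blast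
    then show False using big[of "{v}"] by simp
  qed
  show ?thesis
  proof (cases "\<exists>x\<in>V. card (N x) = 1")
    case True
    then obtain x v where x: "x \<in> V" "N x = {v}" by (metis card_1_singletonE)
    have adjx: "adj x w \<longleftrightarrow> w = v" for w
    proof -
      have "w \<in> N x \<longleftrightarrow> w = v" unfolding x(2) by simp
      then show ?thesis by simp
    qed
    have vx: "v \<noteq> x" using adjx[of x] by auto
    have xv: "adj v x" using adjx[of v] adj_sym by blast
    have vV: "v \<in> V" by (rule adj_V[OF xv])
    have "\<exists>w. adj v w \<and> w \<noteq> x"
    proof (rule ccontr)
      assume no: "\<not> ?thesis"
      have "b \<in> {x, v}" if "a \<in> {x, v}" "adj a b" for a b using that no adjx by blast
      then have "V \<subseteq> {x, v}" using closed[of "{x, v}"] x(1) by blast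
      moreover have "card {x, v} \<le> 2" using card_insert_le_m1[of 2 "{v}" x] by simp
      ultimately show False using big[of "{x, v}"] by simp
    qed
    then obtain w where "adj v w" "w \<noteq> x" by blast
    then have "{x, w} \<subseteq> N v" "card {x, w} = 2" using xv by auto
    then have dv: "card (N v) \<ge> 2" using card_mono[OF finite_N] by metis
    let ?a = "\<lambda>a b. adj a b \<and> a \<in> V - {x} \<and> b \<in> V - {x}"
    \<comment> \<open>A walk enters and leaves the leaf \<open>x\<close> only through
      \<open>v\<close>, so replacing \<open>x\<close> by \<open>v\<close> keeps it inside
      \<open>V - {x}\<close>.\<close>
    have reach: "?a\<^sup>*\<^sup>* v (if w = x then v else w)" if "adj\<^sup>*\<^sup>* v w" for w
      using that
    proof (induction rule: rtranclp_induct)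
      case base
      then show ?case by simp
    next
      case (step y z)
      have zy: "adj z y" by (rule adj_sym[OF step(2)])
      show ?case
      proof (cases "z = x")
        case True
        then show ?thesis by simp
      next
        case zx: False
        show ?thesis
        proof (cases "y = x")
          case True
          then have "z = v" using step(2) adjx by simp
          then show ?thesis by simp
        next
          case False
          then have "?a y z" using step(2) zx adj_V[OF step(2)] adj_V[OF zy] by blast
          moreover have "?a\<^sup>*\<^sup>* v y" using step.IH False by simp
          ultimately show ?thesis using zx by (simp add: rtranclp.rtrancl_into_rtrancl)
        qed
      qed
    qed
    have c: "?a\<^sup>*\<^sup>* v w" if "w \<in> V - {x}" for w
      using reach[OF conn[OF vV, of w]] that by simp
    have "v \<in> V - {x}" using vV vx by blast
    from core_exists[OF _ this c]
    obtain R B where "R \<union> B = V - {x}" "v \<in> R" "core R B" "indep R" by blast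
    then show ?thesis using colourable_leaf[OF x dv] by blast
  next
    case False
    have d2: "card (N v) \<ge> 2" if "v \<in> V" for v
    proof -
      have "card (N v) \<noteq> 0" using N1[OF that] by simp
      moreover have "card (N v) \<noteq> 1" using False that by blast
      ultimately show ?thesis by linarith
    qed
    have "V \<noteq> {}" using V3 by auto
    then obtain s where s: "s \<in> V" by blast
    have c: "(\<lambda>a b. adj a b \<and> a \<in> V \<and> b \<in> V)\<^sup>*\<^sup>* s v" if "v \<in> V" for v
    proof -
      have "adj a b \<longleftrightarrow> adj a b \<and> a \<in> V \<and> b \<in> V" for a b using adj_V adj_sym by blast
      then have "(\<lambda>a b. adj a b \<and> a \<in> V \<and> b \<in> V) = adj" by (intro ext) blast
      then show ?thesis using conn[OF s that] by simp
    qed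
    from core_exists[OF order_refl s c]
    obtain R B where "R \<union> B = V" "s \<in> R" "core R B" "indep R" by blast
    then show ?thesis using colourable_min_degree_two d2 by blast
  qed
qed

end

section \<open>Components and compactness\<close>

context fin_graph
begin

definition component :: "'a \<Rightarrow> 'a set" where "component u = {w. adj\<^sup>*\<^sup>* u w}"

lemma component_V:
  assumes "u \<in> V"
  shows "component u \<subseteq> V"
proof
  fix w assume "w \<in> component u"
  then have "adj\<^sup>*\<^sup>* u w" by (simp add: component_def)
  then show "w \<in> V" by (cases rule: rtranclp.cases) (use assms adj_V adj_sym in auto)
qed

lemma component_eq:
  assumes "adj u v"
  shows "component u = component v"
proof -
  have "component b \<subseteq> component a" if "adj a b" for a b
    using that by (auto simp: component_def intro: converse_rtranclp_into_rtranclp)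
  then show ?thesis using assms adj_sym by blast
qed

lemma component_weighting:
  assumes u: "u \<in> V" and c3: "card (component u) \<ge> 3"
  shows "\<exists>\<omega> :: 'a set \<Rightarrow> int. \<forall>a\<in>component u. \<forall>b. adj a b \<longrightarrow>
    \<omega> {a, b} \<in> {1, 2, 3} \<and> (\<Sum>w\<in>N a. \<omega> {a, w}) \<noteq> (\<Sum>w\<in>N b. \<omega> {b, w})"
proof -
  define adj' where "adj' a b \<longleftrightarrow> adj a b \<and> a \<in> component u" for a b
  have closed: "b \<in> component u" if "a \<in> component u" "adj a b" for a b
    using that by (auto simp: component_def)
  interpret C: fin_graph "component u" adj'
  proof
    show "finite (component u)" using component_V[OF u] finV finite_subset by blast
    show "adj' b a" if "adj' a b" for a b
      using that closed adj_sym unfolding adj'_def by blast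
  qed (auto simp: adj'_def)
  have reach: "adj'\<^sup>*\<^sup>* u w" if "adj\<^sup>*\<^sup>* u w" for w
    using that
  proof (induction rule: rtranclp_induct)
    case (step y z)
    then have "adj' y z" by (simp add: adj'_def component_def)
    with step.IH show ?case by (rule rtranclp.rtrancl_into_rtrancl)
  qed simp
  have "C.colourable"
  proof (rule C.colourable_connected[OF _ c3])
    fix a b assume "a \<in> component u" "b \<in> component u"
    then have "adj'\<^sup>*\<^sup>* u a" "adj'\<^sup>*\<^sup>* u b" using reach by (auto simp: component_def)
    moreover have "adj'\<^sup>*\<^sup>* a u"
      by (rule rtranclp_sym[OF C.adj_sym \<open>adj'\<^sup>*\<^sup>* u a\<close>])
    ultimately show "adj'\<^sup>*\<^sup>* a b" by simp
  qed
  then obtain \<omega> :: "'a set \<Rightarrow> int" where \<omega>: "\<And>a b. adj' a b \<Longrightarrow> \<omega> {a, b} \<in> {1, 2, 3}"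
    "\<And>a b. adj' a b \<Longrightarrow> (\<Sum>w\<in>C.N a. \<omega> {a, w}) \<noteq> (\<Sum>w\<in>C.N b. \<omega> {b, w})"
    unfolding C.colourable_def by blast
  have N: "C.N a = N a" if "a \<in> component u" for a
    using that by (auto simp: adj'_def)
  show ?thesis
  proof (intro exI[of _ \<omega>] ballI allI impI conjI)
    fix a b assume a: "a \<in> component u" "adj a b"
    then have "adj' a b" by (simp add: adj'_def)
    then show "\<omega> {a, b} \<in> {1, 2, 3}" "(\<Sum>w\<in>N a. \<omega> {a, w}) \<noteq> (\<Sum>w\<in>N b. \<omega> {b, w})"
      using \<omega>(1)[of a b] \<omega>(2)[of a b] N[OF a(1)] N[OF closed[OF a]] by auto
  qed
qed

lemma weighting_exists:
  "\<exists>\<omega> :: 'a set \<Rightarrow> int. \<forall>a b. adj a b \<longrightarrow> card (component a) \<ge> 3 \<longrightarrow>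
    \<omega> {a, b} \<in> {1, 2, 3} \<and> (\<Sum>w\<in>N a. \<omega> {a, w}) \<noteq> (\<Sum>w\<in>N b. \<omega> {b, w})"
proof -
  define P where "P C \<omega> \<longleftrightarrow> (\<forall>a\<in>C. \<forall>b. adj a b \<longrightarrow>
    \<omega> {a, b} \<in> {1, 2, 3} \<and> (\<Sum>w\<in>N a. \<omega> {a, w}) \<noteq> (\<Sum>w\<in>N b. \<omega> {b, w}))"
    for C and \<omega> :: "'a set \<Rightarrow> int"
  define \<Omega> where "\<Omega> C = (SOME \<omega>. P C \<omega>)" for C
  have \<Omega>: "P (component a) (\<Omega> (component a))" if "a \<in> V" "card (component a) \<ge> 3" for a
  proof -
    have "\<exists>\<omega>. P (component a) \<omega>" using component_weighting[OF that] unfolding P_def .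
    then show ?thesis unfolding \<Omega>_def by (rule someI_ex)
  qed
  \<comment> \<open>Both ends of an edge lie in the same component, so it does not matter which of
    them is chosen.\<close>
  define \<omega> where "\<omega> e = \<Omega> (component (SOME x. x \<in> e)) e" for e
  have edge: "\<omega> {a, b} = \<Omega> (component a) {a, b}" if "adj a b" for a b
  proof -
    define x where "x = (SOME x. x \<in> {a, b})"
    have "x \<in> {a, b}" unfolding x_def by (rule someI[of _ a]) simp
    then have "component x = component a" using component_eq[OF that] by (elim insertE) simp_all
    then show ?thesis unfolding \<omega>_def x_def[symmetric] by simp
  qed
  have sums: "(\<Sum>w\<in>N a. \<omega> {a, w}) = (\<Sum>w\<in>N a. \<Omega> (component a) {a, w})" for a
    by (rule sum.cong) (simp_all add: edge)
  show ?thesis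
  proof (intro exI[of _ \<omega>] allI impI)
    fix a b assume ab: "adj a b" "card (component a) \<ge> 3"
    have "a \<in> component a" by (simp add: component_def)
    then have "\<Omega> (component a) {a, b} \<in> {1, 2, 3} \<and>
        (\<Sum>w\<in>N a. \<Omega> (component a) {a, w}) \<noteq> (\<Sum>w\<in>N b. \<Omega> (component a) {b, w})"
      using \<Omega>[OF adj_V[OF ab(1)] ab(2)] ab(1) unfolding P_def by blast
    then show "\<omega> {a, b} \<in> {1, 2, 3} \<and> (\<Sum>w\<in>N a. \<omega> {a, w}) \<noteq> (\<Sum>w\<in>N b. \<omega> {b, w})"
      unfolding sums edge[OF ab(1)] component_eq[OF ab(1)] .
  qed
qed

end

text \<open>A constraint on finitely many coordinates has a finite union of cylinders as its
  solution set, which is closed in the compact product of discrete finite spaces; the finite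
  intersection property does the rest.\<close>

lemma finite_choice_compactness:
  fixes P :: "'c \<Rightarrow> ('e \<Rightarrow> 'v) \<Rightarrow> bool"
  assumes F: "finite F"
    and d: "\<And>c. c \<in> I \<Longrightarrow> finite (d c) \<and> d c \<subseteq> E"
    and dep: "\<And>c f g. c \<in> I \<Longrightarrow> (\<And>e. e \<in> d c \<Longrightarrow> f e = g e) \<Longrightarrow> P c f \<Longrightarrow> P c g"
    and fin: "\<And>J. finite J \<Longrightarrow> J \<subseteq> I \<Longrightarrow> \<exists>f. (\<forall>e\<in>E. f e \<in> F) \<and> (\<forall>c\<in>J. P c f)"
  shows "\<exists>f. (\<forall>e\<in>E. f e \<in> F) \<and> (\<forall>c\<in>I. P c f)"
proof -
  define X where "X = product_topology (\<lambda>_::'e. discrete_topology F) E"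
  have top: "topspace X = (\<Pi>\<^sub>E e\<in>E. F)" by (simp add: X_def)
  have comp: "compact_space X"
    unfolding X_def compact_space_product_topology using F by (simp add: compact_space_discrete_topology)
  define K where "K c = {f \<in> topspace X. P c f}" for c
  have closed: "closedin X (K c)" if c: "c \<in> I" for c
  proof -
    have coord: "closedin X {f \<in> topspace X. f e = a}" if "e \<in> E" for e a
    proof -
      have "continuous_map X (discrete_topology F) (\<lambda>f. f e)"
        unfolding X_def by (rule continuous_map_product_projection[OF that])
      moreover have "closedin (discrete_topology F) ({a} \<inter> F)" by simp
      ultimately have "closedin X {f \<in> topspace X. f e \<in> {a} \<inter> F}"
        by (rule closedin_continuous_map_preimage)
      moreover have "{f \<in> topspace X. f e \<in> {a} \<inter> F} = {f \<in> topspace X. f e = a}"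
        using that by (auto simp: top)
      ultimately show ?thesis by simp
    qed
    define Q where "Q p = {f \<in> topspace X. \<forall>e\<in>d c. f e = p e}" for p
    have Q: "closedin X (Q p)" for p
    proof -
      have "Q p = \<Inter>(insert (topspace X) ((\<lambda>e. {f \<in> topspace X. f e = p e}) ` d c))"
        by (auto simp: Q_def)
      moreover have "closedin X \<dots>"
        by (rule closedin_Inter) (use coord d[OF c] in auto)
      ultimately show ?thesis by simp
    qed
    let ?R = "(\<lambda>f. restrict f (d c)) ` K c"
    have "?R \<subseteq> (\<Pi>\<^sub>E e\<in>d c. F)" using d[OF c] by (auto simp: K_def top)
    moreover have "finite (\<Pi>\<^sub>E e\<in>d c. F)" by (rule finite_PiE) (use d[OF c] F in auto)
    ultimately have "finite ?R" by (rule finite_subset)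
    have "K c = \<Union>(Q ` ?R)"
    proof
      show "K c \<subseteq> \<Union>(Q ` ?R)" by (auto simp: Q_def K_def)
      show "\<Union>(Q ` ?R) \<subseteq> K c"
      proof
        fix g assume "g \<in> \<Union>(Q ` ?R)"
        then obtain f where f: "f \<in> K c" "g \<in> Q (restrict f (d c))" by blast
        then have "g e = f e" if "e \<in> d c" for e using that by (simp add: Q_def)
        then have "P c g" using dep[OF c, of f g] f(1) by (simp add: K_def)
        then show "g \<in> K c" using f(2) by (simp add: K_def Q_def)
      qed
    qed
    then show ?thesis
      using closedin_Union[of "Q ` ?R" X] \<open>finite ?R\<close> Q by auto
  qed
  have fip: "\<Inter>\<F> \<noteq> {}" if \<F>: "finite \<F>" "\<F> \<subseteq> insert (topspace X) (K ` I)" for \<F>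
  proof -
    have "finite (\<F> - {topspace X})" "\<F> - {topspace X} \<subseteq> K ` I" using \<F> by auto
    then obtain J where J: "J \<subseteq> I" "finite J" "\<F> - {topspace X} = K ` J"
      by (meson finite_subset_image)
    obtain f where f: "\<forall>e\<in>E. f e \<in> F" "\<forall>c\<in>J. P c f" using fin[OF J(2,1)] by blast
    have "restrict f E \<in> topspace X" using f(1) by (simp add: top)
    moreover have "P c (restrict f E)" if "c \<in> J" for c
    proof (rule dep)
      show "c \<in> I" "P c f" using that J f by blast+
      show "f e = restrict f E e" if "e \<in> d c" for e using d[OF \<open>c \<in> I\<close>] that by auto
    qed
    ultimately have "restrict f E \<in> K c" if "c \<in> J" for c
      unfolding K_def using that by blast
    then have "restrict f E \<in> A" if "A \<in> \<F> - {topspace X}" for A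
      using that unfolding J(3) by blast
    then have "restrict f E \<in> \<Inter>\<F>"
      using \<open>restrict f E \<in> topspace X\<close> by blast
    then show ?thesis by blast
  qed
  \<comment> \<open>Adding the whole space guarantees values in \<open>F\<close> even if
    \<open>I\<close> is empty.\<close>
  have "\<Inter>(insert (topspace X) (K ` I)) \<noteq> {}"
    using comp[unfolded compact_space_fip, rule_format, of "insert (topspace X) (K ` I)"] closed fip by auto
  then obtain f where "f \<in> topspace X" "\<forall>c\<in>I. P c f" by (auto simp: K_def)
  then show ?thesis by (intro exI[of _ f]) (auto simp: top)
qed

text \<open>Retain the edges that meet the set \<open>S\<close> of all ends of pairs in
  \<open>J\<close>. This finite graph contains the full neighbourhood of each vertex of
  \<open>S\<close>, so weighted degrees there are the original ones, and an edge given by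
  \<open>J\<close>, not being isolated, lies in a component with at least three vertices.\<close>

lemma finite_constraints_weighting:
  fixes V :: "'a set" and E :: "'a set set"
  assumes simple: "simple_graph V E" and noiso: "\<not> has_isolated_edge E"
    and J: "finite J" "\<And>u v. (u, v) \<in> J \<Longrightarrow> {u, v} \<in> E \<and> finite (nbhd E u) \<and> finite (nbhd E v)"
  shows "\<exists>\<omega> :: 'a set \<Rightarrow> nat. (\<forall>e\<in>E. \<omega> e \<in> {1, 2, 3}) \<and> (\<forall>(u, v)\<in>J. wsum E \<omega> u \<noteq> wsum E \<omega> v)"
proof -
  define S where "S = fst ` J \<union> snd ` J"
  define adj where "adj a b \<longleftrightarrow> {a, b} \<in> E \<and> (a \<in> S \<or> b \<in> S)" for a b
  have finS: "finite S" using J(1) by (simp add: S_def)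
  have finN: "finite (nbhd E s)" if "s \<in> S" for s using that J(2) by (force simp: S_def)
  have ne: "a \<noteq> b" if "{a, b} \<in> E" for a b
  proof
    assume "a = b"
    then have "card {a} = 2" using simple that unfolding simple_graph_def by fastforce
    then show False by simp
  qed
  interpret G: fin_graph "S \<union> (\<Union>s\<in>S. nbhd E s)" adj
  proof
    show "finite (S \<union> (\<Union>s\<in>S. nbhd E s))" using finS finN by blast
    show "adj b a" if "adj a b" for a b using that by (auto simp: adj_def insert_commute)
    show "\<not> adj a a" for a using ne[of a a] by (auto simp: adj_def)
    show "a \<in> S \<union> (\<Union>s\<in>S. nbhd E s)" if "adj a b" for a b
      using that by (auto simp: adj_def nbhd_def insert_commute)
  qed
  obtain \<omega> :: "'a set \<Rightarrow> int" where \<omega>: "\<And>a b. adj a b \<Longrightarrow> card (G.component a) \<ge> 3 \<Longrightarrow>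
    \<omega> {a, b} \<in> {1, 2, 3} \<and> (\<Sum>w\<in>G.N a. \<omega> {a, w}) \<noteq> (\<Sum>w\<in>G.N b. \<omega> {b, w})"
    using G.weighting_exists by blast
  \<comment> \<open>The default 1 only affects edges for which \<open>\<omega>\<close> guarantees
    nothing: those outside the retained graph or in its small components.\<close>
  define \<omega>' where "\<omega>' e = (if \<omega> e \<in> {1, 2, 3} then nat (\<omega> e) else 1)" for e
  have N: "G.N s = nbhd E s" if "s \<in> S" for s using that by (auto simp: adj_def nbhd_def)
  have wsum: "int (wsum E \<omega>' s) = (\<Sum>w\<in>G.N s. \<omega> {s, w})" if s: "s \<in> S" "card (G.component s) \<ge> 3" for s
  proof -
    have "int (\<omega>' {s, w}) = \<omega> {s, w}" if "w \<in> nbhd E s" for w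
    proof -
      have "adj s w" using s that by (simp add: adj_def nbhd_def)
      then have "\<omega> {s, w} \<in> {1, 2, 3}" using \<omega> s(2) by blast
      then show ?thesis by (auto simp: \<omega>'_def)
    qed
    then show ?thesis unfolding wsum_def N[OF s(1)] by simp
  qed
  have "wsum E \<omega>' u \<noteq> wsum E \<omega>' v" if uv: "(u, v) \<in> J" for u v
  proof -
    have e: "{u, v} \<in> E" using J(2)[OF uv] by blast
    have S: "u \<in> S" "v \<in> S" using uv by (force simp: S_def)+
    have auv: "adj u v" using e S by (simp add: adj_def)
    have "v \<in> nbhd E u" "u \<in> nbhd E v" using e by (auto simp: nbhd_def insert_commute)
    moreover have "\<not> (nbhd E u = {v} \<and> nbhd E v = {u})"
      using noiso e unfolding has_isolated_edge_def by blast
    ultimately obtain w where w: "w \<in> nbhd E u \<and> w \<noteq> v \<or> w \<in> nbhd E v \<and> w \<noteq> u" by blast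
    have "adj u w \<and> w \<noteq> v \<or> adj v w \<and> w \<noteq> u" using w S by (auto simp: adj_def nbhd_def)
    moreover have "a \<noteq> b" if "adj a b" for a b using ne that by (auto simp: adj_def)
    ultimately have w3: "card {u, v, w} = 3" using auv by (auto simp: card_insert_if)
    have "{u, v, w} \<subseteq> G.component u"
    proof -
      have "adj\<^sup>*\<^sup>* u v" using auv by blast
      moreover have "adj\<^sup>*\<^sup>* u w"
        using \<open>adj u w \<and> w \<noteq> v \<or> adj v w \<and> w \<noteq> u\<close> \<open>adj\<^sup>*\<^sup>* u v\<close> by (auto intro: rtranclp.rtrancl_into_rtrancl)
      ultimately show ?thesis by (simp add: G.component_def)
    qed
    moreover have "finite (G.component u)"
      using G.component_V[OF G.adj_V[OF auv]] G.finV by (rule finite_subset)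
    ultimately have c: "card (G.component u) \<ge> 3" using card_mono w3 by metis
    then have "(\<Sum>w\<in>G.N u. \<omega> {u, w}) \<noteq> (\<Sum>w\<in>G.N v. \<omega> {v, w})" using \<omega>[OF auv] by blast
    then show ?thesis
      using wsum[OF S(1) c] wsum[OF S(2) c[unfolded G.component_eq[OF auv]]] by auto
  qed
  moreover have "\<omega>' e \<in> {1, 2, 3}" for e by (auto simp: \<omega>'_def)
  ultimately show ?thesis by blast
qed

theorem theorem2:
  fixes V :: "'a set" and E :: "'a set set"
  assumes "simple_graph V E"
    and "\<not> has_isolated_edge E"
  shows "\<exists>\<omega> :: 'a set \<Rightarrow> nat. (\<forall>e\<in>E. \<omega> e \<in> {1, 2, 3}) \<and>
           (\<forall>u v. {u, v} \<in> E \<longrightarrow>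
              \<not> same_wdeg E \<omega> u v \<or>
              (infinite (nbhd E u) \<and> infinite (nbhd E v) \<and> nbhd E u \<approx> nbhd E v))"
proof -
  \<comment> \<open>If just one end has infinite degree, \<open>same_wdeg\<close> fails anyway; if
    both have, it yields the permitted exception.\<close>
  define I where "I = {(u, v). {u, v} \<in> E \<and> finite (nbhd E u) \<and> finite (nbhd E v)}"
  define d where "d = (\<lambda>(u, v). (\<lambda>w. {u, w}) ` nbhd E u \<union> (\<lambda>w. {v, w}) ` nbhd E v)"
  have "\<exists>\<omega> :: 'a set \<Rightarrow> nat. (\<forall>e\<in>E. \<omega> e \<in> {1, 2, 3}) \<and> (\<forall>c\<in>I. case c of (u, v) \<Rightarrow> wsum E \<omega> u \<noteq> wsum E \<omega> v)"
  proof (rule finite_choice_compactness[where d = d])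
    show "finite {1, 2, 3 :: nat}" by simp
    show "finite (d c) \<and> d c \<subseteq> E" if "c \<in> I" for c
      using that by (auto simp: I_def d_def nbhd_def)
    show "\<exists>f. (\<forall>e\<in>E. f e \<in> {1, 2, 3 :: nat}) \<and> (\<forall>c\<in>J. case c of (u, v) \<Rightarrow> wsum E f u \<noteq> wsum E f v)"
      if "finite J" "J \<subseteq> I" for J
    proof (rule finite_constraints_weighting[OF assms that(1)])
      show "{u, v} \<in> E \<and> finite (nbhd E u) \<and> finite (nbhd E v)" if "(u, v) \<in> J" for u v
        using that \<open>J \<subseteq> I\<close> by (auto simp: I_def)
    qed
    fix c and f g :: "'a set \<Rightarrow> nat"
    assume c: "c \<in> I" and fg: "\<And>e. e \<in> d c \<Longrightarrow> f e = g e"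
      and f: "case c of (u, v) \<Rightarrow> wsum E f u \<noteq> wsum E f v"
    obtain u v where uv: "c = (u, v)" by (cases c)
    have "wsum E f u = wsum E g u" "wsum E f v = wsum E g v"
      unfolding wsum_def by (rule sum.cong; use fg in \<open>auto simp: d_def uv\<close>)+
    then show "case c of (u, v) \<Rightarrow> wsum E g u \<noteq> wsum E g v" using f uv by simp
  qed
  then obtain \<omega> :: "'a set \<Rightarrow> nat" where \<omega>: "\<forall>e\<in>E. \<omega> e \<in> {1, 2, 3}"
    "\<And>u v. (u, v) \<in> I \<Longrightarrow> wsum E \<omega> u \<noteq> wsum E \<omega> v" by blast
  show ?thesis
  proof (intro exI[of _ \<omega>] conjI \<omega>(1) allI impI)
    fix u v assume "{u, v} \<in> E"
    then show "\<not> same_wdeg E \<omega> u v \<or> (infinite (nbhd E u) \<and> infinite (nbhd E v) \<and> nbhd E u \<approx> nbhd E v)"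
      using \<omega>(2)[of u v] unfolding same_wdeg_def I_def by blast
  qed
qed

end
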